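(* Let $\Bbbk$ be a field; all Hopf algebras are over $\Bbbk$. (1) Let $H$ be an amenable cocommutative Hopf algebra. Then every Hopf subalgebra $K\le H$ is amenable. (2) Let $H=\bigcup_{i\in I}H_i$ be a Hopf algebra that is a directed union of Hopf subalgebras $H_i$, each of which is amenable. Then $H$ is amenable. (3) Every Hopf algebra $H$ that is locally of subexponential growth is amenable; in particular, every commutative Hopf algebra is amenable.
   Context: For subspaces $F,E$ of an algebra, $FE$ denotes the linear span of the products $fe$. A Hopf algebra $H$ is called amenable if for every finite-dimensional subspace $F\le H$ and every $\epsilon>0$ there exists a finite-dimensional subcoalgebra $E\le H$ with $\dim\frac{E+FE}{E}<\epsilon\dim E$ (the strict inequality forces $E\neq0$). For a finite-dimensional subspace $F\le H$ put $B_0=\Bbbk 1$ and $B_{n+1}=B_n+FB_n$ for $n\ge0$. $H$ is locally of subexponential growth if $\limsup_{n\to\infty}(\dim B_n)^{1/n}=1$ for every finite-dimensional $F\le H$. *)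

theory Defs
  imports Complex_Main "HOL-Library.Poly_Mapping" "HOL-Library.Set_Algebras"
    "HOL-Library.Extended_Real" "HOL-Library.Liminf_Limsup"
begin

definition fscale :: "'k::field \<Rightarrow> ('b \<Rightarrow>\<^sub>0 'k) \<Rightarrow> ('b \<Rightarrow>\<^sub>0 'k)"
  where "fscale c u = Poly_Mapping.map ((*) c) u"

lemma lookup_fscale [simp]: "Poly_Mapping.lookup (fscale c u) p = c * Poly_Mapping.lookup u p"
  unfolding fscale_def by (simp add: Poly_Mapping.map.rep_eq when_def)

global_interpretation free: vector_space fscale
  by standard (auto intro!: poly_mapping_eqI simp: lookup_add algebra_simps)

text \<open>Linear extension of a map given on the basis of a free vector space.\<close>

definition lin_ext ::
    "('k \<Rightarrow> 'c \<Rightarrow> 'c) \<Rightarrow> ('b \<Rightarrow> 'c) \<Rightarrow> ('b \<Rightarrow>\<^sub>0 'k::field) \<Rightarrow> 'c::ab_group_add"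
  where "lin_ext s f u = (\<Sum>p\<in>Poly_Mapping.keys u. s (Poly_Mapping.lookup u p) (f p))"

abbreviation basis_vec :: "'b \<Rightarrow> ('b \<Rightarrow>\<^sub>0 'k::field)"
  where "basis_vec p \<equiv> Poly_Mapping.single p 1"


locale kspace = vector_space scale
  for scale :: "'k::field \<Rightarrow> 'b::ab_group_add \<Rightarrow> 'b"  (infixr \<open>*s\<close> 75)
begin

definition fd_subspace :: "'b set \<Rightarrow> bool"
  where "fd_subspace V \<longleftrightarrow> subspace V \<and> (\<exists>B. finite B \<and> V = span B)"

text \<open>The cosets of the elements of \<open>B\<close> are pairwise distinct and form a basis of \<open>V / E\<close>.\<close>

definition quotient_basis :: "'b set \<Rightarrow> 'b set \<Rightarrow> 'b set \<Rightarrow> bool"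
  where "quotient_basis V E B \<longleftrightarrow>
    B \<subseteq> V \<and> V \<subseteq> span (E \<union> B) \<and> (\<forall>b\<in>B. b \<notin> span (E \<union> (B - {b})))"

definition dim_quot :: "'b set \<Rightarrow> 'b set \<Rightarrow> nat"
  where "dim_quot V E = card (SOME B. quotient_basis V E B)"

lemma card_quotient_basis:
  assumes V: "fd_subspace V" and E: "subspace E" "E \<subseteq> V" and B: "quotient_basis V E B"
  shows "finite B" "card B + dim E = dim V"
proof -
  obtain S where S: "finite S" "V = span S"
    using V unfolding fd_subspace_def by blast
  obtain A where A: "A \<subseteq> E" "independent A" "E \<subseteq> span A"
    using maximal_independent_subset by blast
  have sA: "span A = E"
    using A E by (simp add: span_subspace)
  have sE: "span E = E"
    using span_span[of A] unfolding sA .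
  have sAB: "span (A \<union> B') = span (E \<union> B')" for B'
    unfolding span_Un sA sE ..
  have disj: "A \<inter> B = {}"
  proof -
    have "b \<notin> E" if "b \<in> B" for b
      using B that span_superset[of "E \<union> (B - {b})"] unfolding quotient_basis_def by blast
    thus ?thesis using A(1) by blast
  qed
  have ext: "independent (A \<union> C)" if "finite C" "C \<subseteq> B" for C
    using that
  proof (induction C rule: finite_induct)
    case empty
    then show ?case using A by simp
  next
    case (insert c C)
    have "span (A \<union> C) \<subseteq> span (E \<union> (B - {c}))"
      unfolding sAB using insert by (intro span_mono) auto
    hence "c \<notin> span (A \<union> C)"
      using B insert unfolding quotient_basis_def by blast
    then show ?case
      using insert by (simp add: independent_insertI)
  qed
  have ind: "independent (A \<union> B)"
  proof
    assume "dependent (A \<union> B)"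
    then obtain T u where T: "finite T" "T \<subseteq> A \<union> B" "(\<Sum>v\<in>T. u v *s v) = 0" "\<exists>v\<in>T. u v \<noteq> 0"
      unfolding dependent_explicit by blast
    hence "dependent T" unfolding dependent_explicit by blast
    moreover have "T \<subseteq> A \<union> (T \<inter> B)" using T by blast
    ultimately show False
      using ext[of "T \<inter> B"] T(1) independent_mono by blast
  qed
  have sub: "A \<union> B \<subseteq> V" using A E B unfolding quotient_basis_def by blast
  have fin: "finite (A \<union> B)"
    using independent_span_bound[OF S(1) ind] sub S(2) by simp
  show "finite B" using fin by simp
  have "V \<subseteq> span (A \<union> B)"
    using B sAB unfolding quotient_basis_def by simp
  hence "dim V = card (A \<union> B)"
    using dim_unique[OF sub _ ind refl] by simp
  also have "\<dots> = card A + card B" using fin disj by (simp add: card_Un_disjoint)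
  also have "card A = dim E" using dim_unique[OF A(1) A(3) A(2) refl] by simp
  finally show "card B + dim E = dim V" by simp
qed

lemma dim_quot_eq:
  assumes V: "fd_subspace V" and E: "subspace E" "E \<subseteq> V"
  shows "dim_quot V E = dim V - dim E"
proof -
  obtain A where A: "A \<subseteq> E" "independent A" "E \<subseteq> span A"
    using maximal_independent_subset by blast
  obtain B where B: "A \<subseteq> B" "B \<subseteq> V" "independent B" "V \<subseteq> span B"
    using maximal_independent_subset_extend[of A V] A E by blast
  have sA: "span A = E"
    using A E by (simp add: span_subspace)
  have sE: "span E = E"
    using span_span[of A] unfolding sA .
  have sAB: "span (E \<union> B') = span (A \<union> B')" for B'
    unfolding span_Un sA sE ..
  have "quotient_basis V E (B - A)"
    unfolding quotient_basis_def sAB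
  proof (intro conjI ballI)
    show "B - A \<subseteq> V" using B by blast
    show "V \<subseteq> span (A \<union> (B - A))" using B by (simp add: Un_absorb1)
    fix b assume b: "b \<in> B - A"
    hence "A \<union> (B - A - {b}) = B - {b}" using B by blast
    thus "b \<notin> span (A \<union> (B - A - {b}))"
      using B(3) b unfolding dependent_def by auto
  qed
  hence "quotient_basis V E (SOME B. quotient_basis V E B)" by (rule someI)
  from card_quotient_basis(2)[OF V E this] show ?thesis
    unfolding dim_quot_def by simp
qed

text \<open>
  \<open>V \<otimes> V\<close> is the free vector space on \<open>V \<times> V\<close> modulo the multilinearity relations, and
  likewise for \<open>V \<otimes> V \<otimes> V\<close>. Tensors are handled through representatives in the free vector
  space; \<open>tensor2_eq\<close> and \<open>tensor3_eq\<close> state that two representatives have the same class.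
\<close>

definition linearity_relations :: "('b \<Rightarrow> ('c \<Rightarrow>\<^sub>0 'k)) \<Rightarrow> ('c \<Rightarrow>\<^sub>0 'k) set"
  where "linearity_relations \<iota> =
    {\<iota> (x + y) - \<iota> x - \<iota> y | x y. True} \<union> {\<iota> (c *s x) - fscale c (\<iota> x) | c x. True}"

definition tensor2_eq :: "(('b \<times> 'b) \<Rightarrow>\<^sub>0 'k) \<Rightarrow> (('b \<times> 'b) \<Rightarrow>\<^sub>0 'k) \<Rightarrow> bool"
  where "tensor2_eq u v \<longleftrightarrow> u - v \<in> free.span
    (\<Union>y. linearity_relations (\<lambda>x. basis_vec (x, y)) \<union>
         linearity_relations (\<lambda>x. basis_vec (y, x)))"

definition tensor3_eq :: "(('b \<times> 'b \<times> 'b) \<Rightarrow>\<^sub>0 'k) \<Rightarrow> (('b \<times> 'b \<times> 'b) \<Rightarrow>\<^sub>0 'k) \<Rightarrow> bool"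
  where "tensor3_eq u v \<longleftrightarrow> u - v \<in> free.span
    (\<Union>y z. linearity_relations (\<lambda>x. basis_vec (x, y, z)) \<union>
           linearity_relations (\<lambda>x. basis_vec (y, x, z)) \<union>
           linearity_relations (\<lambda>x. basis_vec (y, z, x)))"

end


text \<open>
  \<open>comult x\<close> is a representative of the tensor \<open>\<Delta>(x) \<in> V \<otimes> V\<close>. The representative is
  arbitrary: it is constrained only up to \<open>tensor2_eq\<close>, and all notions below depend only on
  its class. The axioms are coassociativity
  \<open>\<Sum> \<Delta>(x\<^sub>1) \<otimes> x\<^sub>2 = \<Sum> x\<^sub>1 \<otimes> \<Delta>(x\<^sub>2)\<close> and the counit laws
  \<open>\<Sum> \<epsilon>(x\<^sub>1) x\<^sub>2 = x = \<Sum> \<epsilon>(x\<^sub>2) x\<^sub>1\<close>, where \<open>\<Delta>(x) = \<Sum> x\<^sub>1 \<otimes> x\<^sub>2\<close>.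
\<close>

locale coalgebra = kspace scale
  for scale :: "'k::field \<Rightarrow> 'a::ab_group_add \<Rightarrow> 'a" +
  fixes comult :: "'a \<Rightarrow> (('a \<times> 'a) \<Rightarrow>\<^sub>0 'k)"
    and counit :: "'a \<Rightarrow> 'k"
  assumes comult_add: "tensor2_eq (comult (x + y)) (comult x + comult y)"
    and comult_scale: "tensor2_eq (comult (scale c x)) (fscale c (comult x))"
    and counit_linear: "Vector_Spaces.linear scale (*) counit"
    and coassoc: "tensor3_eq
      (lin_ext fscale (\<lambda>(a, b). lin_ext fscale (\<lambda>(c, d). basis_vec (c, d, b)) (comult a)) (comult x))
      (lin_ext fscale (\<lambda>(a, b). lin_ext fscale (\<lambda>(c, d). basis_vec (a, c, d)) (comult b)) (comult x))"
    and counit_left: "lin_ext scale (\<lambda>(a, b). scale (counit a) b) (comult x) = x"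
    and counit_right: "lin_ext scale (\<lambda>(a, b). scale (counit b) a) (comult x) = x"
begin

text \<open>\<open>\<Delta>(E)\<close> is contained in the image of \<open>E \<otimes> E\<close> in \<open>V \<otimes> V\<close>.\<close>

definition subcoalgebra :: "'a set \<Rightarrow> bool"
  where "subcoalgebra E \<longleftrightarrow> subspace E \<and>
    (\<forall>x\<in>E. \<exists>u. Poly_Mapping.keys u \<subseteq> E \<times> E \<and> tensor2_eq (comult x) u)"

definition cocommutative :: bool
  where "cocommutative \<longleftrightarrow>
    (\<forall>x. tensor2_eq (comult x) (lin_ext fscale (\<lambda>(a, b). basis_vec (b, a)) (comult x)))"

end


locale unital_algebra = kspace scale
  for scale :: "'k::field \<Rightarrow> 'a::ring_1 \<Rightarrow> 'a" +
  assumes scale_mult_left: "scale c x * y = scale c (x * y)"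
    and scale_mult_right: "x * scale c y = scale c (x * y)"
begin

definition prod_span :: "'a set \<Rightarrow> 'a set \<Rightarrow> 'a set"
  where "prod_span F E = span {f * e | f e. f \<in> F \<and> e \<in> E}"

definition subalgebra :: "'a set \<Rightarrow> bool"
  where "subalgebra K \<longleftrightarrow> subspace K \<and> 1 \<in> K \<and> (\<forall>x\<in>K. \<forall>y\<in>K. x * y \<in> K)"

primrec growth_space :: "'a set \<Rightarrow> nat \<Rightarrow> 'a set"
  where
    "growth_space F 0 = span {1}"
  | "growth_space F (Suc n) = growth_space F n + prod_span F (growth_space F n)"

definition locally_subexp_growth :: bool
  where "locally_subexp_growth \<longleftrightarrow> (\<forall>F. fd_subspace F \<longrightarrow>
    limsup (\<lambda>n. ereal (root n (real (dim (growth_space F n))))) = 1)"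

end


locale bialgebra = coalgebra scale comult counit + unital_algebra scale
  for scale :: "'k::field \<Rightarrow> 'a::ring_1 \<Rightarrow> 'a" and comult counit +
  assumes comult_mult: "tensor2_eq (comult (x * y))
      (lin_ext fscale (\<lambda>(a, b). lin_ext fscale (\<lambda>(c, d). basis_vec (a * c, b * d)) (comult y)) (comult x))"
    and comult_one: "tensor2_eq (comult 1) (basis_vec (1, 1))"
    and counit_mult: "counit (x * y) = counit x * counit y"
    and counit_one: "counit 1 = 1"


locale hopf_algebra = bialgebra scale comult counit
  for scale :: "'k::field \<Rightarrow> 'a::ring_1 \<Rightarrow> 'a" and comult counit +
  fixes antipode :: "'a \<Rightarrow> 'a"
  assumes antipode_linear: "Vector_Spaces.linear scale scale antipode"
    and antipode_left:
      "lin_ext scale (\<lambda>(a, b). antipode a * b) (comult x) = scale (counit x) 1"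
    and antipode_right:
      "lin_ext scale (\<lambda>(a, b). a * antipode b) (comult x) = scale (counit x) 1"
begin

definition hopf_subalgebra :: "'a set \<Rightarrow> bool"
  where "hopf_subalgebra K \<longleftrightarrow>
    subalgebra K \<and> subcoalgebra K \<and> (\<forall>x\<in>K. antipode x \<in> K)"

text \<open>
  Amenability of a Hopf subalgebra \<open>K\<close>, as a Hopf algebra in its own right; the whole Hopf
  algebra is the case \<open>K = UNIV\<close>. The subcoalgebras of \<open>K\<close> are the subcoalgebras of the ambient
  Hopf algebra that are contained in \<open>K\<close>, as \<open>K \<otimes> K\<close> embeds into the ambient tensor square.
\<close>

definition amenable :: "'a set \<Rightarrow> bool"
  where "amenable K \<longleftrightarrow>
    (\<forall>F \<epsilon>. fd_subspace F \<and> F \<subseteq> K \<and> (0::real) < \<epsilon> \<longrightarrow>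
      (\<exists>E. fd_subspace E \<and> subcoalgebra E \<and> E \<subseteq> K \<and>
        real (dim_quot (E + prod_span F E) E) < \<epsilon> * real (dim E)))"

end

end

(*
  Part (1). Suppose K is not amenable: some C \<le> K satisfies dim CE \<ge> c dim E for all
  finite-dimensional subcoalgebras E of K, with c > 1. Call a (K,H)-Hopf module expanding if its
  finite-dimensional subcomodules satisfy the same inequality. This property passes to extensions
  and to unions of chains, so it suffices to show that every proper Hopf submodule N of H has an
  expanding Hopf submodule N'/N \<noteq> 0 of H/N. A simple subcomodule of H/N is isomorphic to a simple
  subcoalgebra D, whose dual is a field, and induces a nonzero map of Hopf modules from K \<otimes> D to
  H/N. Call its kernel R. The intersection of the D*-translates of R is a D*-stable Hopf submodule,
  hence 0, and in a minimal family of translates with zero intersection the intersection of all but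
  one is nonzero; a translate P of it satisfies P \<inter> R = 0, so that P embeds into H/N. Finally
  K \<otimes> D is expanding: the function Z \<mapsto> dim CZ - c dim Z is submodular, so among its minimizers
  inside a D*-stable subcomodule the least one is D*-stable, hence a K-subcomodule of a direct sum
  of copies of K, for which the inequality follows from the one in K by a flag.

  Part (2). A finite-dimensional F lies in some H_i.

  Part (3). F and 1 lie in a finite-dimensional subcoalgebra C. All the B_n of C are subcoalgebras,
  so if none of them satisfied the amenability condition, dim B_n would grow exponentially; in the
  commutative case dim B_n is bounded by a number of monomials polynomial in n.
*)

theory Submission
  imports Defs "HOL-Library.Function_Algebras" "HOL-Library.FuncSet"
begin

subsection \<open>Finite-dimensional subspaces\<close>

text \<open>The obstacle in part (1) is that \<open>K \<otimes> D\<close> carries two coactions. The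
  map to \<open>H / N\<close> respects the diagonal one, while the inequality is known for the one
  on the first factor, which makes \<open>K \<otimes> D\<close> a direct sum of copies of
  \<open>K\<close>. A subspace stable under the diagonal coaction and under the dual of
  \<open>D\<close> is stable under the first-factor coaction as well, because the antipode cancels.
  If \<open>D\<close> were one-dimensional, its dual would be the ground field and stability under
  it would come for free; over a general field it has to be produced twice, once for the kernel
  \<open>R\<close> (by intersecting translates) and once for a subspace violating the inequality (by
  passing to the least minimizer). Cocommutativity makes the dual algebra commutative, and
  simplicity of \<open>D\<close> makes its image on \<open>D\<close> a field, so translations are
  either zero or invertible on \<open>K \<otimes> D\<close>. Quotients never appear as types: a map
  into \<open>H / N\<close> is a linear map into \<open>H\<close> whose compatibilities hold modulo
  \<open>N\<close>, and tensors are used only through their values under bilinear and trilinear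
  maps.\<close>

context kspace
begin

lemma kspace_pair_self: "vector_space_pair scale scale"
  by unfold_locales

lemma vector_space_pair_functional: "vector_space_pair scale ((*) :: 'k \<Rightarrow> 'k \<Rightarrow> 'k)"
  by unfold_locales (auto simp: algebra_simps)

lemma fd_subspace_span: "finite B \<Longrightarrow> fd_subspace (span B)"
  unfolding fd_subspace_def by blast

lemma fd_subspaceD: "fd_subspace V \<Longrightarrow> subspace V"
  unfolding fd_subspace_def by blast

lemma fd_basis:
  assumes "fd_subspace V"
  obtains B where "finite B" "independent B" "span B = V" "card B = dim V"
proof -
  obtain S where S: "finite S" "V = span S" "subspace V"
    using assms unfolding fd_subspace_def by blast
  obtain B where B: "B \<subseteq> V" "independent B" "V \<subseteq> span B" "card B = dim V"
    using basis_exists by blast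
  have "finite B" using independent_span_bound[OF S(1) B(2)] B(1) S(2) by blast
  moreover have "span B = V" using B S(3) span_subspace by blast
  ultimately show ?thesis using B that by blast
qed

lemma fd_subspace_subset:
  assumes "fd_subspace V" "subspace U" "U \<subseteq> V"
  shows "fd_subspace U"
proof -
  obtain S where S: "finite S" "V = span S"
    using assms unfolding fd_subspace_def by blast
  obtain B where B: "B \<subseteq> U" "independent B" "U \<subseteq> span B" "card B = dim U"
    using basis_exists by blast
  have "finite B" using independent_span_bound[OF S(1) B(2)] B(1) S(2) assms by blast
  moreover have "span B = U" using B assms(2) span_subspace by blast
  ultimately show ?thesis unfolding fd_subspace_def using assms(2) by blast
qed

lemma fd_dim_mono:
  assumes "fd_subspace V" "U \<subseteq> V"
  shows "dim U \<le> dim V"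
proof -
  obtain B where "finite B" "span B = V" "card B = dim V"
    using fd_basis[OF assms(1)] by blast
  thus ?thesis using dim_le_card[of U B] assms by simp
qed

lemma fd_dim_eq:
  assumes "fd_subspace V" "subspace U" "U \<subseteq> V" "dim V \<le> dim U"
  shows "U = V"
proof -
  obtain B where B: "finite B" "independent B" "span B = U" "card B = dim U"
    using fd_basis[OF fd_subspace_subset[OF assms(1-3)]] by blast
  have "V \<subseteq> span B"
  proof
    fix x assume x: "x \<in> V"
    show "x \<in> span B"
    proof (rule ccontr)
      assume n: "x \<notin> span B"
      hence i: "independent (insert x B)" using B independent_insertI by blast
      have "insert x B \<subseteq> V" using x B assms span_superset by blast
      hence "card (insert x B) \<le> dim V"
        using fd_dim_mono[OF assms(1), of "insert x B"] dim_eq_card_independent[OF i] by simp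
      moreover have "x \<notin> B" using n span_base by blast
      ultimately show False using B assms(4) by simp
    qed
  qed
  thus ?thesis using B assms by blast
qed

lemma fd_subspace_sum: "fd_subspace U \<Longrightarrow> fd_subspace V \<Longrightarrow> fd_subspace (U + V)"
proof -
  assume a: "fd_subspace U" "fd_subspace V"
  then obtain A B where "finite A" "U = span A" "finite B" "V = span B"
    unfolding fd_subspace_def by blast
  moreover have "span A + span B = span (A \<union> B)"
    unfolding span_Un set_plus_def by blast
  ultimately show ?thesis using fd_subspace_span[of "A \<union> B"] by simp
qed

lemma subspace_plus: "subspace U \<Longrightarrow> subspace V \<Longrightarrow> subspace (U + V)"
proof -
  assume "subspace U" "subspace V"
  moreover have "U + V = {x + y |x y. x \<in> U \<and> y \<in> V}" unfolding set_plus_def by blast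
  ultimately show ?thesis using subspace_sums by simp
qed

lemma fd_subspace_finite_union:
  assumes "finite X" "\<And>x. x \<in> X \<Longrightarrow> fd_subspace (V x)"
  shows "fd_subspace (span (\<Union>x\<in>X. V x))"
proof -
  have "\<forall>x\<in>X. \<exists>B. finite B \<and> V x = span B" using assms unfolding fd_subspace_def by blast
  then obtain B where B: "\<And>x. x \<in> X \<Longrightarrow> finite (B x) \<and> V x = span (B x)" by metis
  have "span (\<Union>x\<in>X. V x) = span (\<Union>x\<in>X. B x)"
  proof (rule span_eq[THEN iffD2], intro conjI)
    have "V x \<subseteq> span (\<Union>x\<in>X. B x)" if "x \<in> X" for x
      using B[OF that] span_mono[of "B x" "\<Union>x\<in>X. B x"] that by blast
    thus "(\<Union>x\<in>X. V x) \<subseteq> span (\<Union>x\<in>X. B x)" by blast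
    have "B x \<subseteq> V x" if "x \<in> X" for x using B[OF that] span_superset by blast
    thus "(\<Union>x\<in>X. B x) \<subseteq> span (\<Union>x\<in>X. V x)" using span_superset[of "\<Union>x\<in>X. V x"] by blast
  qed
  thus ?thesis using fd_subspace_span[of "\<Union>x\<in>X. B x"] assms B by simp
qed

text \<open>Take the identity minus a projection onto \<open>N\<close>. Such a \<open>p\<close>
  replaces the quotient map by \<open>N\<close>, with values in the same space.\<close>

lemma linear_with_kernel:
  assumes "subspace N"
  obtains p where "Vector_Spaces.linear scale scale p" "\<And>x. p x = 0 \<longleftrightarrow> x \<in> N"
proof -
  interpret vector_space_pair scale scale by (rule kspace_pair_self)
  obtain g where g: "range g \<subseteq> N" "Vector_Spaces.linear scale scale g" "\<forall>v\<in>N. g (id v) = v"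
    using linear_exists_left_inverse_on[of id N] assms linear_id by auto
  show ?thesis
  proof (rule that[of "\<lambda>x. x - g x"])
    show "Vector_Spaces.linear scale scale (\<lambda>x. x - g x)"
      using linear_compose_sub[OF linear_ident g(2)] .
    show "x - g x = 0 \<longleftrightarrow> x \<in> N" for x using g by auto
  qed
qed

lemma functional_separates:
  assumes "subspace N" "t \<notin> N"
  obtains l where "Vector_Spaces.linear scale (*) l" "\<And>x. x \<in> N \<Longrightarrow> l x = 0" "l t = 1"
proof -
  interpret P: vector_space_pair scale "(*) :: 'k \<Rightarrow> 'k \<Rightarrow> 'k" by (rule vector_space_pair_functional)
  obtain p where p: "Vector_Spaces.linear scale scale p" "\<And>x. p x = 0 \<longleftrightarrow> x \<in> N"
    using linear_with_kernel[OF assms(1)] by blast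
  have "independent {p t}" using p assms by simp
  then obtain h where h: "Vector_Spaces.linear scale (*) h" "h (p t) = 1"
    using P.linear_independent_extend[of "{p t}" "\<lambda>_. 1"] by auto
  interpret h: Vector_Spaces.linear scale "(*)" h by (rule h)
  show ?thesis
  proof (rule that[of "h \<circ> p"])
    show "Vector_Spaces.linear scale (*) (h \<circ> p)"
      using Vector_Spaces.linear_compose[OF p(1) h(1)] .
    show "(h \<circ> p) x = 0" if "x \<in> N" for x
      using p(2)[THEN iffD2, OF that] by simp
  qed (use h in simp)
qed

lemma functional_zero_imp_zero:
  assumes "\<And>l. Vector_Spaces.linear scale (*) l \<Longrightarrow> l x = 0"
  shows "x = 0"
  using functional_separates[of "{0}" x] assms by (metis singletonD subspace_single_0 zero_neq_one)

text \<open>The coordinates refer to a basis of the whole space that extends \<open>B\<close>, so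
  each \<open>\<psi> b\<close> is a functional on everything and can act through the
  coproduct.\<close>

lemma dual_basis:
  assumes "fd_subspace V"
  obtains B \<psi> where "finite B" "independent B" "span B = V"
    "\<And>b. Vector_Spaces.linear scale (*) (\<psi> b)"
    "\<And>b c. b \<in> B \<Longrightarrow> c \<in> B \<Longrightarrow> \<psi> b c = (if b = c then 1 else 0)"
    "\<And>v. v \<in> V \<Longrightarrow> (\<Sum>b\<in>B. \<psi> b v *s b) = v"
proof -
  obtain B where B: "finite B" "independent B" "span B = V"
    using fd_basis[OF assms] by blast
  let ?E = "extend_basis B"
  have E: "independent ?E" "span ?E = UNIV" "B \<subseteq> ?E"
    using B independent_extend_basis span_extend_basis extend_basis_superset by auto
  let ?\<psi> = "\<lambda>b v. representation ?E v b"
  show ?thesis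
  proof (rule that[of B ?\<psi>])
    show "Vector_Spaces.linear scale (*) (?\<psi> b)" for b
      using E by unfold_locales (auto simp: representation_add representation_scale algebra_simps)
    show "?\<psi> b c = (if b = c then 1 else 0)" if "b \<in> B" "c \<in> B" for b c
      using E representation_basis[of ?E c] that by auto
    show "(\<Sum>b\<in>B. ?\<psi> b v *s b) = v" if "v \<in> V" for v
    proof -
      have "representation ?E v = representation B v"
        using representation_extend[OF E(1), of v B] E B that by simp
      thus ?thesis
        using sum_representation_eq[OF B(2), of v B] B that by simp
    qed
  qed (use B in auto)
qed

end

section \<open>Rank and nullity on finite-dimensional subspaces\<close>

locale kspace_pair = k1: kspace s1 + k2: kspace s2
  for s1 :: "'k::field \<Rightarrow> 'b::ab_group_add \<Rightarrow> 'b" and s2 :: "'k \<Rightarrow> 'c::ab_group_add \<Rightarrow> 'c"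
begin

sublocale vector_space_pair s1 s2
  by unfold_locales

lemma fd_image:
  assumes "Vector_Spaces.linear s1 s2 q" "k1.fd_subspace U"
  shows "k2.fd_subspace (q ` U)"
proof -
  obtain B where B: "finite B" "U = k1.span B" using assms unfolding k1.fd_subspace_def by blast
  have "q ` U = k2.span (q ` B)" using linear_span_image[OF assms(1)] B by simp
  thus ?thesis using k2.fd_subspace_span[of "q ` B"] B by simp
qed

lemma rank_nullity:
  assumes q: "Vector_Spaces.linear s1 s2 q" and U: "k1.fd_subspace U"
  shows "k1.dim U = k2.dim (q ` U) + k1.dim (U \<inter> {x. q x = 0})"
proof -
  interpret q: Vector_Spaces.linear s1 s2 q by fact
  let ?W = "U \<inter> {x. q x = 0}"
  have sU: "k1.subspace U" using U k1.fd_subspaceD by blast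
  have sW: "k1.subspace ?W" using sU q.subspace_kernel k1.subspace_inter by blast
  obtain A where A: "finite A" "k1.independent A" "k1.span A = ?W" "card A = k1.dim ?W"
    using k1.fd_basis[OF k1.fd_subspace_subset[OF U sW]] by blast
  obtain B where B: "A \<subseteq> B" "B \<subseteq> U" "k1.independent B" "U \<subseteq> k1.span B"
    using k1.maximal_independent_subset_extend[of A U] A(2,3) k1.span_superset[of A] by blast
  have sB: "k1.span B = U" using B sU k1.span_subspace by blast
  obtain S where S: "finite S" "U = k1.span S" using U unfolding k1.fd_subspace_def by blast
  have fB: "finite B" using k1.independent_span_bound[OF S(1) B(3)] B(2) S(2) by blast
  have dB: "k1.dim U = card B" using sB k1.dim_span_eq_card_independent[OF B(3)] by simp
  define C where "C = B - A"
  have iC: "k1.independent C" using B(3) k1.independent_mono C_def by blast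
  have inj: "inj_on q (k1.span C)"
  proof (rule q.inj_on_iff_eq_0[THEN iffD2, rule_format])
    show "k1.subspace (k1.span C)" by simp
    fix x assume x: "x \<in> k1.span C" "q x = 0"
    have "x \<in> U" using x k1.span_mono[of C B] sB C_def by blast
    hence xA: "x \<in> k1.span A" using x A by blast
    show "x = 0"
    proof (rule ccontr)
      assume nz: "x \<noteq> 0"
      \<comment> \<open>The coordinates of \<open>x\<close> over \<open>B\<close> are supported both
        in \<open>A\<close> and in the complement \<open>C\<close>, so they all vanish.\<close>
      have r: "k1.representation B x = k1.representation A x" "k1.representation B x = k1.representation C x"
        using k1.representation_extend[OF B(3) xA B(1)] k1.representation_extend[OF B(3) x(1)]
        unfolding C_def by blast+
      have "k1.representation B x = (\<lambda>_. 0)"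
      proof
        fix b show "k1.representation B x b = 0"
          using r k1.representation_ne_zero[of A x b] k1.representation_ne_zero[of C x b] C_def by auto
      qed
      moreover have "x \<in> k1.span B" using xA k1.span_mono[OF B(1)] by blast
      ultimately show False
        using k1.sum_nonzero_representation_eq[OF B(3), of x] nz by simp
    qed
  qed
  have iq: "k2.independent (q ` C)" using q.independent_injective_image[OF iC inj] .
  have "q ` U = k2.span (q ` B)" using sB q.span_image by simp
  also have "\<dots> = k2.span (q ` C)"
  proof (rule k2.span_eq[THEN iffD2], intro conjI)
    have "q b \<in> k2.span (q ` C)" if "b \<in> B" for b
    proof (cases "b \<in> A")
      case True
      hence "q b = 0" using A(3) k1.span_base by blast
      thus ?thesis using k2.span_zero by simp
    next
      case False
      thus ?thesis using that C_def k2.span_base[of "q b" "q ` C"] by simp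
    qed
    thus "q ` B \<subseteq> k2.span (q ` C)" by blast
    show "q ` C \<subseteq> k2.span (q ` B)" using C_def k2.span_superset by blast
  qed
  finally have "k2.dim (q ` U) = card (q ` C)"
    using k2.dim_span_eq_card_independent[OF iq] by simp
  also have "\<dots> = card C" using inj inj_on_subset[OF _ k1.span_superset] card_image by blast
  finally show ?thesis
    using dB A(4) C_def B(1) fB A(1) card_Diff_subset[of A B] card_mono[of B A] by simp
qed

lemma dim_image_le:
  assumes "Vector_Spaces.linear s1 s2 q" "k1.fd_subspace U"
  shows "k2.dim (q ` U) \<le> k1.dim U"
  using rank_nullity[OF assms] by simp

lemma dim_image_inj:
  assumes q: "Vector_Spaces.linear s1 s2 q" and U: "k1.fd_subspace U"
    and inj: "\<And>x. x \<in> U \<Longrightarrow> q x = 0 \<Longrightarrow> x = 0"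
  shows "k2.dim (q ` U) = k1.dim U"
proof -
  have "U \<inter> {x. q x = 0} \<subseteq> k1.span {}" using inj by auto
  hence "k1.dim (U \<inter> {x. q x = 0}) = 0" using k1.dim_le_card[of _ "{}"] by fastforce
  thus ?thesis using rank_nullity[OF q U] by simp
qed

end

context kspace
begin

text \<open>A linear map with kernel \<open>V\<close> has the same image on \<open>U\<close> and on
  \<open>U + V\<close>; rank-nullity is applied to both.\<close>

lemma dim_plus_inter:
  assumes U: "fd_subspace U" and V: "fd_subspace V"
  shows "dim (U + V) + dim (U \<inter> V) = dim U + dim V"
proof -
  interpret kspace_pair scale scale by unfold_locales
  have s: "subspace U" "subspace V" using assms fd_subspaceD by auto
  obtain p where p: "Vector_Spaces.linear scale scale p" "\<And>x. p x = 0 \<longleftrightarrow> x \<in> V"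
    using linear_with_kernel[OF s(2)] by blast
  interpret p: Vector_Spaces.linear scale scale p by fact
  have 1: "dim U = dim (p ` U) + dim (U \<inter> V)" using rank_nullity[OF p(1) U] p(2) by simp
  have "p ` (U + V) = p ` U"
  proof
    have "p (u + v) = p u" if "v \<in> V" for u v using p(2)[of v] that by (simp add: p.add)
    thus "p ` (U + V) \<subseteq> p ` U" by (auto simp: set_plus_def)
    show "p ` U \<subseteq> p ` (U + V)" using subspace_0[OF s(2)] by (force simp: set_plus_def)
  qed
  moreover have "(U + V) \<inter> V = V" using subspace_0[OF s(1)] by (force simp: set_plus_def)
  ultimately have "dim (U + V) = dim (p ` U) + dim V"
    using rank_nullity[OF p(1) fd_subspace_sum[OF U V]] p(2) by simp
  thus ?thesis using 1 by simp
qed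

end

subsection \<open>Sweedler sums\<close>

lemma lin_ext_superset:
  assumes "vector_space s" "finite S" "Poly_Mapping.keys u \<subseteq> S"
  shows "lin_ext s f u = (\<Sum>p\<in>S. s (Poly_Mapping.lookup u p) (f p))"
proof -
  interpret vector_space s by fact
  show ?thesis unfolding lin_ext_def
    using assms by (intro sum.mono_neutral_left) (auto simp: in_keys_iff)
qed

lemma linear_lin_ext:
  assumes "vector_space s"
  shows "Vector_Spaces.linear fscale s (lin_ext s f)"
proof -
  interpret v: vector_space s by fact
  have add: "lin_ext s f (x + y) = lin_ext s f x + lin_ext s f y" for x y
  proof -
    let ?S = "Poly_Mapping.keys x \<union> Poly_Mapping.keys y"
    have "lin_ext s f z = (\<Sum>p\<in>?S. s (Poly_Mapping.lookup z p) (f p))"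
      if "z \<in> {x, y, x + y}" for z
      using that Poly_Mapping.keys_add[of x y] by (intro lin_ext_superset assms) auto
    thus ?thesis by (simp add: lookup_add v.scale_left_distrib sum.distrib)
  qed
  have scale: "lin_ext s f (fscale c x) = s c (lin_ext s f x)" for c x
  proof -
    have "Poly_Mapping.keys (fscale c x) \<subseteq> Poly_Mapping.keys x"
      by (auto simp: in_keys_iff)
    hence "lin_ext s f (fscale c x) = (\<Sum>p\<in>Poly_Mapping.keys x. s (c * Poly_Mapping.lookup x p) (f p))"
      using lin_ext_superset[OF assms, of "Poly_Mapping.keys x" "fscale c x" f] by simp
    thus ?thesis by (simp add: lin_ext_def v.scale_sum_right)
  qed
  show ?thesis
    unfolding Vector_Spaces.linear_iff using assms add scale free.vector_space_axioms by blast
qed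

lemma lin_ext_single [simp]:
  assumes "vector_space s"
  shows "lin_ext s f (basis_vec p) = f p"
proof -
  interpret v: vector_space s by fact
  show ?thesis by (simp add: lin_ext_def)
qed

lemma linear_lin_ext_comp:
  assumes "Vector_Spaces.linear s s' T"
  shows "T (lin_ext s f u) = lin_ext s' (\<lambda>p. T (f p)) u"
proof -
  interpret Vector_Spaces.linear s s' T by fact
  show ?thesis by (simp add: lin_ext_def sum scale)
qed

lemma lin_ext_basis_vec: "lin_ext fscale basis_vec u = u"
proof (rule poly_mapping_eqI)
  fix p
  have "Poly_Mapping.lookup (lin_ext fscale basis_vec u) p =
    (\<Sum>q\<in>Poly_Mapping.keys u. Poly_Mapping.lookup u q * (if q = p then 1 else 0))"
    unfolding lin_ext_def by (simp add: lookup_sum lookup_single when_def)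
  also have "\<dots> = Poly_Mapping.lookup u p"
    by (simp add: if_distrib[of "\<lambda>x. _ * x"] sum.delta in_keys_iff cong: if_cong)
  finally show "Poly_Mapping.lookup (lin_ext fscale basis_vec u) p = Poly_Mapping.lookup u p" .
qed

section \<open>Bilinear maps and equality of tensors\<close>

context kspace
begin

definition bilin :: "('k \<Rightarrow> 'c::ab_group_add \<Rightarrow> 'c) \<Rightarrow> ('b \<Rightarrow> 'b \<Rightarrow> 'c) \<Rightarrow> bool"
  where "bilin s \<beta> \<longleftrightarrow> (\<forall>y. Vector_Spaces.linear scale s (\<lambda>x. \<beta> x y)) \<and>
    (\<forall>x. Vector_Spaces.linear scale s (\<beta> x))"

lemma vector_space_mult: "vector_space ((*) :: 'k \<Rightarrow> 'k \<Rightarrow> 'k)"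
  by unfold_locales (auto simp: algebra_simps)

text \<open>A bilinear map kills the defining relations of the tensor square. This is what permits
  replacing \<open>comult x\<close> by a representative in a chosen subspace.\<close>

lemma tensor2_eq_imp_lin_ext_eq:
  assumes b: "bilin s \<beta>" and t: "tensor2_eq u v"
  shows "lin_ext s (\<lambda>(a, b). \<beta> a b) u = lin_ext s (\<lambda>(a, b). \<beta> a b) v"
proof -
  have vs: "vector_space s" using b unfolding bilin_def Vector_Spaces.linear_iff by blast
  interpret v: vector_space s by fact
  let ?T = "lin_ext s (\<lambda>(a, b). \<beta> a b)"
  interpret T: Vector_Spaces.linear fscale s ?T by (rule linear_lin_ext[OF vs])
  have b1: "\<beta> (x + y) z = \<beta> x z + \<beta> y z" "\<beta> (scale c x) z = s c (\<beta> x z)" for x y z c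
    using b unfolding bilin_def Vector_Spaces.linear_iff by auto
  have b2: "\<beta> z (x + y) = \<beta> z x + \<beta> z y" "\<beta> z (scale c x) = s c (\<beta> z x)" for x y z c
    using b unfolding bilin_def Vector_Spaces.linear_iff by auto
  have "?T w = 0" if "w \<in> (\<Union>y. linearity_relations (\<lambda>x. basis_vec (x, y)) \<union>
         linearity_relations (\<lambda>x. basis_vec (y, x)))" for w
  proof -
    from that consider x x' y where "w = basis_vec (x + x', y) - basis_vec (x, y) - basis_vec (x', y)"
      | c x y where "w = basis_vec (scale c x, y) - fscale c (basis_vec (x, y))"
      | y x x' where "w = basis_vec (y, x + x') - basis_vec (y, x) - basis_vec (y, x')"
      | c y x where "w = basis_vec (y, scale c x) - fscale c (basis_vec (y, x))"
      unfolding linearity_relations_def by fast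
    thus ?thesis
    proof cases
      case 1
      show ?thesis unfolding 1 T.diff lin_ext_single[OF vs] prod.case b1 by simp
    next
      case 2
      show ?thesis unfolding 2 T.diff T.scale lin_ext_single[OF vs] prod.case b1 by simp
    next
      case 3
      show ?thesis unfolding 3 T.diff lin_ext_single[OF vs] prod.case b2 by simp
    next
      case 4
      show ?thesis unfolding 4 T.diff T.scale lin_ext_single[OF vs] prod.case b2 by simp
    qed
  qed
  hence "?T (u - v) = 0" using t unfolding tensor2_eq_def by (rule T.eq_0_on_span)
  thus ?thesis by (simp add: T.diff)
qed

lemma linearity_relations_add: "\<iota> (x + y) - \<iota> x - \<iota> y \<in> linearity_relations \<iota>"
  and linearity_relations_scale: "\<iota> (c *s x) - fscale c (\<iota> x) \<in> linearity_relations \<iota>"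
  unfolding linearity_relations_def by blast+

text \<open>Bilinear forms separate tensors: a functional on the free space that vanishes on the
  relations but not at \<open>u - v\<close> restricts to a bilinear form on basis vectors.\<close>

lemma tensor2_eqI:
  assumes "\<And>\<beta> :: 'b \<Rightarrow> 'b \<Rightarrow> 'k. bilin (*) \<beta> \<Longrightarrow>
    lin_ext (*) (\<lambda>(a, b). \<beta> a b) u = lin_ext (*) (\<lambda>(a, b). \<beta> a b) v"
  shows "tensor2_eq u v"
proof (rule ccontr)
  assume n: "\<not> tensor2_eq u v"
  interpret f: kspace "fscale :: 'k \<Rightarrow> ('b \<times> 'b \<Rightarrow>\<^sub>0 'k) \<Rightarrow> _" by unfold_locales
  let ?rel = "\<Union>y. linearity_relations (\<lambda>x. basis_vec (x, y)) \<union>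
         linearity_relations (\<lambda>x. basis_vec (y, x))"
  obtain l where l: "Vector_Spaces.linear fscale (*) l" "\<forall>x\<in>free.span ?rel. l x = (0::'k)"
    "l (u - v) = 1"
    by (rule f.functional_separates[OF free.subspace_span n[unfolded tensor2_eq_def]]) blast
  interpret l: Vector_Spaces.linear fscale "(*)" l by fact
  let ?\<beta> = "\<lambda>a b. l (basis_vec (a, b))"
  have z: "l r = 0" if "r \<in> ?rel" for r by (rule l(2)[rule_format, OF free.span_base[OF that]])
  have z1: "l r = 0" if "r \<in> linearity_relations (\<lambda>x. basis_vec (x, y))" for r y
    by (rule z, rule UN_I[of y], simp, rule UnI1, rule that)
  have z2: "l r = 0" if "r \<in> linearity_relations (\<lambda>x. basis_vec (y, x))" for r y
    by (rule z, rule UN_I[of y], simp, rule UnI2, rule that)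
  have p1: "l (basis_vec (x + x', y)) = l (basis_vec (x, y)) + l (basis_vec (x', y))" for x x' y
    using z1[OF linearity_relations_add[of "\<lambda>x. basis_vec (x, y)" x x']]
    unfolding l.diff by (simp add: algebra_simps)
  have p2: "l (basis_vec (y, x + x')) = l (basis_vec (y, x)) + l (basis_vec (y, x'))" for x x' y
    using z2[OF linearity_relations_add[of "\<lambda>x. basis_vec (y, x)" x x']]
    unfolding l.diff by (simp add: algebra_simps)
  have p3: "l (basis_vec (scale c x, y)) = c * l (basis_vec (x, y))" for c x y
    using z1[OF linearity_relations_scale[of "\<lambda>x. basis_vec (x, y)" c x]]
    by (simp add: l.diff l.scale algebra_simps)
  have p4: "l (basis_vec (y, scale c x)) = c * l (basis_vec (y, x))" for c x y
    using z2[OF linearity_relations_scale[of "\<lambda>x. basis_vec (y, x)" c x]]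
    by (simp add: l.diff l.scale algebra_simps)
  have "bilin (*) ?\<beta>"
    unfolding bilin_def Vector_Spaces.linear_iff
    using p1 p2 p3 p4 vector_space_axioms vector_space_mult by blast
  hence e: "lin_ext (*) (\<lambda>(a, b). ?\<beta> a b) u = lin_ext (*) (\<lambda>(a, b). ?\<beta> a b) v" by (rule assms)
  have lw: "l w = lin_ext (*) (\<lambda>(a, b). ?\<beta> a b) w" for w
    using linear_lin_ext_comp[OF l(1), of basis_vec w] by (simp add: lin_ext_basis_vec split_def)
  have "l u = l v" by (rule trans[OF lw trans[OF e lw[symmetric]]])
  thus False using l(3) l.diff by simp
qed

end

section \<open>Sweedler notation and the actions of the dual\<close>

context coalgebra
begin

abbreviation functional :: "('a \<Rightarrow> 'k) \<Rightarrow> bool"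
  where "functional \<phi> \<equiv> Vector_Spaces.linear scale (*) \<phi>"

lemma functional_add: "functional \<phi> \<Longrightarrow> \<phi> (x + y) = \<phi> x + \<phi> y"
  and functional_scale: "functional \<phi> \<Longrightarrow> \<phi> (scale c x) = c * \<phi> x"
  and functional_zero: "functional \<phi> \<Longrightarrow> \<phi> 0 = 0"
  and functional_sum: "functional \<phi> \<Longrightarrow> \<phi> (sum f A) = (\<Sum>a\<in>A. \<phi> (f a))"
  subgoal by (simp add: Vector_Spaces.linear_iff)
  subgoal by (simp add: Vector_Spaces.linear_iff)
  subgoal by (metis Vector_Spaces.linear.axioms(3) module_hom.zero)
  subgoal by (metis Vector_Spaces.linear.axioms(3) module_hom.sum)
  done

lemma functionalI:
  "(\<And>x y. \<phi> (x + y) = \<phi> x + \<phi> y) \<Longrightarrow> (\<And>c x. \<phi> (scale c x) = c * \<phi> x) \<Longrightarrow> functional \<phi>"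
  unfolding Vector_Spaces.linear_iff using vector_space_axioms vector_space_mult by blast

text \<open>For bilinear \<open>\<beta>\<close> this is the sum of the
  \<open>\<beta> x\<^sub>1 x\<^sub>2\<close> of Sweedler notation. For other \<open>\<beta>\<close>
  the value depends on the representative \<open>comult x\<close>, hence the hypotheses
  \<open>bilin\<close> below.\<close>

definition sweedler :: "('k \<Rightarrow> 'c::ab_group_add \<Rightarrow> 'c) \<Rightarrow> ('a \<Rightarrow> 'a \<Rightarrow> 'c) \<Rightarrow> 'a \<Rightarrow> 'c"
  where "sweedler s \<beta> x = lin_ext s (\<lambda>(a, b). \<beta> a b) (comult x)"

lemma sweedler_rep:
  assumes "bilin s \<beta>" "tensor2_eq (comult x) u"
  shows "sweedler s \<beta> x =
    (\<Sum>p\<in>Poly_Mapping.keys u. s (Poly_Mapping.lookup u p) (\<beta> (fst p) (snd p)))"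
  using tensor2_eq_imp_lin_ext_eq[OF assms] by (simp add: sweedler_def lin_ext_def split_def)

lemma sweedler_add:
  assumes "bilin s \<beta>"
  shows "sweedler s \<beta> (x + y) = sweedler s \<beta> x + sweedler s \<beta> y"
proof -
  have "vector_space s" using assms unfolding bilin_def Vector_Spaces.linear_iff by blast
  then interpret T: Vector_Spaces.linear fscale s "lin_ext s (\<lambda>(a, b). \<beta> a b)"
    by (rule linear_lin_ext)
  show ?thesis
    using tensor2_eq_imp_lin_ext_eq[OF assms comult_add, of x y] by (simp add: sweedler_def T.add)
qed

lemma sweedler_scale:
  assumes "bilin s \<beta>"
  shows "sweedler s \<beta> (scale c x) = s c (sweedler s \<beta> x)"
proof -
  have "vector_space s" using assms unfolding bilin_def Vector_Spaces.linear_iff by blast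
  then interpret T: Vector_Spaces.linear fscale s "lin_ext s (\<lambda>(a, b). \<beta> a b)"
    by (rule linear_lin_ext)
  show ?thesis
    using tensor2_eq_imp_lin_ext_eq[OF assms comult_scale, of c x] by (simp add: sweedler_def T.scale)
qed

lemma linear_sweedler:
  assumes "bilin s \<beta>"
  shows "Vector_Spaces.linear scale s (sweedler s \<beta>)"
  unfolding Vector_Spaces.linear_iff
  using sweedler_add[OF assms] sweedler_scale[OF assms] assms vector_space_axioms
  unfolding bilin_def Vector_Spaces.linear_iff by blast

lemma sweedler_comp:
  assumes "Vector_Spaces.linear s s' T"
  shows "T (sweedler s \<beta> x) = sweedler s' (\<lambda>a b. T (\<beta> a b)) x"
  using linear_lin_ext_comp[OF assms, of "\<lambda>(a, b). \<beta> a b" "comult x"]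
  by (simp add: sweedler_def split_def)

lemma sweedler_sum:
  assumes "vector_space s"
  shows "sweedler s (\<lambda>a b. \<Sum>i\<in>I. f i a b) x = (\<Sum>i\<in>I. sweedler s (f i) x)"
proof -
  interpret v: vector_space s by fact
  show ?thesis
    unfolding sweedler_def lin_ext_def
    by (simp add: v.scale_sum_right split_def sum.swap[of _ I])
qed

text \<open>The axiom compares classes in the triple tensor product, and the trilinear
  \<open>\<tau>\<close> kills its defining relations.\<close>

lemma sweedler_coassoc:
  assumes s: "vector_space s"
    and 1: "\<And>y z. Vector_Spaces.linear scale s (\<lambda>x. \<tau> x y z)"
    and 2: "\<And>x z. Vector_Spaces.linear scale s (\<lambda>y. \<tau> x y z)"
    and 3: "\<And>x y. Vector_Spaces.linear scale s (\<lambda>z. \<tau> x y z)"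
  shows "sweedler s (\<lambda>a b. sweedler s (\<lambda>c d. \<tau> c d b) a) x =
    sweedler s (\<lambda>a b. sweedler s (\<lambda>c d. \<tau> a c d) b) x"
proof -
  interpret v: vector_space s by fact
  let ?T = "lin_ext s (\<lambda>(a, b, c). \<tau> a b c)"
  have lT: "Vector_Spaces.linear fscale s ?T" by (rule linear_lin_ext[OF s])
  interpret T: Vector_Spaces.linear fscale s ?T by fact
  have b1: "\<tau> (x + x') y z = \<tau> x y z + \<tau> x' y z" "\<tau> (scale c x) y z = s c (\<tau> x y z)" for x x' y z c
    using 1 unfolding Vector_Spaces.linear_iff by auto
  have b2: "\<tau> y (x + x') z = \<tau> y x z + \<tau> y x' z" "\<tau> y (scale c x) z = s c (\<tau> y x z)" for x x' y z c
    using 2 unfolding Vector_Spaces.linear_iff by auto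
  have b3: "\<tau> y z (x + x') = \<tau> y z x + \<tau> y z x'" "\<tau> y z (scale c x) = s c (\<tau> y z x)" for x x' y z c
    using 3 unfolding Vector_Spaces.linear_iff by auto
  let ?u = "lin_ext fscale (\<lambda>(a, b). lin_ext fscale (\<lambda>(c, d). basis_vec (c, d, b)) (comult a)) (comult x)"
  let ?v = "lin_ext fscale (\<lambda>(a, b). lin_ext fscale (\<lambda>(c, d). basis_vec (a, c, d)) (comult b)) (comult x)"
  have "?T w = 0" if "w \<in> (\<Union>y z. linearity_relations (\<lambda>x. basis_vec (x, y, z)) \<union>
           linearity_relations (\<lambda>x. basis_vec (y, x, z)) \<union>
           linearity_relations (\<lambda>x. basis_vec (y, z, x)))" for w
  proof -
    from that consider x x' y z where "w = basis_vec (x + x', y, z) - basis_vec (x, y, z) - basis_vec (x', y, z)"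
      | c x y z where "w = basis_vec (scale c x, y, z) - fscale c (basis_vec (x, y, z))"
      | y x x' z where "w = basis_vec (y, x + x', z) - basis_vec (y, x, z) - basis_vec (y, x', z)"
      | c y x z where "w = basis_vec (y, scale c x, z) - fscale c (basis_vec (y, x, z))"
      | y z x x' where "w = basis_vec (y, z, x + x') - basis_vec (y, z, x) - basis_vec (y, z, x')"
      | c y z x where "w = basis_vec (y, z, scale c x) - fscale c (basis_vec (y, z, x))"
      unfolding linearity_relations_def by fast
    thus ?thesis
    proof cases
      case 1
      show ?thesis unfolding 1 T.diff lin_ext_single[OF s] prod.case b1 by simp
    next
      case 2
      show ?thesis unfolding 2 T.diff T.scale lin_ext_single[OF s] prod.case b1 by simp
    next
      case 3
      show ?thesis unfolding 3 T.diff lin_ext_single[OF s] prod.case b2 by simp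
    next
      case 4
      show ?thesis unfolding 4 T.diff T.scale lin_ext_single[OF s] prod.case b2 by simp
    next
      case 5
      show ?thesis unfolding 5 T.diff lin_ext_single[OF s] prod.case b3 by simp
    next
      case 6
      show ?thesis unfolding 6 T.diff T.scale lin_ext_single[OF s] prod.case b3 by simp
    qed
  qed
  hence "?T (?u - ?v) = 0" using coassoc[of x] unfolding tensor3_eq_def by (rule T.eq_0_on_span)
  hence "?T ?u = ?T ?v" by (simp add: T.diff)
  moreover have "?T ?u = sweedler s (\<lambda>a b. sweedler s (\<lambda>c d. \<tau> c d b) a) x"
    unfolding linear_lin_ext_comp[OF lT] by (simp add: linear_lin_ext_comp[OF lT, unfolded split_def] sweedler_def split_def s)
  moreover have "?T ?v = sweedler s (\<lambda>a b. sweedler s (\<lambda>c d. \<tau> a c d) b) x"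
    unfolding linear_lin_ext_comp[OF lT] by (simp add: linear_lin_ext_comp[OF lT, unfolded split_def] sweedler_def split_def s)
  ultimately show ?thesis by simp
qed

text \<open>The convolution actions of the dual algebra. They vanish for nonlinear \<open>\<phi>\<close>, which makes
  \<open>ract_commute\<close> and \<open>ract_conv\<close> unconditional.\<close>

definition ract :: "('a \<Rightarrow> 'k) \<Rightarrow> 'a \<Rightarrow> 'a"
  where "ract \<phi> x = (if functional \<phi> then sweedler scale (\<lambda>a b. scale (\<phi> b) a) x else 0)"

definition lact :: "('a \<Rightarrow> 'k) \<Rightarrow> 'a \<Rightarrow> 'a"
  where "lact \<phi> x = (if functional \<phi> then sweedler scale (\<lambda>a b. scale (\<phi> a) b) x else 0)"

lemma bilin_scale:
  assumes "functional \<phi>"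
  shows "bilin scale (\<lambda>a b. scale (\<phi> b) a)" "bilin scale (\<lambda>a b. scale (\<phi> a) b)"
  unfolding bilin_def Vector_Spaces.linear_iff
  using assms vector_space_axioms
  by (auto simp: functional_add functional_scale scale_right_distrib scale_left_distrib mult.commute)

lemma linear_zero: "Vector_Spaces.linear scale scale (\<lambda>x. 0)"
  unfolding Vector_Spaces.linear_iff using vector_space_axioms by simp

lemma linear_ract: "Vector_Spaces.linear scale scale (ract \<phi>)"
proof (cases "functional \<phi>")
  case True
  thus ?thesis using linear_sweedler[OF bilin_scale(1)[OF True]] unfolding ract_def by simp
next
  case False
  thus ?thesis using linear_zero unfolding ract_def by simp
qed

lemma linear_lact: "Vector_Spaces.linear scale scale (lact \<phi>)"
proof (cases "functional \<phi>")
  case True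
  thus ?thesis using linear_sweedler[OF bilin_scale(2)[OF True]] unfolding lact_def by simp
next
  case False
  thus ?thesis using linear_zero unfolding lact_def by simp
qed

sublocale ract: Vector_Spaces.linear scale scale "ract \<phi>" for \<phi>
  by (rule linear_ract)

sublocale lact: Vector_Spaces.linear scale scale "lact \<phi>" for \<phi>
  by (rule linear_lact)

lemma functional_comp:
  "functional \<phi> \<Longrightarrow> Vector_Spaces.linear scale scale T \<Longrightarrow> functional (\<lambda>x. \<phi> (T x))"
  using Vector_Spaces.linear_compose[of scale scale T "(*)" \<phi>] by (simp add: o_def)

lemma functional_ract: "functional \<phi> \<Longrightarrow> functional (\<lambda>x. \<phi> (ract \<psi> x))"
  and functional_lact: "functional \<phi> \<Longrightarrow> functional (\<lambda>x. \<phi> (lact \<psi> x))"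
  by (simp_all add: functional_comp linear_ract linear_lact)

lemma functional_apply_ract:
  "functional \<phi> \<Longrightarrow> functional \<psi> \<Longrightarrow> \<phi> (ract \<psi> x) = sweedler (*) (\<lambda>a b. \<phi> a * \<psi> b) x"
  by (simp add: ract_def sweedler_comp functional_scale mult.commute)

lemma functional_apply_lact:
  "functional \<phi> \<Longrightarrow> functional \<psi> \<Longrightarrow> \<phi> (lact \<psi> x) = sweedler (*) (\<lambda>a b. \<psi> a * \<phi> b) x"
  by (simp add: lact_def sweedler_comp functional_scale)

lemma linear_scale_functional: "functional \<phi> \<Longrightarrow> Vector_Spaces.linear scale scale (\<lambda>x. scale (\<phi> x) y)"
  unfolding Vector_Spaces.linear_iff using vector_space_axioms
  by (auto simp: functional_add functional_scale scale_left_distrib)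

lemma linear_scale_left: "Vector_Spaces.linear (*) scale (\<lambda>c. scale c x)"
  unfolding Vector_Spaces.linear_iff using vector_space_axioms vector_space_mult
  by (auto simp: scale_left_distrib)

lemma linear_scale_right: "Vector_Spaces.linear scale scale (\<lambda>x. scale c x)"
  unfolding Vector_Spaces.linear_iff using vector_space_axioms
  by (auto simp: scale_right_distrib mult.commute)

lemma linear_scale_functional': "functional \<phi> \<Longrightarrow> Vector_Spaces.linear scale scale (\<lambda>x. scale (c * \<phi> x) y)"
  using linear_scale_functional[of "\<lambda>x. c * \<phi> x" y]
  by (simp add: functionalI functional_add functional_scale algebra_simps)

text \<open>Both sides are the sum of \<open>x\<^sub>1\<close> with weights
  \<open>\<phi> x\<^sub>2 * \<psi> x\<^sub>3\<close>: the actions compose through the convolution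
  product.\<close>

lemma ract_ract:
  assumes "functional \<phi>" "functional \<psi>"
  shows "ract \<phi> (ract \<psi> x) = ract (\<lambda>y. \<phi> (ract \<psi> y)) x"
proof -
  let ?\<tau> = "\<lambda>c d b. scale (\<psi> b * \<phi> d) c"
  have "ract \<phi> (ract \<psi> x) = sweedler scale (\<lambda>a b. ract \<phi> (scale (\<psi> b) a)) x"
    unfolding ract_def[of \<psi>] using assms by (simp add: sweedler_comp[OF linear_ract])
  also have "\<dots> = sweedler scale (\<lambda>a b. sweedler scale (\<lambda>c d. ?\<tau> c d b) a) x"
    using assms unfolding ract_def
    by (simp add: sweedler_scale[OF bilin_scale(1)] sweedler_comp[OF linear_scale_right])
  also have "\<dots> = sweedler scale (\<lambda>a b. sweedler scale (\<lambda>c d. ?\<tau> a c d) b) x"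
    using assms
    by (intro sweedler_coassoc vector_space_axioms linear_scale_right linear_scale_functional')
      (simp_all add: linear_scale_functional' mult.commute)
  also have "\<dots> = ract (\<lambda>y. \<phi> (ract \<psi> y)) x"
  proof -
    have "ract (\<lambda>y. \<phi> (ract \<psi> y)) x = sweedler scale (\<lambda>a b. scale (\<phi> (ract \<psi> b)) a) x"
      unfolding ract_def[of "\<lambda>y. \<phi> (ract \<psi> y)"] using functional_ract[OF assms(1)] by simp
    thus ?thesis
      using assms by (simp add: functional_apply_ract sweedler_comp[OF linear_scale_left] mult.commute)
  qed
  finally show ?thesis .
qed

end

section \<open>Subcoalgebras as the subspaces stable under both actions\<close>

context coalgebra
begin

lemma ract_sweedler: "functional \<phi> \<Longrightarrow> ract \<phi> x = sweedler scale (\<lambda>a b. scale (\<phi> b) a) x"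
  and lact_sweedler: "functional \<phi> \<Longrightarrow> lact \<phi> x = sweedler scale (\<lambda>a b. scale (\<phi> a) b) x"
  by (simp_all add: ract_def lact_def)

lemma lact_lact:
  assumes "functional \<phi>" "functional \<psi>"
  shows "lact \<phi> (lact \<psi> x) = lact (\<lambda>y. \<phi> (lact \<psi> y)) x"
proof -
  let ?\<tau> = "\<lambda>a c d. scale (\<psi> a * \<phi> c) d"
  have "lact \<phi> (lact \<psi> x) = sweedler scale (\<lambda>a b. lact \<phi> (scale (\<psi> a) b)) x"
    using assms by (simp add: lact_sweedler[of \<psi>] sweedler_comp[OF linear_lact])
  also have "\<dots> = sweedler scale (\<lambda>a b. sweedler scale (\<lambda>c d. ?\<tau> a c d) b) x"
    using assms
    by (simp add: lact_sweedler sweedler_scale[OF bilin_scale(2)] sweedler_comp[OF linear_scale_right])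
  also have "\<dots> = sweedler scale (\<lambda>a b. sweedler scale (\<lambda>c d. ?\<tau> c d b) a) x"
    using assms
    by (intro sweedler_coassoc[symmetric] vector_space_axioms linear_scale_right linear_scale_functional')
      (simp_all add: linear_scale_functional' mult.commute)
  also have "\<dots> = sweedler scale (\<lambda>a b. scale (\<phi> (lact \<psi> a)) b) x"
    using assms by (simp add: functional_apply_lact sweedler_comp[OF linear_scale_left])
  also have "\<dots> = lact (\<lambda>y. \<phi> (lact \<psi> y)) x"
    using lact_sweedler[OF functional_lact[OF assms(1)]] by simp
  finally show ?thesis .
qed

lemma ract_lact:
  assumes "functional \<phi>" "functional \<psi>"
  shows "ract \<phi> (lact \<psi> x) = sweedler scale (\<lambda>a b. sweedler scale (\<lambda>c d. scale (\<psi> a * \<phi> d) c) b) x"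
proof -
  have "ract \<phi> (lact \<psi> x) = sweedler scale (\<lambda>a b. ract \<phi> (scale (\<psi> a) b)) x"
    using assms by (simp add: lact_sweedler[of \<psi>] sweedler_comp[OF linear_ract])
  thus ?thesis
    using assms
    by (simp add: ract_sweedler sweedler_scale[OF bilin_scale(1)] sweedler_comp[OF linear_scale_right])
qed

text \<open>Both sides are the sum of \<open>x\<^sub>2\<close> with weights
  \<open>\<psi> x\<^sub>1 * \<phi> x\<^sub>3\<close>. When the two actions coincide, this becomes
  the commutativity of the dual algebra.\<close>

lemma lact_ract:
  assumes "functional \<phi>" "functional \<psi>"
  shows "lact \<psi> (ract \<phi> x) = ract \<phi> (lact \<psi> x)"
proof -
  let ?\<tau> = "\<lambda>a c d. scale (\<psi> a * \<phi> d) c"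
  have "lact \<psi> (ract \<phi> x) = sweedler scale (\<lambda>a b. lact \<psi> (scale (\<phi> b) a)) x"
    using assms by (simp add: ract_sweedler[of \<phi>] sweedler_comp[OF linear_lact])
  also have "\<dots> = sweedler scale (\<lambda>a b. sweedler scale (\<lambda>c d. ?\<tau> c d b) a) x"
    using assms
    by (simp add: lact_sweedler sweedler_scale[OF bilin_scale(2)] sweedler_comp[OF linear_scale_right]
        mult.commute)
  also have "\<dots> = sweedler scale (\<lambda>a b. sweedler scale (\<lambda>c d. ?\<tau> a c d) b) x"
    using assms
    by (intro sweedler_coassoc vector_space_axioms linear_scale_right linear_scale_functional')
      (simp_all add: linear_scale_functional' mult.commute)
  finally show ?thesis using ract_lact[OF assms] by simp
qed

lemma functional_counit: "functional counit"
  by (rule counit_linear)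

lemma ract_counit: "ract counit x = x"
  and lact_counit: "lact counit x = x"
  using counit_left[of x] counit_right[of x]
  by (simp_all add: ract_sweedler lact_sweedler functional_counit sweedler_def)

lemma counit_ract:
  assumes "functional \<phi>"
  shows "counit (ract \<phi> x) = \<phi> x"
  using arg_cong[OF lact_counit[of x], of \<phi>] assms functional_counit
  by (simp add: functional_apply_ract functional_apply_lact)

lemma sweedler_cong_rep:
  assumes "bilin s \<beta>" "bilin s \<beta>'" "tensor2_eq (comult x) u"
    and "\<And>a b. (a, b) \<in> Poly_Mapping.keys u \<Longrightarrow> \<beta> a b = \<beta>' a b"
  shows "sweedler s \<beta> x = sweedler s \<beta>' x"
  unfolding sweedler_rep[OF assms(1,3)] sweedler_rep[OF assms(2,3)]
  using assms(4) by (intro sum.cong) auto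

lemma bilinD:
  assumes "bilin (*) \<beta>"
  shows "\<beta> (sum f A) y = (\<Sum>i\<in>A. \<beta> (f i) y)" "\<beta> (scale c x) y = c * \<beta> x y"
    "\<beta> y (sum f A) = (\<Sum>i\<in>A. \<beta> y (f i))" "\<beta> y (scale c x) = c * \<beta> y x"
proof -
  have f: "functional (\<lambda>x. \<beta> x y)" "functional (\<beta> y)" for y using assms unfolding bilin_def by auto
  show "\<beta> (sum f A) y = (\<Sum>i\<in>A. \<beta> (f i) y)" "\<beta> (scale c x) y = c * \<beta> x y"
    "\<beta> y (sum f A) = (\<Sum>i\<in>A. \<beta> y (f i))" "\<beta> y (scale c x) = c * \<beta> y x"
    using functional_sum[OF f(1)] functional_scale[OF f(1)]
      functional_sum[OF f(2)] functional_scale[OF f(2)] by auto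
qed

text \<open>Expanding the first tensor factors over a basis of their span turns the second factors
  into \<open>lact (\<psi> b) x\<close>. One choice of \<open>B\<close> and \<open>\<psi>\<close>
  serves all \<open>\<beta>\<close>, so two bilinear forms can be compared term by term.\<close>

lemma sweedler_expand_left:
  obtains B \<psi> where "finite B" "\<And>b. functional (\<psi> b)"
    "\<And>\<beta>. bilin (*) \<beta> \<Longrightarrow> sweedler (*) \<beta> x = (\<Sum>b\<in>B. \<beta> b (lact (\<psi> b) x))"
proof -
  let ?V = "span (fst ` Poly_Mapping.keys (comult x))"
  obtain B \<psi> where B: "finite B" "\<And>b. functional (\<psi> b)" "\<And>v. v \<in> ?V \<Longrightarrow> (\<Sum>b\<in>B. scale (\<psi> b v) b) = v"
    by (rule dual_basis[OF fd_subspace_span[OF finite_imageI[OF finite_keys[of "comult x"], of fst]]]) blast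
  have "sweedler (*) \<beta> x = (\<Sum>b\<in>B. \<beta> b (lact (\<psi> b) x))" if b: "bilin (*) \<beta>" for \<beta>
  proof -
    have e: "\<beta> a c = (\<Sum>i\<in>B. \<psi> i a * \<beta> i c)" if "(a, c) \<in> Poly_Mapping.keys (comult x)" for a c
    proof -
      have "a \<in> fst ` Poly_Mapping.keys (comult x)" using image_eqI[OF _ that, of a fst] by simp
      hence "\<beta> a c = \<beta> (\<Sum>b\<in>B. scale (\<psi> b a) b) c" by (simp only: B(3)[OF span_base])
      thus ?thesis by (simp add: bilinD[OF b])
    qed
    have fb: "functional (\<beta> i)" for i using b unfolding bilin_def by auto
    have "sweedler (*) \<beta> x = sweedler (*) (\<lambda>a c. \<Sum>i\<in>B. \<psi> i a * \<beta> i c) x"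
      unfolding sweedler_def lin_ext_def using e by (intro sum.cong) auto
    also have "\<dots> = (\<Sum>i\<in>B. \<beta> i (lact (\<psi> i) x))"
      using B(2) fb by (simp add: sweedler_sum[OF vector_space_mult] functional_apply_lact)
    finally show ?thesis .
  qed
  thus ?thesis using that B by blast
qed

lemma sweedler_expand_right:
  obtains B \<psi> where "finite B" "\<And>b. functional (\<psi> b)"
    "\<And>\<beta>. bilin (*) \<beta> \<Longrightarrow> sweedler (*) \<beta> x = (\<Sum>b\<in>B. \<beta> (ract (\<psi> b) x) b)"
proof -
  let ?V = "span (snd ` Poly_Mapping.keys (comult x))"
  obtain B \<psi> where B: "finite B" "\<And>b. functional (\<psi> b)" "\<And>v. v \<in> ?V \<Longrightarrow> (\<Sum>b\<in>B. scale (\<psi> b v) b) = v"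
    by (rule dual_basis[OF fd_subspace_span[OF finite_imageI[OF finite_keys[of "comult x"], of snd]]]) blast
  have "sweedler (*) \<beta> x = (\<Sum>b\<in>B. \<beta> (ract (\<psi> b) x) b)" if b: "bilin (*) \<beta>" for \<beta>
  proof -
    have e: "\<beta> a c = (\<Sum>i\<in>B. \<beta> a i * \<psi> i c)" if "(a, c) \<in> Poly_Mapping.keys (comult x)" for a c
    proof -
      have "c \<in> snd ` Poly_Mapping.keys (comult x)" using image_eqI[OF _ that, of c snd] by simp
      hence "\<beta> a c = \<beta> a (\<Sum>b\<in>B. scale (\<psi> b c) b)" by (simp only: B(3)[OF span_base])
      thus ?thesis by (simp add: bilinD[OF b] mult.commute)
    qed
    have fb: "functional (\<lambda>a. \<beta> a i)" for i using b unfolding bilin_def by auto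
    have "sweedler (*) \<beta> x = sweedler (*) (\<lambda>a c. \<Sum>i\<in>B. \<beta> a i * \<psi> i c) x"
      unfolding sweedler_def lin_ext_def using e by (intro sum.cong) auto
    also have "\<dots> = (\<Sum>i\<in>B. \<beta> (ract (\<psi> i) x) i)"
      using B(2) functional_apply_ract[OF fb, symmetric] by (simp add: sweedler_sum[OF vector_space_mult])
    finally show ?thesis .
  qed
  thus ?thesis using that B by blast
qed

text \<open>Apply a projection \<open>P\<close> onto \<open>E\<close> to both factors of the
  coproduct. The class does not change: one expansion presents the second factors as
  \<open>lact\<close> images of \<open>x\<close>, another presents the first factors as
  \<open>ract\<close> images, and \<open>P\<close> fixes both kinds.\<close>

lemma subcoalgebraI:
  assumes E: "subspace E"
    and stable: "\<And>\<phi> x. functional \<phi> \<Longrightarrow> x \<in> E \<Longrightarrow> ract \<phi> x \<in> E \<and> lact \<phi> x \<in> E"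
  shows "subcoalgebra E"
  unfolding subcoalgebra_def
proof (intro conjI ballI)
  show "subspace E" by fact
  fix x assume x: "x \<in> E"
  interpret vector_space_pair scale scale by (rule kspace_pair_self)
  obtain P where P: "range P \<subseteq> E" "Vector_Spaces.linear scale scale P" "\<forall>v\<in>E. P (id v) = v"
    using linear_exists_left_inverse_on[of id E] E linear_id by auto
  let ?u = "lin_ext fscale (\<lambda>(a, b). basis_vec (P a, P b)) (comult x)"
  have "Poly_Mapping.keys ?u \<subseteq> E \<times> E"
  proof -
    have "Poly_Mapping.keys ?u \<subseteq>
      (\<Union>p\<in>Poly_Mapping.keys (comult x). Poly_Mapping.keys (fscale (Poly_Mapping.lookup (comult x) p)
        (basis_vec (P (fst p), P (snd p)))))"
      unfolding lin_ext_def split_def by (rule Poly_Mapping.keys_sum)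
    also have "\<dots> \<subseteq> E \<times> E" using P(1) by (auto simp: in_keys_iff lookup_single when_def image_subset_iff split: if_splits)
    finally show ?thesis .
  qed
  moreover have "tensor2_eq (comult x) ?u"
  proof (rule tensor2_eqI)
    fix \<beta> :: "'a \<Rightarrow> 'a \<Rightarrow> 'k" assume b: "bilin (*) \<beta>"
    have f: "functional (\<lambda>x. \<beta> x y)" "functional (\<beta> y)" for y using b unfolding bilin_def by auto
    have b1: "bilin (*) (\<lambda>a c. \<beta> (P a) c)"
      unfolding bilin_def using functional_comp[OF f(1) P(2)] f(2) by blast
    have b2: "bilin (*) (\<lambda>a c. \<beta> (P a) (P c))"
      unfolding bilin_def using functional_comp[OF f(1) P(2)] functional_comp[OF f(2) P(2)] by blast
    have vs: "vector_space ((*) :: 'k \<Rightarrow> _)" by (rule vector_space_mult)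
    have "lin_ext (*) (\<lambda>(a, b). \<beta> a b) ?u = sweedler (*) (\<lambda>a c. \<beta> (P a) (P c)) x"
      unfolding linear_lin_ext_comp[OF linear_lin_ext[OF vs]]
      by (simp add: sweedler_def split_def vs)
    also have "\<dots> = sweedler (*) (\<lambda>a c. \<beta> (P a) c) x"
    proof -
      obtain B \<psi> where "finite B" and B: "\<And>b. functional (\<psi> b)"
        "\<And>\<beta>. bilin (*) \<beta> \<Longrightarrow> sweedler (*) \<beta> x = (\<Sum>b\<in>B. \<beta> b (lact (\<psi> b) x))"
        by (rule sweedler_expand_left[of x]) (rule that)
      show ?thesis unfolding B(2)[OF b1] B(2)[OF b2] using P(3) stable[OF B(1) x] by simp
    qed
    also have "\<dots> = sweedler (*) \<beta> x"
    proof -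
      obtain B \<psi> where "finite B" and B: "\<And>b. functional (\<psi> b)"
        "\<And>\<beta>. bilin (*) \<beta> \<Longrightarrow> sweedler (*) \<beta> x = (\<Sum>b\<in>B. \<beta> (ract (\<psi> b) x) b)"
        by (rule sweedler_expand_right[of x]) (rule that)
      show ?thesis unfolding B(2)[OF b1] B(2)[OF b] using P(3) stable[OF B(1) x] by simp
    qed
    finally show "lin_ext (*) (\<lambda>(a, b). \<beta> a b) (comult x) = lin_ext (*) (\<lambda>(a, b). \<beta> a b) ?u"
      unfolding sweedler_def by simp
  qed
  ultimately show "\<exists>u. Poly_Mapping.keys u \<subseteq> E \<times> E \<and> tensor2_eq (comult x) u" by blast
qed

lemma subcoalgebra_rep:
  assumes "subcoalgebra E" "x \<in> E"
  obtains u where "Poly_Mapping.keys u \<subseteq> E \<times> E" "tensor2_eq (comult x) u"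
  using assms unfolding subcoalgebra_def by blast

lemma subcoalgebra_subspace: "subcoalgebra E \<Longrightarrow> subspace E"
  unfolding subcoalgebra_def by blast

lemma subcoalgebra_ract:
  assumes E: "subcoalgebra E" and x: "x \<in> E"
  shows "ract \<phi> x \<in> E"
proof (cases "functional \<phi>")
  case True
  obtain u where u: "Poly_Mapping.keys u \<subseteq> E \<times> E" "tensor2_eq (comult x) u"
    using subcoalgebra_rep[OF assms] by blast
  have "ract \<phi> x = (\<Sum>p\<in>Poly_Mapping.keys u. scale (Poly_Mapping.lookup u p) (scale (\<phi> (snd p)) (fst p)))"
    using sweedler_rep[OF bilin_scale(1)[OF True] u(2)] ract_sweedler[OF True] by simp
  also have "\<dots> \<in> E"
    using u(1) by (intro subspace_sum subspace_scale subcoalgebra_subspace[OF E]) auto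
  finally show ?thesis .
next
  case False
  thus ?thesis using subspace_0[OF subcoalgebra_subspace[OF E]] by (simp add: ract_def)
qed

lemma subcoalgebra_lact:
  assumes E: "subcoalgebra E" and x: "x \<in> E"
  shows "lact \<phi> x \<in> E"
proof (cases "functional \<phi>")
  case True
  obtain u where u: "Poly_Mapping.keys u \<subseteq> E \<times> E" "tensor2_eq (comult x) u"
    using subcoalgebra_rep[OF assms] by blast
  have "lact \<phi> x = (\<Sum>p\<in>Poly_Mapping.keys u. scale (Poly_Mapping.lookup u p) (scale (\<phi> (fst p)) (snd p)))"
    using sweedler_rep[OF bilin_scale(2)[OF True] u(2)] lact_sweedler[OF True] by simp
  also have "\<dots> \<in> E"
    using u(1) by (intro subspace_sum subspace_scale subcoalgebra_subspace[OF E]) auto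
  finally show ?thesis .
next
  case False
  thus ?thesis using subspace_0[OF subcoalgebra_subspace[OF E]] by (simp add: lact_def)
qed

lemma ract_cong_subcoalgebra:
  assumes E: "subcoalgebra E" and x: "x \<in> E" and f: "functional \<phi>" "functional \<psi>"
    and eq: "\<And>v. v \<in> E \<Longrightarrow> \<phi> v = \<psi> v"
  shows "ract \<phi> x = ract \<psi> x"
proof -
  obtain u where u: "Poly_Mapping.keys u \<subseteq> E \<times> E" "tensor2_eq (comult x) u"
    using subcoalgebra_rep[OF E x] by blast
  show ?thesis
    unfolding ract_sweedler[OF f(1)] ract_sweedler[OF f(2)]
    using u eq f by (intro sweedler_cong_rep[OF _ _ u(2)] bilin_scale) auto
qed

lemma subcoalgebra_span_Union:
  assumes "\<And>i. i \<in> I \<Longrightarrow> subcoalgebra (C i)"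
  shows "subcoalgebra (span (\<Union>i\<in>I. C i))"
proof (rule subcoalgebraI)
  let ?S = "span (\<Union>i\<in>I. C i)"
  have s: "subspace {x. ract \<phi> x \<in> ?S}" "subspace {x. lact \<phi> x \<in> ?S}" for \<phi>
    by (simp_all add: ract.subspace_linear_preimage lact.subspace_linear_preimage)
  have b: "(\<Union>i\<in>I. C i) \<subseteq> {x. ract \<phi> x \<in> ?S}" "(\<Union>i\<in>I. C i) \<subseteq> {x. lact \<phi> x \<in> ?S}" for \<phi>
    using assms subcoalgebra_ract subcoalgebra_lact by (fastforce intro!: span_base)+
  show "ract \<phi> x \<in> ?S \<and> lact \<phi> x \<in> ?S" if "x \<in> ?S" for \<phi> x
    using span_minimal[OF b(1) s(1), of \<phi>] span_minimal[OF b(2) s(2), of \<phi>] that by blast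
qed simp

text \<open>The subcoalgebra generated by \<open>x\<close> is spanned by the middle factors of
  \<open>(id \<otimes> \<Delta>)(\<Delta>(x))\<close>, hence finite-dimensional.\<close>

lemma fd_subcoalgebra_generated:
  obtains C where "fd_subspace C" "subcoalgebra C" "x \<in> C"
    "\<And>K. subcoalgebra K \<Longrightarrow> x \<in> K \<Longrightarrow> C \<subseteq> K"
proof -
  define G where "G = {ract \<phi> (lact \<psi> x) | \<phi> \<psi>. functional \<phi> \<and> functional \<psi>}"
  let ?M = "\<Union>p\<in>Poly_Mapping.keys (comult x). fst ` Poly_Mapping.keys (comult (snd p))"
  have "G \<subseteq> span ?M"
  proof
    fix z assume "z \<in> G"
    then obtain \<phi> \<psi> where z: "functional \<phi>" "functional \<psi>" "z = ract \<phi> (lact \<psi> x)"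
      unfolding G_def by blast
    show "z \<in> span ?M"
      unfolding z(3) ract_lact[OF z(1,2)] sweedler_def lin_ext_def split_def
      by (intro span_sum span_scale span_base) auto
  qed
  hence "span G \<subseteq> span ?M" by (simp add: span_minimal)
  hence fd: "fd_subspace (span G)"
    using fd_subspace_subset[OF fd_subspace_span[of ?M] subspace_span] by simp
  have "ract counit (lact counit x) = x" by (simp add: ract_counit lact_counit)
  hence "x \<in> G" unfolding G_def using functional_counit by force
  hence xG: "x \<in> span G" by (rule span_base)
  have sub: "subcoalgebra (span G)"
  proof (rule subcoalgebraI)
    fix \<chi> z assume c: "functional \<chi>" "z \<in> span G"
    have 1: "ract \<chi> y \<in> span G" "lact \<chi> y \<in> span G" if "y \<in> G" for y
    proof -
      obtain \<phi> \<psi> where y: "functional \<phi>" "functional \<psi>" "y = ract \<phi> (lact \<psi> x)"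
        using \<open>y \<in> G\<close> unfolding G_def by blast
      have "ract \<chi> y = ract (\<lambda>v. \<chi> (ract \<phi> v)) (lact \<psi> x)"
        using y ract_ract[OF c(1) y(1)] by simp
      thus "ract \<chi> y \<in> span G"
        using functional_ract[OF c(1)] y unfolding G_def by (auto intro!: span_base)
      have "lact \<chi> y = ract \<phi> (lact (\<lambda>v. \<chi> (lact \<psi> v)) x)"
        using y lact_ract[OF y(1) c(1)] lact_lact[OF c(1) y(2)] by simp
      thus "lact \<chi> y \<in> span G"
        using functional_lact[OF c(1)] y unfolding G_def by (auto intro!: span_base)
    qed
    have s: "subspace {x. ract \<chi> x \<in> span G}" "subspace {x. lact \<chi> x \<in> span G}"
      by (simp_all add: ract.subspace_linear_preimage lact.subspace_linear_preimage)
    show "ract \<chi> z \<in> span G \<and> lact \<chi> z \<in> span G"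
      using span_minimal[OF _ s(1), of G] span_minimal[OF _ s(2), of G] 1 c(2) by blast
  qed simp
  have "span G \<subseteq> K" if "subcoalgebra K" "x \<in> K" for K
    using that unfolding G_def
    by (intro span_minimal subcoalgebra_subspace) (auto intro!: subcoalgebra_ract subcoalgebra_lact)
  thus ?thesis using that fd sub xG by blast
qed

lemma fd_subcoalgebra_containing:
  assumes F: "fd_subspace F" "F \<subseteq> K" and K: "subcoalgebra K"
  obtains C where "fd_subspace C" "subcoalgebra C" "F \<subseteq> C" "C \<subseteq> K"
proof -
  obtain B where B: "finite B" "F = span B" using F unfolding fd_subspace_def by blast
  have "\<forall>x. \<exists>C. fd_subspace C \<and> subcoalgebra C \<and> x \<in> C \<and> (\<forall>K. subcoalgebra K \<longrightarrow> x \<in> K \<longrightarrow> C \<subseteq> K)"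
    using fd_subcoalgebra_generated by metis
  then obtain C where C: "\<And>x. fd_subspace (C x)" "\<And>x. subcoalgebra (C x)" "\<And>x. x \<in> C x"
    "\<And>x K. subcoalgebra K \<Longrightarrow> x \<in> K \<Longrightarrow> C x \<subseteq> K" by metis
  let ?C = "span (\<Union>x\<in>B. C x)"
  have "B \<subseteq> K" using B F span_superset by blast
  hence "?C \<subseteq> K"
    using C(4)[OF K] by (intro span_minimal subcoalgebra_subspace[OF K]) blast
  moreover have "F \<subseteq> ?C" unfolding B(2) using C(3) by (intro span_mono) blast
  ultimately show ?thesis
    using that fd_subspace_finite_union[OF B(1), of C] C(1,2) subcoalgebra_span_Union[of B C] by blast
qed

lemma cocommutative_lact_eq_ract:
  assumes "cocommutative"
  shows "lact \<phi> x = ract \<phi> x"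
proof (cases "functional \<phi>")
  case True
  let ?u = "lin_ext fscale (\<lambda>(a, b). basis_vec (b, a)) (comult x)"
  have "tensor2_eq (comult x) ?u" using assms unfolding cocommutative_def by blast
  hence "lact \<phi> x = lin_ext scale (\<lambda>(a, b). scale (\<phi> a) b) ?u"
    unfolding lact_sweedler[OF True] sweedler_def
    by (rule tensor2_eq_imp_lin_ext_eq[OF bilin_scale(2)[OF True]])
  also have "\<dots> = ract \<phi> x"
    unfolding linear_lin_ext_comp[OF linear_lin_ext[OF vector_space_axioms]] ract_sweedler[OF True]
    by (simp add: sweedler_def split_def vector_space_axioms)
  finally show ?thesis .
qed (simp add: lact_def ract_def)

end

section \<open>The actions of the dual on products\<close>

context bialgebra
begin

lemma functional_mult_left: "functional \<phi> \<Longrightarrow> functional (\<lambda>b. \<phi> (c * b))"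
  and functional_mult_right: "functional \<phi> \<Longrightarrow> functional (\<lambda>b. \<phi> (b * c))"
  by (simp_all add: functionalI distrib_left distrib_right functional_add functional_scale
      scale_mult_left scale_mult_right)

lemma linear_mult_left: "Vector_Spaces.linear scale scale (\<lambda>y. a * y)"
  and linear_mult_right: "Vector_Spaces.linear scale scale (\<lambda>y. y * a)"
  unfolding Vector_Spaces.linear_iff
  by (simp_all add: vector_space_axioms distrib_left distrib_right scale_mult_left scale_mult_right)

lemma sweedler_mult:
  assumes "bilin s \<beta>"
  shows "sweedler s \<beta> (x * y) = sweedler s (\<lambda>a b. sweedler s (\<lambda>c d. \<beta> (a * c) (b * d)) y) x"
proof -
  have vs: "vector_space s" using assms unfolding bilin_def Vector_Spaces.linear_iff by blast
  show ?thesis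
    unfolding sweedler_def tensor2_eq_imp_lin_ext_eq[OF assms comult_mult]
    unfolding linear_lin_ext_comp[OF linear_lin_ext[OF vs]] split_def
      linear_lin_ext_comp[OF linear_lin_ext[OF vs], unfolded split_def]
    by (simp add: vs)
qed

lemma ract_mult:
  assumes "functional \<phi>"
  shows "ract \<phi> (x * y) = sweedler scale (\<lambda>a b. a * ract (\<lambda>d. \<phi> (b * d)) y) x"
  using assms functional_mult_left[OF assms]
  by (simp add: ract_sweedler sweedler_mult[OF bilin_scale(1)] sweedler_comp[OF linear_mult_left]
      scale_mult_right)

lemma lact_mult:
  assumes "functional \<phi>"
  shows "lact \<phi> (x * y) = sweedler scale (\<lambda>a b. b * lact (\<lambda>d. \<phi> (a * d)) y) x"
  using assms functional_mult_left[OF assms]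
  by (simp add: lact_sweedler sweedler_mult[OF bilin_scale(2)] sweedler_comp[OF linear_mult_left]
      scale_mult_right)

lemma subcoalgebra_span_one: "subcoalgebra (span {1})"
  unfolding subcoalgebra_def
proof (intro conjI ballI)
  fix x assume "x \<in> span {1}"
  then obtain c where x: "x = scale c 1" unfolding span_singleton by blast
  have "tensor2_eq (comult x) (fscale c (basis_vec (1, 1)))"
  proof (rule tensor2_eqI)
    fix \<beta> :: "'a \<Rightarrow> 'a \<Rightarrow> 'k" assume b: "bilin (*) \<beta>"
    interpret T: Vector_Spaces.linear fscale "(*)" "lin_ext (*) (\<lambda>(a, b). \<beta> a b)"
      by (rule linear_lin_ext[OF vector_space_mult])
    show "lin_ext (*) (\<lambda>(a, b). \<beta> a b) (comult x) =
      lin_ext (*) (\<lambda>(a, b). \<beta> a b) (fscale c (basis_vec (1, 1)))"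
      unfolding x tensor2_eq_imp_lin_ext_eq[OF b comult_scale] T.scale
        tensor2_eq_imp_lin_ext_eq[OF b comult_one] ..
  qed
  moreover have "Poly_Mapping.keys (fscale c (basis_vec (1, 1))) \<subseteq> span {1} \<times> span {1}"
    by (auto simp: in_keys_iff lookup_single when_def span_base split: if_splits)
  ultimately show "\<exists>u. Poly_Mapping.keys u \<subseteq> span {1} \<times> span {1} \<and> tensor2_eq (comult x) u"
    by blast
qed simp

end

section \<open>Bilinear actions and the subspaces they span\<close>

locale kspace_action = kspace_pair s1 s2
  for s1 :: "'k::field \<Rightarrow> 'b::ab_group_add \<Rightarrow> 'b" and s2 :: "'k \<Rightarrow> 'c::ab_group_add \<Rightarrow> 'c" +
  fixes act :: "'b \<Rightarrow> 'c \<Rightarrow> 'c"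
  assumes linear_act_left: "Vector_Spaces.linear s1 s2 (\<lambda>f. act f e)"
    and linear_act_right: "Vector_Spaces.linear s2 s2 (act f)"
begin

text \<open>It specialises to \<open>prod_span\<close> on \<open>H\<close> and to the products in
  the model of \<open>K \<otimes> D\<close>, so that dimension estimates relating the two are proved
  once.\<close>

definition act_span :: "'b set \<Rightarrow> 'c set \<Rightarrow> 'c set"
  where "act_span F E = k2.span {act f e | f e. f \<in> F \<and> e \<in> E}"

lemma subspace_act_span [simp]: "k2.subspace (act_span F E)"
  unfolding act_span_def by simp

lemma act_span_base: "f \<in> F \<Longrightarrow> e \<in> E \<Longrightarrow> act f e \<in> act_span F E"
  unfolding act_span_def by (rule k2.span_base) blast

lemma act_span_minimal:
  "(\<And>f e. f \<in> F \<Longrightarrow> e \<in> E \<Longrightarrow> act f e \<in> V) \<Longrightarrow> k2.subspace V \<Longrightarrow> act_span F E \<subseteq> V"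
  unfolding act_span_def by (rule k2.span_minimal) auto

lemma act_span_mono: "F \<subseteq> F' \<Longrightarrow> E \<subseteq> E' \<Longrightarrow> act_span F E \<subseteq> act_span F' E'"
  unfolding act_span_def by (rule k2.span_mono) blast

lemma act_span_span: "act_span (k1.span A) (k2.span B) = act_span A B"
proof
  show "act_span (k1.span A) (k2.span B) \<subseteq> act_span A B"
  proof (rule act_span_minimal)
    fix f e assume fe: "f \<in> k1.span A" "e \<in> k2.span B"
    have 1: "act f b \<in> act_span A B" if "b \<in> B" for b
    proof -
      interpret l: Vector_Spaces.linear s1 s2 "\<lambda>f. act f b" by (rule linear_act_left)
      have "k1.span A \<subseteq> {f. act f b \<in> act_span A B}"
        using that act_span_base by (intro k1.span_minimal l.subspace_linear_preimage) auto
      thus ?thesis using fe by blast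
    qed
    interpret l: Vector_Spaces.linear s2 s2 "act f" by (rule linear_act_right)
    have "k2.span B \<subseteq> {e. act f e \<in> act_span A B}"
      using 1 by (intro k2.span_minimal l.subspace_linear_preimage) auto
    thus "act f e \<in> act_span A B" using fe by blast
  qed simp
  show "act_span A B \<subseteq> act_span (k1.span A) (k2.span B)"
    by (intro act_span_mono k1.span_superset k2.span_superset)
qed

lemma fd_act_span:
  assumes "k1.fd_subspace F" "k2.fd_subspace E"
  shows "k2.fd_subspace (act_span F E)"
proof -
  obtain A B where AB: "finite A" "F = k1.span A" "finite B" "E = k2.span B"
    using assms unfolding k1.fd_subspace_def k2.fd_subspace_def by blast
  have "{act f e | f e. f \<in> A \<and> e \<in> B} = (\<lambda>(f, e). act f e) ` (A \<times> B)" by auto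
  hence "finite {act f e | f e. f \<in> A \<and> e \<in> B}" using AB by simp
  thus ?thesis unfolding AB act_span_span unfolding act_span_def by (rule k2.fd_subspace_span)
qed

lemma act_span_plus:
  assumes "k2.subspace U" "k2.subspace V"
  shows "act_span F (U + V) \<subseteq> act_span F U + act_span F V"
proof (rule act_span_minimal)
  fix f e assume fe: "f \<in> F" "e \<in> U + V"
  then obtain u v where uv: "u \<in> U" "v \<in> V" "e = u + v" unfolding set_plus_def by blast
  interpret l: Vector_Spaces.linear s2 s2 "act f" by (rule linear_act_right)
  have "act f e = act f u + act f v" using uv l.add by simp
  thus "act f e \<in> act_span F U + act_span F V"
    using act_span_base[OF fe(1) uv(1)] act_span_base[OF fe(1) uv(2)] by (auto simp: set_plus_def)
qed (simp add: k2.subspace_plus)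

end

subsection \<open>Expansion and growth\<close>

context unital_algebra
begin

sublocale mult_action: kspace_action scale scale "(*)"
  rewrites "kspace_action.act_span scale (*) = prod_span"
proof -
  show i: "kspace_action scale scale (*)"
    by unfold_locales (simp_all add: distrib_left distrib_right scale_mult_left scale_mult_right)
  show "kspace_action.act_span scale (*) = prod_span"
    unfolding kspace_action.act_span_def[OF i] prod_span_def by (intro ext) simp
qed

lemma dim_quot_plus:
  assumes "fd_subspace E" "fd_subspace F"
  shows "dim_quot (E + prod_span F E) E = dim (E + prod_span F E) - dim E"
    "dim E \<le> dim (E + prod_span F E)"
proof -
  have fd: "fd_subspace (E + prod_span F E)"
    using assms by (intro fd_subspace_sum mult_action.fd_act_span)
  have "0 \<in> prod_span F E" using mult_action.subspace_act_span subspace_0 by blast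
  hence sub: "E \<subseteq> E + prod_span F E" by (force simp: set_plus_def)
  show "dim_quot (E + prod_span F E) E = dim (E + prod_span F E) - dim E"
    by (rule dim_quot_eq[OF fd fd_subspaceD[OF assms(1)] sub])
  show "dim E \<le> dim (E + prod_span F E)" by (rule fd_dim_mono[OF fd sub])
qed

end

context bialgebra
begin

lemma ract_functional_add:
  assumes "functional \<phi>" "functional \<psi>"
  shows "ract (\<lambda>x. \<phi> x + \<psi> x) y = ract \<phi> y + ract \<psi> y"
proof -
  have "functional (\<lambda>x. \<phi> x + \<psi> x)"
    using assms by (simp add: functionalI functional_add functional_scale distrib_left)
  thus ?thesis using assms
    by (simp add: ract_sweedler sweedler_def lin_ext_def split_def scale_left_distrib
        scale_right_distrib sum.distrib)
qed

lemma lact_functional_add: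
  assumes "functional \<phi>" "functional \<psi>"
  shows "lact (\<lambda>x. \<phi> x + \<psi> x) y = lact \<phi> y + lact \<psi> y"
proof -
  have "functional (\<lambda>x. \<phi> x + \<psi> x)"
    using assms by (simp add: functionalI functional_add functional_scale distrib_left)
  thus ?thesis using assms
    by (simp add: lact_sweedler sweedler_def lin_ext_def split_def scale_left_distrib
        scale_right_distrib sum.distrib)
qed

lemma functional_const_mult: "functional \<phi> \<Longrightarrow> functional (\<lambda>x. c * \<phi> x)"
  by (simp add: functionalI functional_add functional_scale distrib_left)

lemma ract_functional_scale:
  assumes "functional \<phi>"
  shows "ract (\<lambda>x. c * \<phi> x) y = scale c (ract \<phi> y)"
  using assms functional_const_mult[OF assms, of c]
  by (simp add: ract_sweedler sweedler_comp[OF linear_scale_right])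

lemma lact_functional_scale:
  assumes "functional \<phi>"
  shows "lact (\<lambda>x. c * \<phi> x) y = scale c (lact \<phi> y)"
  using assms functional_const_mult[OF assms, of c]
  by (simp add: lact_sweedler sweedler_comp[OF linear_scale_right])

lemma bilin_ract_mult:
  assumes "functional \<phi>"
  shows "bilin scale (\<lambda>a b. a * ract (\<lambda>d. \<phi> (b * d)) x)"
    "bilin scale (\<lambda>a b. b * lact (\<lambda>d. \<phi> (a * d)) x)"
  unfolding bilin_def Vector_Spaces.linear_iff
  using assms vector_space_axioms functional_mult_left[OF assms]
  by (simp_all add: distrib_left distrib_right scale_mult_left scale_mult_right functional_add
      functional_scale ract_functional_add ract_functional_scale lact_functional_add lact_functional_scale)

text \<open>A representative of the coproduct of \<open>f\<close> inside
  \<open>C \<otimes> C\<close> supplies the \<open>a i\<close> and \<open>\<omega> i\<close>. They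
  do not depend on \<open>x\<close>, and they keep the left factors in \<open>C\<close>.\<close>

lemma ract_mult_expand:
  assumes "subcoalgebra C" "f \<in> C" "functional \<phi>"
  obtains I :: "('a \<times> 'a) set" and a \<omega> where "finite I" "\<And>i. i \<in> I \<Longrightarrow> a i \<in> C"
    "\<And>i. functional (\<omega> i)" "\<And>x. ract \<phi> (f * x) = (\<Sum>i\<in>I. a i * ract (\<omega> i) x)"
proof -
  obtain u where u: "Poly_Mapping.keys u \<subseteq> C \<times> C" "tensor2_eq (comult f) u"
    using subcoalgebra_rep[OF assms(1,2)] by blast
  show ?thesis
  proof (rule that[of "Poly_Mapping.keys u" "\<lambda>p. scale (Poly_Mapping.lookup u p) (fst p)"
        "\<lambda>p d. \<phi> (snd p * d)"])
    show "scale (Poly_Mapping.lookup u p) (fst p) \<in> C" if "p \<in> Poly_Mapping.keys u" for p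
      using that u(1) by (intro subspace_scale subcoalgebra_subspace assms) auto
    show "ract \<phi> (f * x) = (\<Sum>p\<in>Poly_Mapping.keys u.
      scale (Poly_Mapping.lookup u p) (fst p) * ract (\<lambda>d. \<phi> (snd p * d)) x)" for x
      unfolding ract_mult[OF assms(3)] sweedler_rep[OF bilin_ract_mult(1)[OF assms(3)] u(2)]
      by (simp add: scale_mult_left)
  qed (use assms functional_mult_left in auto)
qed

lemma lact_mult_expand:
  assumes "subcoalgebra C" "f \<in> C" "functional \<phi>"
  obtains I :: "('a \<times> 'a) set" and a \<omega> where "finite I" "\<And>i. i \<in> I \<Longrightarrow> a i \<in> C"
    "\<And>i. functional (\<omega> i)" "\<And>x. lact \<phi> (f * x) = (\<Sum>i\<in>I. a i * lact (\<omega> i) x)"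
proof -
  obtain u where u: "Poly_Mapping.keys u \<subseteq> C \<times> C" "tensor2_eq (comult f) u"
    using subcoalgebra_rep[OF assms(1,2)] by blast
  show ?thesis
  proof (rule that[of "Poly_Mapping.keys u" "\<lambda>p. scale (Poly_Mapping.lookup u p) (snd p)"
        "\<lambda>p d. \<phi> (fst p * d)"])
    show "scale (Poly_Mapping.lookup u p) (snd p) \<in> C" if "p \<in> Poly_Mapping.keys u" for p
      using that u(1) by (intro subspace_scale subcoalgebra_subspace assms) auto
    show "lact \<phi> (f * x) = (\<Sum>p\<in>Poly_Mapping.keys u.
      scale (Poly_Mapping.lookup u p) (snd p) * lact (\<lambda>d. \<phi> (fst p * d)) x)" for x
      unfolding lact_mult[OF assms(3)] sweedler_rep[OF bilin_ract_mult(2)[OF assms(3)] u(2)]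
      by (simp add: scale_mult_left)
  qed (use assms functional_mult_left in auto)
qed

lemma subcoalgebra_prod_span:
  assumes "subcoalgebra C" "subcoalgebra E"
  shows "subcoalgebra (prod_span C E)"
proof (rule subcoalgebraI)
  let ?S = "prod_span C E"
  have sS: "subspace ?S" by simp
  fix \<phi> x assume p: "functional \<phi>" and x: "x \<in> ?S"
  have "?S \<subseteq> {x. ract \<phi> x \<in> ?S}"
  proof (rule mult_action.act_span_minimal)
    fix f e assume fe: "f \<in> C" "e \<in> E"
    obtain I :: "('a \<times> 'a) set" and a \<omega> where I: "finite I" "\<And>i. i \<in> I \<Longrightarrow> a i \<in> C"
      "\<And>i. functional (\<omega> i)" "\<And>x. ract \<phi> (f * x) = (\<Sum>i\<in>I. a i * ract (\<omega> i) x)"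
      by (rule ract_mult_expand[OF assms(1) fe(1) p]) (rule that)
    show "f * e \<in> {x. ract \<phi> x \<in> ?S}"
      using I(2) subcoalgebra_ract[OF assms(2) fe(2)]
      by (auto simp: I(4) intro!: subspace_sum[OF sS] mult_action.act_span_base)
  qed (rule ract.subspace_linear_preimage[OF sS])
  moreover have "?S \<subseteq> {x. lact \<phi> x \<in> ?S}"
  proof (rule mult_action.act_span_minimal)
    fix f e assume fe: "f \<in> C" "e \<in> E"
    obtain I :: "('a \<times> 'a) set" and a \<omega> where I: "finite I" "\<And>i. i \<in> I \<Longrightarrow> a i \<in> C"
      "\<And>i. functional (\<omega> i)" "\<And>x. lact \<phi> (f * x) = (\<Sum>i\<in>I. a i * lact (\<omega> i) x)"
      by (rule lact_mult_expand[OF assms(1) fe(1) p]) (rule that)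
    show "f * e \<in> {x. lact \<phi> x \<in> ?S}"
      using I(2) subcoalgebra_lact[OF assms(2) fe(2)]
      by (auto simp: I(4) intro!: subspace_sum[OF sS] mult_action.act_span_base)
  qed (rule lact.subspace_linear_preimage[OF sS])
  ultimately show "ract \<phi> x \<in> ?S \<and> lact \<phi> x \<in> ?S" using x by blast
qed simp

lemma subcoalgebra_plus:
  assumes "subcoalgebra C" "subcoalgebra E"
  shows "subcoalgebra (C + E)"
proof (rule subcoalgebraI)
  show "subspace (C + E)" using assms by (intro subspace_plus subcoalgebra_subspace)
  show "ract \<phi> x \<in> C + E \<and> lact \<phi> x \<in> C + E" if x: "x \<in> C + E" for \<phi> x
  proof -
    obtain c e where "c \<in> C" "e \<in> E" "x = c + e" using x unfolding set_plus_def by blast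
    thus ?thesis
      using assms by (auto simp: set_plus_def ract.add lact.add intro!: bexI subcoalgebra_ract subcoalgebra_lact)
  qed
qed

lemma growth_space_fd_subcoalgebra:
  assumes "fd_subspace C" "subcoalgebra C"
  shows "fd_subspace (growth_space C n) \<and> subcoalgebra (growth_space C n)"
proof (induction n)
  case 0
  show ?case using subcoalgebra_span_one fd_subspace_span[of "{1}"] by simp
next
  case (Suc n)
  thus ?case using assms
    by (simp add: fd_subspace_sum mult_action.fd_act_span subcoalgebra_plus subcoalgebra_prod_span)
qed

lemma dim_one: "dim {1} = 1"
  using dim_eq_card_independent[of "{1}"] by simp

end

text \<open>With \<open>r\<close> the \<open>d\<close>-th root of \<open>q\<close>, the sequence
  \<open>n / r ^ n\<close> tends to 0. The threshold \<open>1 / r\<close> pays for the shift: at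
  \<open>Suc N\<close> it reads \<open>N + 1 < r ^ N\<close>.\<close>

lemma exponential_beats_polynomial:
  fixes q :: real
  assumes "1 < q"
  shows "\<exists>n. real ((n + 1) ^ d) < q ^ n"
proof (cases "d = 0")
  case True
  thus ?thesis using assms by (intro exI[of _ 1]) simp
next
  case False
  define r where "r = root d q"
  have r: "1 < r" "r ^ d = q" using False assms unfolding r_def by (simp_all add: real_root_pow_pos2)
  have "(\<lambda>n. real n * (1 / r) ^ n) \<longlonglongrightarrow> 0"
    using r powser_times_n_limit_0[of "1 / r"] by simp
  hence "eventually (\<lambda>n. real n * (1 / r) ^ n < 1 / r) sequentially"
    using r by (intro order_tendstoD) auto
  then obtain N where N: "\<And>n. n \<ge> N \<Longrightarrow> real n * (1 / r) ^ n < 1 / r"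
    unfolding eventually_sequentially by blast
  have "real (Suc N) * (1 / r) ^ Suc N < 1 / r" by (rule N) simp
  hence "r * real (N + 1) < r * r ^ N" using r by (simp add: field_simps)
  hence "real (N + 1) < r ^ N" using r by simp
  hence "real (N + 1) ^ d < (r ^ N) ^ d" using False by (intro power_strict_mono) auto
  also have "(r ^ N) ^ d = q ^ N" unfolding r(2)[symmetric] by (simp add: power_mult[symmetric] mult.commute)
  finally show ?thesis by (intro exI[of _ N]) simp
qed

section \<open>Polynomial growth in the commutative case\<close>

context unital_algebra
begin

primrec monomial :: "('a \<Rightarrow> nat) \<Rightarrow> 'a list \<Rightarrow> 'a"
  where
    "monomial e [] = 1"
  | "monomial e (b # bs) = b ^ e b * monomial e bs"

lemma monomial_cong: "(\<And>b. b \<in> set bs \<Longrightarrow> e b = e' b) \<Longrightarrow> monomial e bs = monomial e' bs"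
  by (induction bs) auto

lemma monomial_mult:
  assumes comm: "\<And>x y :: 'a. x * y = y * x" and "distinct bs" "c \<in> set bs"
  shows "c * monomial e bs = monomial (e(c := Suc (e c))) bs"
  using assms(2,3)
proof (induction bs)
  case (Cons b bs)
  show ?case
  proof (cases "b = c")
    case True
    hence "monomial (e(c := Suc (e c))) bs = monomial e bs"
      using Cons.prems by (intro monomial_cong) auto
    thus ?thesis using True by (simp add: mult.assoc fun_upd_def)
  next
    case False
    have "c * (b ^ e b * monomial e bs) = b ^ e b * (c * monomial e bs)"
      using comm[of c "b ^ e b"] by (simp add: mult.assoc[symmetric])
    thus ?thesis using False Cons by simp
  qed
qed simp

text \<open>Each exponent is bounded, not the total degree: the count is then a plain power of
  \<open>n + 1\<close>, and multiplying by a generator still raises the bound by at most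
  one.\<close>

definition monomials :: "'a list \<Rightarrow> nat \<Rightarrow> 'a set"
  where "monomials bs n = (\<lambda>e. monomial e bs) ` PiE (set bs) (\<lambda>_. {..n})"

lemma finite_monomials: "finite (monomials bs n)"
  and card_monomials: "card (monomials bs n) \<le> (n + 1) ^ card (set bs)"
proof -
  have f: "finite (PiE (set bs) (\<lambda>_. {..n}))" by (intro finite_PiE) auto
  thus "finite (monomials bs n)" unfolding monomials_def by simp
  show "card (monomials bs n) \<le> (n + 1) ^ card (set bs)"
    unfolding monomials_def using card_image_le[OF f] by (simp add: card_PiE)
qed

lemma monomial_in_monomials:
  assumes "\<And>b. b \<in> set bs \<Longrightarrow> e b \<le> n"
  shows "monomial e bs \<in> monomials bs n"
proof -
  have "restrict e (set bs) \<in> PiE (set bs) (\<lambda>_. {..n})" using assms by simp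
  moreover have "monomial (restrict e (set bs)) bs = monomial e bs" by (rule monomial_cong) simp
  ultimately show ?thesis unfolding monomials_def by (metis image_eqI)
qed

lemma growth_space_monomials:
  assumes comm: "\<And>x y :: 'a. x * y = y * x" and d: "distinct bs"
  shows "growth_space (span (set bs)) n \<subseteq> span (monomials bs n)"
proof (induction n)
  case 0
  have "monomial (\<lambda>_. 0) bs = 1" by (induction bs) auto
  hence "1 \<in> monomials bs 0" using monomial_in_monomials[of bs "\<lambda>_. 0" 0] by simp
  thus ?case by (simp add: span_mono)
next
  case (Suc n)
  have 1: "monomials bs n \<subseteq> monomials bs (Suc n)"
  proof
    fix x assume "x \<in> monomials bs n"
    then obtain e where "x = monomial e bs" "\<And>b. b \<in> set bs \<Longrightarrow> e b \<le> n"
      unfolding monomials_def by auto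
    thus "x \<in> monomials bs (Suc n)" using monomial_in_monomials[of bs e "Suc n"] le_SucI by blast
  qed
  have "c * x \<in> monomials bs (Suc n)" if "c \<in> set bs" "x \<in> monomials bs n" for c x
  proof -
    obtain e where "x = monomial e bs" "\<And>b. b \<in> set bs \<Longrightarrow> e b \<le> n"
      using \<open>x \<in> monomials bs n\<close> unfolding monomials_def by auto
    thus ?thesis
      using monomial_in_monomials[of bs "e(c := Suc (e c))" "Suc n"] that
      by (simp add: monomial_mult[OF comm d] le_SucI)
  qed
  hence "prod_span (set bs) (monomials bs n) \<subseteq> span (monomials bs (Suc n))"
    by (intro mult_action.act_span_minimal span_base) auto
  hence 2: "prod_span (span (set bs)) (growth_space (span (set bs)) n) \<subseteq> span (monomials bs (Suc n))"
    using mult_action.act_span_mono[OF subset_refl Suc.IH, of "span (set bs)"]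
    by (simp add: mult_action.act_span_span)
  show ?case
    using 2 Suc.IH span_mono[OF 1] by (auto simp: set_plus_def intro!: span_add)
qed

end

section \<open>Parts (2) and (3): directed unions and slow growth\<close>

context hopf_algebra
begin

lemma amenable_directed_union:
  assumes ne: "I \<noteq> {}" and sub: "\<And>i. i \<in> I \<Longrightarrow> hopf_subalgebra (H i)"
    and dir: "\<And>i j. i \<in> I \<Longrightarrow> j \<in> I \<Longrightarrow> \<exists>k\<in>I. H i \<union> H j \<subseteq> H k"
    and un: "(\<Union>i\<in>I. H i) = UNIV" and am: "\<And>i. i \<in> I \<Longrightarrow> amenable (H i)"
  shows "amenable UNIV"
  unfolding amenable_def
proof (intro allI impI, elim conjE)
  fix F and \<epsilon> :: real assume F: "fd_subspace F" and e: "0 < \<epsilon>"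
  obtain B where B: "finite B" "F = span B" using F unfolding fd_subspace_def by blast
  have "\<exists>i\<in>I. B \<subseteq> H i" using B(1)
  proof (induction B rule: finite_induct)
    case (insert b B)
    then obtain i j where "i \<in> I" "B \<subseteq> H i" "j \<in> I" "b \<in> H j" using un by blast
    thus ?case using dir[of i j] by blast
  qed (use ne in blast)
  then obtain i where i: "i \<in> I" "B \<subseteq> H i" by blast
  have "F \<subseteq> H i"
    unfolding B using i sub[OF i(1)] unfolding hopf_subalgebra_def subalgebra_def
    by (intro span_minimal) auto
  thus "\<exists>E. fd_subspace E \<and> subcoalgebra E \<and> E \<subseteq> UNIV \<and>
    real (dim_quot (E + prod_span F E) E) < \<epsilon> * real (dim E)"
    using am[OF i(1)] F e unfolding amenable_def by blast
qed

text \<open>\<open>C\<close> is a finite-dimensional subcoalgebra around \<open>F\<close> and 1.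
  Because it contains 1, the space \<open>C E\<close> contains \<open>E + F E\<close>, whose
  dimension is at least \<open>1 + \<epsilon>\<close> times that of \<open>E\<close>. Because it is
  a subcoalgebra, its products with subcoalgebras are again subcoalgebras, so the inequality can be
  iterated.\<close>

lemma not_amenable_expanding:
  assumes K: "subcoalgebra K" "1 \<in> K" and na: "\<not> amenable K"
  obtains C \<epsilon> where "fd_subspace C" "subcoalgebra C" "1 \<in> C" "C \<subseteq> K" "0 < (\<epsilon>::real)"
    "\<And>E. fd_subspace E \<Longrightarrow> subcoalgebra E \<Longrightarrow> E \<subseteq> K \<Longrightarrow>
      (1 + \<epsilon>) * real (dim E) \<le> real (dim (prod_span C E))"
proof -
  obtain F \<epsilon> where F: "fd_subspace F" "F \<subseteq> K" "0 < (\<epsilon>::real)"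
    and G: "\<And>E. fd_subspace E \<Longrightarrow> subcoalgebra E \<Longrightarrow> E \<subseteq> K \<Longrightarrow>
      \<epsilon> * real (dim E) \<le> real (dim_quot (E + prod_span F E) E)"
    using na unfolding amenable_def by (meson linorder_not_le)
  have F1: "fd_subspace (F + span {1})" by (intro fd_subspace_sum fd_subspace_span F) simp
  have F2: "F + span {1} \<subseteq> K"
    using F K subspace_add[OF subcoalgebra_subspace[OF K(1)]]
      span_minimal[of "{1}" K] subcoalgebra_subspace[OF K(1)]
    by (auto simp: set_plus_def)
  obtain C where C: "fd_subspace C" "subcoalgebra C" "F + span {1} \<subseteq> C" "C \<subseteq> K"
    using fd_subcoalgebra_containing[OF F1 F2 K(1)] by blast
  have "0 \<in> F" using F fd_subspaceD subspace_0 by blast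
  hence FC: "F \<subseteq> C" "1 \<in> C"
    using C(3) span_base[of 1 "{1}"] span_zero[of "{1}"] by (force simp: set_plus_def)+
  show ?thesis
  proof (rule that[of C \<epsilon>])
    fix E assume E: "fd_subspace E" "subcoalgebra E" "E \<subseteq> K"
    have fd: "fd_subspace (prod_span C E)" using C(1) E(1) by (rule mult_action.fd_act_span)
    have "E \<subseteq> prod_span C E" using mult_action.act_span_base[OF FC(2), of _ E] by auto
    hence "E + prod_span F E \<subseteq> prod_span C E"
      using mult_action.act_span_mono[OF FC(1), of E E] subspace_add[OF mult_action.subspace_act_span]
      unfolding set_plus_def by blast
    hence "dim (E + prod_span F E) \<le> dim (prod_span C E)" by (rule fd_dim_mono[OF fd])
    thus "(1 + \<epsilon>) * real (dim E) \<le> real (dim (prod_span C E))"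
      using G[OF E] dim_quot_plus[OF E(1) F(1)] by (simp add: of_nat_diff algebra_simps)
  qed (use C F FC in auto)
qed

lemma subcoalgebra_UNIV: "subcoalgebra UNIV"
  by (rule subcoalgebraI) auto

lemma not_amenable_exponential_growth:
  assumes "\<not> amenable UNIV"
  obtains C \<epsilon> where "fd_subspace C" "0 < (\<epsilon>::real)" "\<And>n. (1 + \<epsilon>) ^ n \<le> real (dim (growth_space C n))"
proof -
  obtain C \<epsilon> where C: "fd_subspace C" "subcoalgebra C" "1 \<in> C" "0 < (\<epsilon>::real)"
    and exp: "\<And>E. fd_subspace E \<Longrightarrow> subcoalgebra E \<Longrightarrow> E \<subseteq> UNIV \<Longrightarrow>
      (1 + \<epsilon>) * real (dim E) \<le> real (dim (prod_span C E))"
    by (rule not_amenable_expanding[OF subcoalgebra_UNIV UNIV_I assms]) blast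
  have "(1 + \<epsilon>) ^ n \<le> real (dim (growth_space C n))" for n
  proof (induction n)
    case (Suc n)
    let ?B = "growth_space C n"
    have B: "fd_subspace ?B" "subcoalgebra ?B" using growth_space_fd_subcoalgebra C by blast+
    have "(1 + \<epsilon>) ^ Suc n \<le> (1 + \<epsilon>) * real (dim ?B)" using Suc C(4) by simp
    also have "\<dots> \<le> real (dim (prod_span C ?B))" using exp B by simp
    also have "\<dots> \<le> real (dim (growth_space C (Suc n)))"
    proof -
      have "prod_span C ?B \<subseteq> growth_space C (Suc n)"
        using subspace_0[OF fd_subspaceD[OF B(1)]] by (force simp: set_plus_def)
      thus ?thesis
        using fd_dim_mono growth_space_fd_subcoalgebra[OF C(1,2), of "Suc n"] by (meson of_nat_mono)
    qed
    finally show ?case .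
  qed (simp add: dim_one)
  thus ?thesis using that C by blast
qed

lemma amenable_of_subexp_growth:
  assumes "locally_subexp_growth"
  shows "amenable UNIV"
proof (rule ccontr)
  assume "\<not> amenable UNIV"
  then obtain C \<epsilon> where C: "fd_subspace C" "0 < (\<epsilon>::real)"
    "\<And>n. (1 + \<epsilon>) ^ n \<le> real (dim (growth_space C n))"
    by (rule not_amenable_exponential_growth) blast
  have "1 + \<epsilon> \<le> root n (real (dim (growth_space C n)))" if "n \<ge> 1" for n
  proof -
    have "1 + \<epsilon> = root n ((1 + \<epsilon>) ^ n)" using that C(2) by (simp add: real_root_power_cancel)
    also have "\<dots> \<le> root n (real (dim (growth_space C n)))" using C(3) that by simp
    finally show ?thesis .
  qed
  hence "ereal (1 + \<epsilon>) \<le> limsup (\<lambda>n. ereal (root n (real (dim (growth_space C n)))))"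
    by (intro le_Limsup) (auto simp: eventually_sequentially)
  thus False using assms C unfolding locally_subexp_growth_def by simp
qed

lemma amenable_of_commutative:
  assumes comm: "\<And>x y :: 'a. x * y = y * x"
  shows "amenable UNIV"
proof (rule ccontr)
  assume "\<not> amenable UNIV"
  then obtain C \<epsilon> where C: "fd_subspace C" "0 < (\<epsilon>::real)"
    "\<And>n. (1 + \<epsilon>) ^ n \<le> real (dim (growth_space C n))"
    by (rule not_amenable_exponential_growth) blast
  obtain B where B: "finite B" "C = span B" using C(1) unfolding fd_subspace_def by blast
  obtain bs where bs: "set bs = B" "distinct bs" using finite_distinct_list[OF B(1)] by blast
  obtain n where n: "real ((n + 1) ^ card (set bs)) < (1 + \<epsilon>) ^ n"
    using exponential_beats_polynomial[of "1 + \<epsilon>" "card (set bs)"] C(2) by auto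
  have "dim (growth_space C n) \<le> card (monomials bs n)"
    using growth_space_monomials[OF comm bs(2), of n] B(2) bs(1) finite_monomials
    by (intro dim_le_card) auto
  also have "\<dots> \<le> (n + 1) ^ card (set bs)" by (rule card_monomials)
  finally have "real (dim (growth_space C n)) \<le> real ((n + 1) ^ card (set bs))"
    by (rule of_nat_mono)
  thus False using n C(3)[of n] by linarith
qed

end

section \<open>Additivity of the expansion inequality along a linear map\<close>

locale kspace_action_pair =
  a1: kspace_action s s1 act1 + a2: kspace_action s s2 act2
  for s :: "'k::field \<Rightarrow> 'b::ab_group_add \<Rightarrow> 'b"
    and s1 :: "'k \<Rightarrow> 'c::ab_group_add \<Rightarrow> 'c" and act1
    and s2 :: "'k \<Rightarrow> 'd::ab_group_add \<Rightarrow> 'd" and act2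
begin

sublocale p: kspace_pair s1 s2
  by unfold_locales

text \<open>The image of \<open>F U\<close> under \<open>q\<close> contains \<open>F q(U)\<close>,
  and the kernel of \<open>q\<close> on \<open>F U\<close> contains \<open>F\<close> times the
  kernel of \<open>q\<close> on \<open>U\<close>; rank-nullity adds the two. So lower bounds for a
  kernel and an image add up to one for \<open>U\<close>. Commutation is asked for on
  \<open>F\<close> and \<open>U\<close> only, because the map in \<open>strict_extension\<close> is
  \<open>K\<close>-linear just on the enlarged submodule.\<close>

lemma dim_act_span_ge:
  assumes q: "Vector_Spaces.linear s1 s2 q"
    and F: "a1.k1.fd_subspace F" and U: "a1.k2.fd_subspace U"
    and comm: "\<And>f u. f \<in> F \<Longrightarrow> u \<in> U \<Longrightarrow> q (act1 f u) = act2 f (q u)"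
  shows "a2.k2.dim (a2.act_span F (q ` U)) + a1.k2.dim (a1.act_span F (U \<inter> {x. q x = 0}))
    \<le> a1.k2.dim (a1.act_span F U)"
proof -
  interpret q: Vector_Spaces.linear s1 s2 q by fact
  let ?FU = "a1.act_span F U"
  have fd: "a1.k2.fd_subspace ?FU" using F U by (rule a1.fd_act_span)
  have "a2.act_span F (q ` U) \<subseteq> q ` ?FU"
  proof (rule a2.act_span_minimal)
    show "act2 f e \<in> q ` ?FU" if fe: "f \<in> F" "e \<in> q ` U" for f e
    proof -
      obtain u where u: "u \<in> U" "e = q u" using fe(2) by blast
      have "act1 f u \<in> ?FU" using fe(1) u(1) by (rule a1.act_span_base)
      thus ?thesis using comm[OF fe(1) u(1)] u(2) by (metis image_eqI)
    qed
    show "a2.k2.subspace (q ` ?FU)" by (rule q.subspace_image) simp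
  qed
  hence 1: "a2.k2.dim (a2.act_span F (q ` U)) \<le> a2.k2.dim (q ` ?FU)"
    by (rule a2.k2.fd_dim_mono[OF p.fd_image[OF q fd]])
  have "a1.act_span F (U \<inter> {x. q x = 0}) \<subseteq> ?FU \<inter> {x. q x = 0}"
  proof (rule a1.act_span_minimal)
    show "act1 f e \<in> ?FU \<inter> {x. q x = 0}" if fe: "f \<in> F" "e \<in> U \<inter> {x. q x = 0}" for f e
    proof -
      interpret l: Vector_Spaces.linear s2 s2 "act2 f" by (rule a2.linear_act_right)
      show ?thesis using fe comm[of f e] a1.act_span_base[of f F e U] by simp
    qed
    show "a1.k2.subspace (?FU \<inter> {x. q x = 0})"
      using q.subspace_kernel by (intro a1.k2.subspace_inter) simp_all
  qed
  moreover have "a1.k2.fd_subspace (?FU \<inter> {x. q x = 0})"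
    using q.subspace_kernel by (intro a1.k2.fd_subspace_subset[OF fd] a1.k2.subspace_inter) simp_all
  ultimately have "a1.k2.dim (a1.act_span F (U \<inter> {x. q x = 0})) \<le> a1.k2.dim (?FU \<inter> {x. q x = 0})"
    by (intro a1.k2.fd_dim_mono)
  thus ?thesis using 1 p.rank_nullity[OF q fd] by simp
qed

end

subsection \<open>The dual algebra of a cocommutative Hopf algebra\<close>

context bialgebra
begin

lemma ract_nonfunctional: "\<not> functional \<phi> \<Longrightarrow> ract \<phi> x = 0"
  by (simp add: ract_def)

lemma functional_0: "functional (\<lambda>_. 0)"
  by (simp add: functionalI)

lemma functional_plus: "functional \<phi> \<Longrightarrow> functional \<psi> \<Longrightarrow> functional (\<lambda>x. \<phi> x + \<psi> x)"
  by (rule functionalI) (simp_all add: functional_add functional_scale distrib_left)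

lemma functional_Sum: "(\<And>i. i \<in> I \<Longrightarrow> functional (f i)) \<Longrightarrow> functional (\<lambda>x. \<Sum>i\<in>I. f i x)"
  by (induction I rule: infinite_finite_induct)
    (simp_all add: functional_0 functional_plus)

lemma ract_functional_0: "ract (\<lambda>_. 0) x = 0"
  using ract_functional_scale[OF functional_0, of 0 x] by simp

lemma ract_functional_sum:
  "(\<And>i. i \<in> I \<Longrightarrow> functional (f i)) \<Longrightarrow> ract (\<lambda>x. \<Sum>i\<in>I. f i x) y = (\<Sum>i\<in>I. ract (f i) y)"
  by (induction I rule: infinite_finite_induct)
    (simp_all add: ract_functional_0 ract_functional_add functional_Sum)

text \<open>The convolution product, \<open>\<phi> x\<^sub>1 * \<psi> x\<^sub>2\<close> summed. The
  zero default makes every value a functional.\<close>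

definition conv :: "('a \<Rightarrow> 'k) \<Rightarrow> ('a \<Rightarrow> 'k) \<Rightarrow> 'a \<Rightarrow> 'k"
  where "conv \<phi> \<psi> = (if functional \<phi> \<and> functional \<psi> then (\<lambda>x. \<phi> (ract \<psi> x)) else (\<lambda>_. 0))"

lemma functional_conv: "functional (conv \<phi> \<psi>)"
  by (simp add: conv_def functional_ract functional_0)

lemma ract_conv: "ract (conv \<phi> \<psi>) x = ract \<phi> (ract \<psi> x)"
proof (cases "functional \<phi> \<and> functional \<psi>")
  case False
  hence "ract \<phi> (ract \<psi> x) = 0" by (auto simp: ract_nonfunctional)
  thus ?thesis using False by (auto simp: conv_def ract_functional_0)
qed (simp add: conv_def ract_ract)

end

locale cocommutative_hopf_algebra = hopf_algebra scale comult counit antipode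
  for scale :: "'k::field \<Rightarrow> 'a::ring_1 \<Rightarrow> 'a" and comult counit antipode +
  assumes cocommutative: cocommutative
begin

lemma lact_eq_ract: "lact \<phi> x = ract \<phi> x"
  by (rule cocommutative_lact_eq_ract[OF cocommutative])

lemma ract_commute: "ract \<phi> (ract \<psi> x) = ract \<psi> (ract \<phi> x)"
proof (cases "functional \<phi> \<and> functional \<psi>")
  case True
  thus ?thesis using lact_ract[of \<phi> \<psi> x] by (simp add: lact_eq_ract)
next
  case False
  thus ?thesis by (auto simp: ract_nonfunctional)
qed

lemma subcoalgebra_iff: "subcoalgebra E \<longleftrightarrow> subspace E \<and> (\<forall>\<phi>. \<forall>x\<in>E. ract \<phi> x \<in> E)"
  using subcoalgebraI[of E] subcoalgebra_subspace subcoalgebra_ract by (auto simp: lact_eq_ract)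

text \<open>This is the antipode law \<open>S(v\<^sub>1) v\<^sub>2 = \<epsilon>(v) 1\<close> with
  \<open>v\<^sub>1\<close> expanded over \<open>X\<close>. The second factor belonging to
  \<open>h\<close> is \<open>lact (\<eta> h) v\<close>, which equals
  \<open>ract (\<eta> h) v\<close> by cocommutativity.\<close>

lemma sum_antipode_mult_ract:
  assumes "subcoalgebra E"
    "\<And>v. v \<in> E \<Longrightarrow> (\<Sum>h\<in>X. scale (\<eta> h v) h) = v" "\<And>h. functional (\<eta> h)" "v \<in> E"
  shows "(\<Sum>h\<in>X. antipode h * ract (\<eta> h) v) = scale (counit v) 1"
proof -
  interpret S: Vector_Spaces.linear scale scale antipode by (rule antipode_linear)
  obtain u where u: "Poly_Mapping.keys u \<subseteq> E \<times> E" "tensor2_eq (comult v) u"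
    using subcoalgebra_rep[OF assms(1,4)] by blast
  have b1: "bilin scale (\<lambda>a c. antipode a * c)"
    unfolding bilin_def Vector_Spaces.linear_iff
    by (simp add: vector_space_axioms distrib_left distrib_right S.add S.scale scale_mult_left scale_mult_right)
  have b2: "bilin scale (\<lambda>a c. \<Sum>h\<in>X. antipode h * scale (\<eta> h a) c)"
    unfolding bilin_def Vector_Spaces.linear_iff
    using assms(3)
    by (simp add: vector_space_axioms distrib_left distrib_right scale_mult_left scale_mult_right
        functional_add functional_scale scale_right_distrib scale_left_distrib sum.distrib
        scale_sum_right mult.commute)
  have "(\<Sum>h\<in>X. antipode h * ract (\<eta> h) v) = sweedler scale (\<lambda>a c. \<Sum>h\<in>X. antipode h * scale (\<eta> h a) c) v"
    using assms(3)
    by (simp add: sweedler_sum[OF vector_space_axioms] lact_eq_ract[symmetric] lact_sweedler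
        sweedler_comp[OF linear_mult_left])
  also have "\<dots> = sweedler scale (\<lambda>a c. antipode a * c) v"
  proof (rule sweedler_cong_rep[OF b2 b1 u(2)])
    fix a c assume "(a, c) \<in> Poly_Mapping.keys u"
    hence a: "a \<in> E" using u(1) by blast
    have "(\<Sum>h\<in>X. antipode h * scale (\<eta> h a) c) = antipode (\<Sum>h\<in>X. scale (\<eta> h a) h) * c"
      by (simp add: S.sum S.scale sum_distrib_right scale_mult_left scale_mult_right)
    thus "(\<Sum>h\<in>X. antipode h * scale (\<eta> h a) c) = antipode a * c" by (simp only: assms(2)[OF a])
  qed
  also have "\<dots> = scale (counit v) 1" using antipode_left unfolding sweedler_def .
  finally show ?thesis .
qed

text \<open>The smallest subcoalgebra containing \<open>x\<close>; it is already a subspace because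
  the functionals form one.\<close>

definition orbit :: "'a \<Rightarrow> 'a set"
  where "orbit x = {ract \<phi> x | \<phi>. functional \<phi>}"

lemma orbit_self: "x \<in> orbit x"
  unfolding orbit_def using ract_counit[of x] functional_counit by force

lemma subcoalgebra_orbit: "subcoalgebra (orbit x)"
  unfolding subcoalgebra_iff
proof (intro conjI allI ballI)
  show "subspace (orbit x)"
  proof (rule subspaceI)
    show "0 \<in> orbit x" unfolding orbit_def using ract_functional_0[of x] functional_0 by force
    show "y + z \<in> orbit x" if yz: "y \<in> orbit x" "z \<in> orbit x" for y z
    proof -
      obtain \<phi> \<psi> where "functional \<phi>" "functional \<psi>" "y = ract \<phi> x" "z = ract \<psi> x"
        using yz unfolding orbit_def by blast
      thus ?thesis unfolding orbit_def
        using ract_functional_add[of \<phi> \<psi> x] functional_plus[of \<phi> \<psi>]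
        by (auto intro!: exI[of _ "\<lambda>x. \<phi> x + \<psi> x"])
    qed
    show "scale c y \<in> orbit x" if y: "y \<in> orbit x" for c y
    proof -
      obtain \<phi> where "functional \<phi>" "y = ract \<phi> x" using y unfolding orbit_def by blast
      thus ?thesis unfolding orbit_def
        using ract_functional_scale[of \<phi> c x] functional_const_mult[of \<phi> c]
        by (auto intro!: exI[of _ "\<lambda>x. c * \<phi> x"])
    qed
  qed
  show "ract \<psi> y \<in> orbit x" if y: "y \<in> orbit x" for \<psi> y
  proof -
    obtain \<phi> where "functional \<phi>" "y = ract \<phi> x" using y unfolding orbit_def by blast
    hence "ract \<psi> y = ract (conv \<psi> \<phi>) x" by (simp add: ract_conv)
    thus ?thesis unfolding orbit_def using functional_conv by blast
  qed
qed

lemma orbit_subset: "subcoalgebra E \<Longrightarrow> x \<in> E \<Longrightarrow> orbit x \<subseteq> E"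
  unfolding orbit_def using subcoalgebra_ract by auto

definition vscale :: "'k \<Rightarrow> (('a \<Rightarrow> 'k) \<Rightarrow> 'a) \<Rightarrow> ('a \<Rightarrow> 'k) \<Rightarrow> 'a"
  where "vscale c z = (\<lambda>\<chi>. scale c (z \<chi>))"

definition vact :: "'a \<Rightarrow> (('a \<Rightarrow> 'k) \<Rightarrow> 'a) \<Rightarrow> ('a \<Rightarrow> 'k) \<Rightarrow> 'a"
  where "vact k z = (\<lambda>\<chi>. k * z \<chi>)"

definition vract :: "('a \<Rightarrow> 'k) \<Rightarrow> (('a \<Rightarrow> 'k) \<Rightarrow> 'a) \<Rightarrow> ('a \<Rightarrow> 'k) \<Rightarrow> 'a"
  where "vract \<phi> z = (\<lambda>\<chi>. ract \<phi> (z \<chi>))"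

definition shift :: "('a \<Rightarrow> 'k) \<Rightarrow> (('a \<Rightarrow> 'k) \<Rightarrow> 'a) \<Rightarrow> ('a \<Rightarrow> 'k) \<Rightarrow> 'a"
  where "shift \<phi> z = (\<lambda>\<chi>. z (conv \<chi> \<phi>))"

text \<open>Under \<open>k \<otimes> y \<mapsto> \<Sum> k y\<^sub>1 \<otimes> y\<^sub>2\<close> the space \<open>K \<otimes> D\<close> embeds into \<open>H \<otimes> D\<close>, whose
  elements are viewed as maps \<open>H\<^sup>* \<Rightarrow> H\<close>. The diagonal coaction of \<open>K \<otimes> D\<close> then becomes the
  coaction \<open>vract\<close> on values, and \<open>D\<^sup>*\<close> acts on the second factor by \<open>shift\<close>.\<close>

definition emb :: "'a \<Rightarrow> 'a \<Rightarrow> ('a \<Rightarrow> 'k) \<Rightarrow> 'a"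
  where "emb k y = (\<lambda>\<chi>. k * ract \<chi> y)"

sublocale V: kspace vscale
  by unfold_locales
    (auto simp: vscale_def fun_eq_iff scale_right_distrib scale_left_distrib)

sublocale vmult: kspace_action scale vscale vact
  by unfold_locales
    (auto simp: vscale_def vact_def fun_eq_iff distrib_left distrib_right scale_mult_left scale_mult_right
      scale_right_distrib scale_left_distrib)

lemma vlinear_vract: "Vector_Spaces.linear vscale vscale (vract \<phi>)"
  and vlinear_shift: "Vector_Spaces.linear vscale vscale (shift \<phi>)"
  unfolding Vector_Spaces.linear_iff
  by (auto simp: V.vector_space_axioms vscale_def vract_def shift_def fun_eq_iff ract.add ract.scale)

sublocale vract: Vector_Spaces.linear vscale vscale "vract \<phi>" for \<phi>
  by (rule vlinear_vract)

sublocale shift: Vector_Spaces.linear vscale vscale "shift \<phi>" for \<phi>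
  by (rule vlinear_shift)

sublocale vact: Vector_Spaces.linear vscale vscale "vact k" for k
  by (rule vmult.linear_act_right)

lemma shift_vract: "shift \<phi> (vract \<psi> z) = vract \<psi> (shift \<phi> z)"
  and shift_vact: "shift \<phi> (vact k z) = vact k (shift \<phi> z)"
  by (simp_all add: shift_def vract_def vact_def)

lemma shift_emb: "shift \<phi> (emb k y) = emb k (ract \<phi> y)"
  by (simp add: shift_def emb_def ract_conv)

lemma vact_emb: "vact k' (emb k y) = emb (k' * k) y"
  by (simp add: vact_def emb_def mult.assoc)

lemma emb_sum_right: "emb k (\<Sum>i\<in>I. f i) = (\<Sum>i\<in>I. emb k (f i))"
  by (induction I rule: infinite_finite_induct)
    (simp_all add: emb_def fun_eq_iff ract.add distrib_left ract.zero)

lemma emb_scale_right: "emb k (scale c y) = vscale c (emb k y)"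
  and emb_scale_left: "emb (scale c k) y = vscale c (emb k y)"
  by (simp_all add: emb_def vscale_def ract.scale scale_mult_left scale_mult_right)

text \<open>The same \<open>a\<close> and \<open>\<omega>\<close> describe the coaction on
  \<open>emb k y\<close> and on products \<open>k * x\<close> in \<open>H\<close>, which is what
  \<open>lift_vract\<close> compares. Commutativity of the dual moves \<open>\<omega> i\<close> past
  the argument of the function \<open>emb k y\<close>.\<close>

lemma vract_emb:
  assumes "subcoalgebra K" "k \<in> K" "functional \<phi>"
  obtains I :: "('a \<times> 'a) set" and a \<omega> where "finite I" "\<And>i. i \<in> I \<Longrightarrow> a i \<in> K"
    "\<And>i. functional (\<omega> i)" "\<And>y. vract \<phi> (emb k y) = (\<Sum>i\<in>I. emb (a i) (ract (\<omega> i) y))"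
    "\<And>x. ract \<phi> (k * x) = (\<Sum>i\<in>I. a i * ract (\<omega> i) x)"
proof -
  obtain I :: "('a \<times> 'a) set" and a \<omega> where I: "finite I" "\<And>i. i \<in> I \<Longrightarrow> a i \<in> K"
    "\<And>i. functional (\<omega> i)" "\<And>x. ract \<phi> (k * x) = (\<Sum>i\<in>I. a i * ract (\<omega> i) x)"
    by (rule ract_mult_expand[OF assms]) (rule that)
  have s: "(\<Sum>i\<in>J. f i) \<chi> = (\<Sum>i\<in>J. f i \<chi>)" for J and f :: "'a \<times> 'a \<Rightarrow> ('a \<Rightarrow> 'k) \<Rightarrow> 'a" and \<chi>
    by (induction J rule: infinite_finite_induct) simp_all
  have "vract \<phi> (emb k y) = (\<Sum>i\<in>I. emb (a i) (ract (\<omega> i) y))" for y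
    by (rule ext) (simp add: s, simp add: vract_def emb_def I(4) ract_commute)
  thus ?thesis using that I by blast
qed

end

subsection \<open>Hopf modules induced from simple subcoalgebras\<close>

text \<open>A subcoalgebra \<open>D\<close> all of whose nonzero elements generate the distinguished element \<open>d\<close>,
  with a basis \<open>B\<close> and dual basis \<open>\<psi>\<close>; thus \<open>D\<^sup>*\<close> is a field.\<close>

locale simple_subcoalgebra = cocommutative_hopf_algebra scale comult counit antipode
  for scale :: "'k::field \<Rightarrow> 'a::ring_1 \<Rightarrow> 'a" and comult counit antipode +
  fixes K D :: "'a set" and d :: 'a and B :: "'a set" and \<psi> :: "'a \<Rightarrow> 'a \<Rightarrow> 'k"
  assumes K: "hopf_subalgebra K"
    and D: "subcoalgebra D" and d: "d \<in> D"
    and D_orbit: "\<And>y. y \<in> D \<Longrightarrow> \<exists>\<phi>. functional \<phi> \<and> ract \<phi> d = y"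
    and D_simple: "\<And>y. y \<in> D \<Longrightarrow> y \<noteq> 0 \<Longrightarrow> \<exists>\<phi>. functional \<phi> \<and> ract \<phi> y = d"
    and finite_B: "finite B" and B_D: "B \<subseteq> D"
    and functional_\<psi>: "\<And>b. functional (\<psi> b)"
    and \<psi>_dual: "\<And>b c. b \<in> B \<Longrightarrow> c \<in> B \<Longrightarrow> \<psi> b c = (if b = c then 1 else 0)"
    and \<psi>_expand: "\<And>y. y \<in> D \<Longrightarrow> (\<Sum>b\<in>B. scale (\<psi> b y) b) = y"
begin

lemma K_subcoalgebra: "subcoalgebra K" and K_mult: "x \<in> K \<Longrightarrow> y \<in> K \<Longrightarrow> x * y \<in> K"
  and K_one: "1 \<in> K" and K_antipode: "x \<in> K \<Longrightarrow> antipode x \<in> K"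
  using K unfolding hopf_subalgebra_def subalgebra_def by auto

lemma K_subspace: "subspace K" and D_subspace: "subspace D"
  using K_subcoalgebra D subcoalgebra_subspace by auto

lemma D_ract: "y \<in> D \<Longrightarrow> ract \<phi> y \<in> D"
  using subcoalgebra_ract[OF D] .

text \<open>On \<open>D\<close> a functional acts through its restriction, a combination of the
  \<open>\<psi> b\<close>. Later this reduces all translations of \<open>K \<otimes> D\<close> to
  finitely many.\<close>

lemma ract_D_eq:
  assumes "y \<in> D" "functional \<phi>"
  shows "ract \<phi> y = (\<Sum>b\<in>B. scale (\<phi> b) (ract (\<psi> b) y))"
proof -
  have f: "functional (\<lambda>v. \<phi> b * \<psi> b v)" for b by (rule functional_const_mult[OF functional_\<psi>])
  have "\<phi> v = (\<Sum>b\<in>B. \<phi> b * \<psi> b v)" if v: "v \<in> D" for v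
  proof -
    have "\<phi> v = \<phi> (\<Sum>b\<in>B. scale (\<psi> b v) b)" using \<psi>_expand[OF v] by simp
    also have "\<dots> = (\<Sum>b\<in>B. \<phi> b * \<psi> b v)"
      using assms(2) by (simp add: functional_sum functional_scale mult.commute)
    finally show ?thesis .
  qed
  hence "ract \<phi> y = ract (\<lambda>v. \<Sum>b\<in>B. \<phi> b * \<psi> b v) y"
    by (intro ract_cong_subcoalgebra[OF D assms(1)] assms(2) functional_Sum f)
  also have "\<dots> = (\<Sum>b\<in>B. scale (\<phi> b) (ract (\<psi> b) y))"
    by (simp add: ract_functional_sum[OF f] ract_functional_scale[OF functional_\<psi>])
  finally show ?thesis .
qed

lemma sum_ract_mult_antipode:
  assumes y: "y \<in> D"
  shows "(\<Sum>b\<in>B. ract (\<psi> b) y * antipode b) = scale (counit y) 1"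
proof -
  interpret S: Vector_Spaces.linear scale scale antipode by (rule antipode_linear)
  obtain u where u: "Poly_Mapping.keys u \<subseteq> D \<times> D" "tensor2_eq (comult y) u"
    using subcoalgebra_rep[OF D y] by blast
  have b1: "bilin scale (\<lambda>a c. a * antipode c)"
    unfolding bilin_def Vector_Spaces.linear_iff
    by (simp add: vector_space_axioms distrib_left distrib_right S.add S.scale scale_mult_left scale_mult_right)
  have b2: "bilin scale (\<lambda>a c. \<Sum>b\<in>B. scale (\<psi> b c) a * antipode b)"
    unfolding bilin_def Vector_Spaces.linear_iff
    using functional_\<psi>
    by (simp add: vector_space_axioms distrib_left distrib_right scale_mult_left scale_mult_right
        functional_add functional_scale scale_right_distrib scale_left_distrib sum.distrib
        scale_sum_right mult.commute)
  have "(\<Sum>b\<in>B. ract (\<psi> b) y * antipode b) = sweedler scale (\<lambda>a c. \<Sum>b\<in>B. scale (\<psi> b c) a * antipode b) y"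
    using functional_\<psi>
    by (simp add: sweedler_sum[OF vector_space_axioms] ract_sweedler sweedler_comp[OF linear_mult_right])
  also have "\<dots> = sweedler scale (\<lambda>a c. a * antipode c) y"
  proof (rule sweedler_cong_rep[OF b2 b1 u(2)])
    fix a c assume "(a, c) \<in> Poly_Mapping.keys u"
    hence c: "c \<in> D" using u(1) by blast
    have "(\<Sum>b\<in>B. scale (\<psi> b c) a * antipode b) = a * antipode (\<Sum>b\<in>B. scale (\<psi> b c) b)"
      by (simp add: S.sum S.scale sum_distrib_left scale_mult_left scale_mult_right)
    thus "(\<Sum>b\<in>B. scale (\<psi> b c) a * antipode b) = a * antipode c" by (simp only: \<psi>_expand[OF c])
  qed
  also have "\<dots> = scale (counit y) 1" using antipode_right unfolding sweedler_def .
  finally show ?thesis .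
qed

text \<open>The left side is the sum of \<open>y\<^sub>1\<close> with weights
  \<open>\<omega> (y\<^sub>2 * S(y\<^sub>3))\<close>, where \<open>b\<close> runs through the values
  of \<open>y\<^sub>3\<close>. The antipode law turns the weight into
  \<open>\<omega> 1 * \<epsilon>(y\<^sub>2)\<close>.\<close>

lemma sum_ract_antipode_ract:
  assumes y: "y \<in> D" and w: "functional \<omega>"
  shows "(\<Sum>b\<in>B. ract (\<lambda>x. \<omega> (x * antipode b)) (ract (\<psi> b) y)) = scale (\<omega> 1) y"
proof -
  let ?f = "\<lambda>b v. \<omega> (ract (\<psi> b) v * antipode b)"
  have f: "functional (?f b)" for b using functional_ract[OF functional_mult_right[OF w]] .
  have "(\<Sum>b\<in>B. ract (\<lambda>x. \<omega> (x * antipode b)) (ract (\<psi> b) y)) = ract (\<lambda>v. \<Sum>b\<in>B. ?f b v) y"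
    by (simp add: ract_ract[OF functional_mult_right[OF w] functional_\<psi>] ract_functional_sum[OF f])
  also have "\<dots> = ract (\<lambda>v. \<omega> 1 * counit v) y"
  proof (intro ract_cong_subcoalgebra[OF D y] functional_Sum f functional_const_mult functional_counit)
    fix v assume v: "v \<in> D"
    have "(\<Sum>b\<in>B. ?f b v) = \<omega> (\<Sum>b\<in>B. ract (\<psi> b) v * antipode b)" by (simp add: functional_sum[OF w])
    thus "(\<Sum>b\<in>B. ?f b v) = \<omega> 1 * counit v"
      using sum_ract_mult_antipode[OF v] by (simp add: functional_scale[OF w])
  qed
  finally show ?thesis by (simp add: ract_functional_scale functional_counit ract_counit)
qed

text \<open>The left side is the sum of \<open>k\<^sub>1 * y\<^sub>1\<close> with weights
  \<open>\<chi> (k\<^sub>2 * y\<^sub>2 * S(y\<^sub>3))\<close>. Absorbing \<open>k\<^sub>2\<close>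
  into the functional reduces it to the preceding lemma.\<close>

lemma sum_ract_antipode_mult:
  assumes y: "y \<in> D" and c: "functional \<chi>"
  shows "(\<Sum>b\<in>B. ract (\<lambda>x. \<chi> (x * antipode b)) (k * ract (\<psi> b) y)) = ract \<chi> k * y"
proof -
  have "(\<Sum>b\<in>B. ract (\<lambda>x. \<chi> (x * antipode b)) (k * ract (\<psi> b) y))
    = sweedler scale (\<lambda>a a'. a * (\<Sum>b\<in>B. ract (\<lambda>x. \<chi> (a' * (x * antipode b))) (ract (\<psi> b) y))) k"
    by (simp add: ract_mult[OF functional_mult_right[OF c]] sweedler_sum[OF vector_space_axioms]
        sum_distrib_left mult.assoc)
  also have "\<dots> = sweedler scale (\<lambda>a a'. scale (\<chi> a') a * y) k"
    using sum_ract_antipode_ract[OF y functional_mult_left[OF c]]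
    by (simp add: scale_mult_left scale_mult_right)
  also have "\<dots> = ract \<chi> k * y"
    by (simp add: ract_sweedler[OF c] sweedler_comp[OF linear_mult_right])
  finally show ?thesis .
qed

definition W :: "(('a \<Rightarrow> 'k) \<Rightarrow> 'a) set"
  where "W = V.span {emb k y | k y. k \<in> K \<and> y \<in> D}"

lemma subspace_W [simp]: "V.subspace W"
  unfolding W_def by simp

lemma emb_W: "k \<in> K \<Longrightarrow> y \<in> D \<Longrightarrow> emb k y \<in> W"
  unfolding W_def by (rule V.span_base) blast

lemma W_induct:
  assumes "z \<in> W" "V.subspace {z. P z}" "\<And>k y. k \<in> K \<Longrightarrow> y \<in> D \<Longrightarrow> P (emb k y)"
  shows "P z"
proof -
  have "W \<subseteq> {z. P z}" unfolding W_def using assms(2,3) by (intro V.span_minimal) auto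
  thus ?thesis using assms(1) by blast
qed

sublocale VV: kspace_pair vscale vscale
  by unfold_locales

sublocale VH: kspace_pair vscale scale
  by unfold_locales

lemma subspace_equalizer:
  assumes "Vector_Spaces.linear vscale s f" "Vector_Spaces.linear vscale s g"
  shows "V.subspace {z. f z = g z}"
proof -
  interpret f: Vector_Spaces.linear vscale s f by fact
  interpret g: Vector_Spaces.linear vscale s g by fact
  show ?thesis by (rule V.subspaceI) (auto simp: f.add g.add f.scale g.scale f.zero g.zero)
qed

text \<open>The map \<open>id \<otimes> \<phi>\<close> from \<open>K \<otimes> D\<close> to
  \<open>K\<close>, as \<open>coord_emb\<close> shows. The antipode undoes the twist
  \<open>k \<otimes> y \<mapsto> k y\<^sub>1 \<otimes> y\<^sub>2\<close> that is built into
  \<open>emb\<close>.\<close>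

definition coord :: "('a \<Rightarrow> 'k) \<Rightarrow> (('a \<Rightarrow> 'k) \<Rightarrow> 'a) \<Rightarrow> 'a"
  where "coord \<phi> z = (\<Sum>b\<in>B. shift \<phi> z (\<psi> b) * antipode b)"

lemma vlinear_coord: "Vector_Spaces.linear vscale scale (coord \<phi>)"
  unfolding Vector_Spaces.linear_iff
  by (auto simp: V.vector_space_axioms vector_space_axioms coord_def shift.add shift.scale
      distrib_right sum.distrib scale_sum_right scale_mult_left)
    (simp add: vscale_def scale_mult_left)

sublocale coord: Vector_Spaces.linear vscale scale "coord \<phi>" for \<phi>
  by (rule vlinear_coord)

lemma coord_emb:
  assumes "y \<in> D" "functional \<phi>"
  shows "coord \<phi> (emb k y) = scale (\<phi> y) k"
proof -
  have "coord \<phi> (emb k y) = k * (\<Sum>b\<in>B. ract (\<psi> b) (ract \<phi> y) * antipode b)"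
    by (simp add: coord_def shift_emb) (simp add: emb_def sum_distrib_left mult.assoc)
  thus ?thesis
    by (simp add: sum_ract_mult_antipode[OF D_ract[OF assms(1)]] counit_ract[OF assms(2)] scale_mult_right)
qed

lemma coord_vact: "coord \<phi> (vact k z) = k * coord \<phi> z"
  unfolding coord_def shift_vact by (simp add: vact_def sum_distrib_left mult.assoc)

lemma coord_K:
  assumes "z \<in> W" "functional \<phi>"
  shows "coord \<phi> z \<in> K"
  using assms(1)
proof (rule W_induct)
  show "V.subspace {z. coord \<phi> z \<in> K}" by (rule coord.subspace_linear_preimage[OF K_subspace])
  show "coord \<phi> (emb k y) \<in> K" if "k \<in> K" "y \<in> D" for k y
    using that coord_emb[OF that(2) assms(2)] subspace_scale[OF K_subspace] by simp
qed

lemma vlinear_emb_coord: "Vector_Spaces.linear vscale vscale (\<lambda>z. \<Sum>b\<in>B. emb (coord (\<psi> b) z) b)"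
  unfolding Vector_Spaces.linear_iff
proof (intro conjI allI V.vector_space_axioms)
  have e: "emb (k + k') y = emb k y + emb k' y" for k k' y
    by (simp add: emb_def fun_eq_iff distrib_right)
  show "(\<Sum>b\<in>B. emb (coord (\<psi> b) (x + y)) b) = (\<Sum>b\<in>B. emb (coord (\<psi> b) x) b) + (\<Sum>b\<in>B. emb (coord (\<psi> b) y) b)"
    for x y by (simp add: coord.add e sum.distrib)
  show "(\<Sum>b\<in>B. emb (coord (\<psi> b) (vscale c x)) b) = vscale c (\<Sum>b\<in>B. emb (coord (\<psi> b) x) b)" for c x
    by (simp add: coord.scale emb_scale_left V.scale_sum_right)
qed

lemma W_expand:
  assumes "z \<in> W"
  shows "z = (\<Sum>b\<in>B. emb (coord (\<psi> b) z) b)"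
  using assms
proof (rule W_induct)
  show "V.subspace {z. z = (\<Sum>b\<in>B. emb (coord (\<psi> b) z) b)}"
    by (rule subspace_equalizer[OF V.linear_ident vlinear_emb_coord])
  show "emb k y = (\<Sum>b\<in>B. emb (coord (\<psi> b) (emb k y)) b)" if "k \<in> K" "y \<in> D" for k y
  proof -
    have "emb k y = emb k (\<Sum>b\<in>B. scale (\<psi> b y) b)" by (simp add: \<psi>_expand[OF that(2)])
    also have "\<dots> = (\<Sum>b\<in>B. emb (coord (\<psi> b) (emb k y)) b)"
      by (simp add: coord_emb[OF that(2) functional_\<psi>] emb_sum_right emb_scale_right emb_scale_left)
    finally show ?thesis .
  qed
qed

lemma W_zeroI:
  assumes "z \<in> W" "\<And>b. b \<in> B \<Longrightarrow> coord (\<psi> b) z = 0"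
  shows "z = 0"
proof -
  have "emb 0 y = 0" for y by (simp add: emb_def fun_eq_iff)
  thus ?thesis using W_expand[OF assms(1)] assms(2) by simp
qed

lemma vract_W:
  assumes "z \<in> W" "functional \<phi>"
  shows "vract \<phi> z \<in> W"
  using assms(1)
proof (rule W_induct)
  show "V.subspace {z. vract \<phi> z \<in> W}" by (rule vract.subspace_linear_preimage) simp
  show "vract \<phi> (emb k y) \<in> W" if ky: "k \<in> K" "y \<in> D" for k y
  proof -
    obtain I :: "('a \<times> 'a) set" and a \<omega> where I: "finite I" "\<And>i. i \<in> I \<Longrightarrow> a i \<in> K"
      "\<And>i. functional (\<omega> i)" "\<And>y. vract \<phi> (emb k y) = (\<Sum>i\<in>I. emb (a i) (ract (\<omega> i) y))"
      "\<And>x. ract \<phi> (k * x) = (\<Sum>i\<in>I. a i * ract (\<omega> i) x)"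
      by (rule vract_emb[OF K_subcoalgebra ky(1) assms(2)]) (rule that)
    show ?thesis unfolding I(4) using I(2) ky(2) by (intro V.subspace_sum emb_W D_ract) auto
  qed
qed

lemma shift_W:
  assumes "z \<in> W"
  shows "shift \<phi> z \<in> W"
  using assms
proof (rule W_induct)
  show "V.subspace {z. shift \<phi> z \<in> W}" by (rule shift.subspace_linear_preimage) simp
qed (auto simp: shift_emb intro!: emb_W D_ract)

lemma vact_W:
  assumes "z \<in> W" "k' \<in> K"
  shows "vact k' z \<in> W"
  using assms(1)
proof (rule W_induct)
  show "V.subspace {z. vact k' z \<in> W}" by (rule vact.subspace_linear_preimage) simp
qed (auto simp: vact_emb intro!: emb_W K_mult assms)

lemma shift_expand:
  assumes "z \<in> W" "functional \<phi>"
  shows "shift \<phi> z = (\<Sum>b\<in>B. vscale (\<phi> b) (shift (\<psi> b) z))"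
  using assms(1)
proof (rule W_induct)
  show "V.subspace {z. shift \<phi> z = (\<Sum>b\<in>B. vscale (\<phi> b) (shift (\<psi> b) z))}"
    by (rule subspace_equalizer[OF vlinear_shift])
      (simp add: Vector_Spaces.linear_iff V.vector_space_axioms shift.add shift.scale
        V.scale_right_distrib sum.distrib V.scale_sum_right mult.commute)
  show "shift \<phi> (emb k y) = (\<Sum>b\<in>B. vscale (\<phi> b) (shift (\<psi> b) (emb k y)))" if "k \<in> K" "y \<in> D" for k y
    using ract_D_eq[OF that(2) assms(2)] by (simp add: shift_emb emb_sum_right emb_scale_right)
qed

lemma shift_counit:
  assumes "z \<in> W"
  shows "shift counit z = z"
  using assms
proof (rule W_induct)
  show "V.subspace {z. shift counit z = z}"
    by (rule subspace_equalizer[OF vlinear_shift V.linear_ident])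
qed (simp add: shift_emb ract_counit)

lemma shift_shift:
  assumes "z \<in> W"
  shows "shift \<phi> (shift \<theta> z) = shift (conv \<phi> \<theta>) z"
  using assms
proof (rule W_induct)
  show "V.subspace {z. shift \<phi> (shift \<theta> z) = shift (conv \<phi> \<theta>) z}"
    by (rule subspace_equalizer[OF _ vlinear_shift])
      (use Vector_Spaces.linear_compose[OF vlinear_shift[of \<theta>] vlinear_shift[of \<phi>]] in \<open>simp add: o_def\<close>)
qed (simp add: shift_emb ract_conv)

text \<open>The coaction of \<open>K\<close> on the first factor of \<open>K \<otimes> D\<close>, recovered from the diagonal coaction by
  cancelling \<open>y\<^sub>2 S(y\<^sub>3)\<close>.\<close>

definition kract :: "('a \<Rightarrow> 'k) \<Rightarrow> (('a \<Rightarrow> 'k) \<Rightarrow> 'a) \<Rightarrow> ('a \<Rightarrow> 'k) \<Rightarrow> 'a"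
  where "kract \<chi> z = (\<Sum>b\<in>B. vract (\<lambda>x. \<chi> (x * antipode b)) (shift (\<psi> b) z))"

lemma vlinear_kract: "Vector_Spaces.linear vscale vscale (kract \<chi>)"
  unfolding Vector_Spaces.linear_iff
  by (simp add: V.vector_space_axioms kract_def shift.add vract.add sum.distrib
      shift.scale vract.scale V.scale_sum_right)

lemma kract_emb:
  assumes "y \<in> D" "functional \<chi>"
  shows "kract \<chi> (emb k y) = emb (ract \<chi> k) y"
proof
  fix \<xi>
  have s: "(\<Sum>i\<in>J. f i) \<chi> = (\<Sum>i\<in>J. f i \<chi>)" for J and f :: "'a \<Rightarrow> ('a \<Rightarrow> 'k) \<Rightarrow> 'a" and \<chi>
    by (induction J rule: infinite_finite_induct) simp_all
  have "kract \<chi> (emb k y) \<xi> = (\<Sum>b\<in>B. ract (\<lambda>x. \<chi> (x * antipode b)) (k * ract (\<psi> b) (ract \<xi> y)))"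
    unfolding kract_def s shift_emb by (simp add: vract_def emb_def ract_commute[of \<xi>])
  also have "\<dots> = emb (ract \<chi> k) y \<xi>"
    using sum_ract_antipode_mult[OF D_ract[OF assms(1)] assms(2)] by (simp add: emb_def)
  finally show "kract \<chi> (emb k y) \<xi> = emb (ract \<chi> k) y \<xi>" .
qed

text \<open>Coordinates respect the coaction on the first factor, so the coordinates of a
  \<open>kract\<close>-stable subspace form a subcoalgebra of \<open>K\<close>, where the expansion
  inequality is available.\<close>

lemma coord_kract:
  assumes "z \<in> W" "functional \<phi>" "functional \<chi>"
  shows "coord \<phi> (kract \<chi> z) = ract \<chi> (coord \<phi> z)"
  using assms(1)
proof (rule W_induct)
  show "V.subspace {z. coord \<phi> (kract \<chi> z) = ract \<chi> (coord \<phi> z)}"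
    using Vector_Spaces.linear_compose[OF vlinear_kract[of \<chi>] vlinear_coord[of \<phi>]]
      Vector_Spaces.linear_compose[OF vlinear_coord[of \<phi>] linear_ract[of \<chi>]]
    by (intro subspace_equalizer[of scale]) (simp_all add: o_def)
qed (simp add: kract_emb coord_emb assms ract.scale)

text \<open>The subcomodules of \<open>K \<otimes> D\<close> for the diagonal coaction. Stability
  under \<open>shift\<close> is a separate condition.\<close>

definition stable :: "(('a \<Rightarrow> 'k) \<Rightarrow> 'a) set \<Rightarrow> bool"
  where "stable Z \<longleftrightarrow> V.subspace Z \<and> Z \<subseteq> W \<and> (\<forall>\<phi>. functional \<phi> \<longrightarrow> (\<forall>z\<in>Z. vract \<phi> z \<in> Z))"

text \<open>\<open>kract\<close> is composed of \<open>shift\<close> and \<open>vract\<close>, so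
  stability under both gives a subcomodule for the first factor.\<close>

lemma kract_stable:
  assumes "stable Z" "\<And>\<phi> z. functional \<phi> \<Longrightarrow> z \<in> Z \<Longrightarrow> shift \<phi> z \<in> Z" "functional \<chi>" "z \<in> Z"
  shows "kract \<chi> z \<in> Z"
  unfolding kract_def
  using assms functional_mult_right[OF assms(3)] functional_\<psi> unfolding stable_def
  by (intro V.subspace_sum) auto

end

subsection \<open>Expansion of Hopf modules\<close>

context cocommutative_hopf_algebra
begin

lemma act_span_mult: "kspace_action.act_span scale (*) = prod_span"
  unfolding kspace_action.act_span_def[OF mult_action.kspace_action_axioms] prod_span_def
  by (intro ext) simp

definition expands :: "'a set \<Rightarrow> real \<Rightarrow> 'a set \<Rightarrow> bool"
  where "expands C c N \<longleftrightarrow> (\<forall>E. fd_subspace E \<and> subcoalgebra E \<and> E \<subseteq> N \<longrightarrow>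
    c * real (dim E) \<le> real (dim (prod_span C E)))"

definition hopf_submodule :: "'a set \<Rightarrow> 'a set \<Rightarrow> bool"
  where "hopf_submodule K N \<longleftrightarrow> subcoalgebra N \<and> (\<forall>k\<in>K. \<forall>x\<in>N. k * x \<in> N)"

end

section \<open>The expansion inequality for \<open>K \<otimes> D\<close>\<close>

locale expanding_simple_subcoalgebra =
  simple_subcoalgebra scale comult counit antipode K D d B \<psi>
  for scale :: "'k::field \<Rightarrow> 'a::ring_1 \<Rightarrow> 'a" and comult counit antipode K D d B \<psi> +
  fixes C :: "'a set" and c :: real
  assumes fd_C: "fd_subspace C" and C_K: "C \<subseteq> K" and K_expands: "expands C c K"
begin

lemma dim_coord_step:
  assumes U: "V.fd_subspace U"
  shows "dim (prod_span C (coord \<phi> ` U)) + V.dim (vmult.act_span C (U \<inter> {z. coord \<phi> z = 0}))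
    \<le> V.dim (vmult.act_span C U)"
proof -
  interpret P: kspace_action_pair scale vscale vact scale "(*)" by unfold_locales
  show ?thesis
    using P.dim_act_span_ge[OF vlinear_coord fd_C U coord_vact] by (simp add: act_span_mult)
qed

text \<open>The coordinates embed \<open>Z\<close> into a direct sum of copies of \<open>K\<close>
  indexed by \<open>B\<close>. Each step splits off one coordinate: its image is a subcoalgebra of
  \<open>K\<close>, its kernel has one coordinate fewer, and the two inequalities add up.\<close>

lemma kract_stable_expands:
  assumes "V.fd_subspace Z" "Z \<subseteq> W" "\<And>\<chi> z. functional \<chi> \<Longrightarrow> z \<in> Z \<Longrightarrow> kract \<chi> z \<in> Z"
  shows "c * real (V.dim Z) \<le> real (V.dim (vmult.act_span C Z))"
proof -
  \<comment> \<open>\<open>A\<close> collects the coordinates that may be nonzero on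
    \<open>Z\<close>.\<close>
  have "c * real (V.dim Z) \<le> real (V.dim (vmult.act_span C Z))"
    if "finite A" "A \<subseteq> B" "V.fd_subspace Z" "Z \<subseteq> W" "\<And>\<chi> z. functional \<chi> \<Longrightarrow> z \<in> Z \<Longrightarrow> kract \<chi> z \<in> Z"
      "\<And>b z. b \<in> B - A \<Longrightarrow> z \<in> Z \<Longrightarrow> coord (\<psi> b) z = 0" for A Z
    using that
  proof (induction A arbitrary: Z rule: finite_induct)
    case empty
    have "Z \<subseteq> {0}" using empty W_zeroI by blast
    hence "V.dim Z \<le> 0" using V.dim_le_card[of Z "{}"] by simp
    thus ?case by simp
  next
    case (insert a A)
    let ?q = "coord (\<psi> a)"
    let ?Z = "Z \<inter> {z. ?q z = 0}"
    have sZ: "V.subspace ?Z"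
      using insert.prems(2) V.fd_subspaceD coord.subspace_kernel V.subspace_inter by blast
    have fZ: "V.fd_subspace ?Z" by (rule V.fd_subspace_subset[OF insert.prems(2) sZ]) blast
    have 1: "c * real (V.dim ?Z) \<le> real (V.dim (vmult.act_span C ?Z))"
    proof (rule insert.IH[OF _ fZ])
      show "kract \<chi> z \<in> ?Z" if "functional \<chi>" "z \<in> ?Z" for \<chi> z
        using that insert.prems(3,4) coord_kract[OF _ functional_\<psi> that(1), of z a] by (auto simp: ract.zero)
      show "coord (\<psi> b) z = 0" if "b \<in> B - A" "z \<in> ?Z" for b z
        using that insert.prems(5) by (cases "b = a") auto
    qed (use insert.prems in auto)
    have fq: "fd_subspace (?q ` Z)" by (rule VH.fd_image[OF vlinear_coord insert.prems(2)])
    have "subcoalgebra (?q ` Z)"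
    proof (rule subcoalgebraI[OF fd_subspaceD[OF fq]])
      fix \<phi> x assume "functional \<phi>" "x \<in> ?q ` Z"
      then obtain z where z: "functional \<phi>" "z \<in> Z" "x = ?q z" by blast
      have "ract \<phi> x = ?q (kract \<phi> z)"
        using coord_kract[OF _ functional_\<psi> z(1), of z a] z insert.prems(3) by auto
      thus "ract \<phi> x \<in> ?q ` Z \<and> lact \<phi> x \<in> ?q ` Z" using insert.prems(4) z lact_eq_ract by auto
    qed
    moreover have "?q ` Z \<subseteq> K" using insert.prems(3) coord_K functional_\<psi> by blast
    ultimately have "c * real (dim (?q ` Z)) \<le> real (dim (prod_span C (?q ` Z)))"
      using K_expands fq unfolding expands_def by blast
    thus ?case
      using 1 dim_coord_step[OF insert.prems(2), of "\<psi> a"]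
        VH.rank_nullity[OF vlinear_coord insert.prems(2), of "\<psi> a"]
      by (simp add: distrib_left)
  qed
  from this[OF finite_B subset_refl assms(1,2)] assms(3) show ?thesis by blast
qed

text \<open>The defect \<open>dim (C Z) - c dim Z\<close> is submodular, so its minimizer of least dimension is
  unique and therefore invariant under the field \<open>D\<^sup>*\<close>.\<close>

lemma stable_expands:
  assumes Z0: "stable Z0" "V.fd_subspace Z0"
  shows "c * real (V.dim Z0) \<le> real (V.dim (vmult.act_span C Z0))"
proof (rule ccontr)
  assume neg: "\<not> ?thesis"
  let ?CZ = "vmult.act_span C"
  define h where "h Z = real (V.dim (?CZ Z)) - c * real (V.dim Z)" for Z
  \<comment> \<open>\<open>M\<close> is the hull of \<open>Z0\<close> under all translations. It is
    finite-dimensional because finitely many \<open>\<psi> b\<close> generate them; competitors are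
    confined to \<open>M\<close> so that their dimensions are bounded.\<close>
  define M where "M = V.span (\<Union>b\<in>B. shift (\<psi> b) ` Z0)"
  have Z0W: "Z0 \<subseteq> W" "V.subspace Z0" using Z0 unfolding stable_def by auto
  have fdM: "V.fd_subspace M"
    unfolding M_def by (intro V.fd_subspace_finite_union finite_B VV.fd_image vlinear_shift Z0)
  have sM: "V.subspace M" unfolding M_def by simp
  have base: "shift \<phi> z \<in> M" if "functional \<phi>" "z \<in> Z0" for \<phi> z
  proof -
    have "shift \<phi> z = (\<Sum>b\<in>B. vscale (\<phi> b) (shift (\<psi> b) z))"
      using shift_expand[OF _ that(1)] that(2) Z0W by blast
    thus ?thesis unfolding M_def using that(2)
      by (auto intro!: V.span_sum V.span_scale intro: V.span_base)
  qed
  have Z0M: "Z0 \<subseteq> M" using base[OF functional_counit] shift_counit Z0W by (metis subsetD subsetI)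
  have shiftM: "shift \<phi> z \<in> M" if "z \<in> M" for \<phi> z
  proof -
    have "M \<subseteq> {z. shift \<phi> z \<in> M}"
      unfolding M_def by (rule V.span_minimal)
        (use base[OF functional_conv] shift_shift Z0W in \<open>auto simp: M_def[symmetric] sM intro!: shift.subspace_linear_preimage\<close>)
    thus ?thesis using that by blast
  qed
  define P where "P Z \<longleftrightarrow> stable Z \<and> Z \<subseteq> M" for Z
  have PZ0: "P Z0" using Z0 Z0M unfolding P_def by blast
  have Pfd: "V.fd_subspace Z" if "P Z" for Z
    using that V.fd_subspace_subset[OF fdM] unfolding P_def stable_def by blast
  have Pfd': "V.fd_subspace (?CZ Z)" if "P Z" for Z
    using fd_C Pfd[OF that] by (rule vmult.fd_act_span)
  \<comment> \<open>There may be infinitely many competitors, but only finitely many pairs of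
    dimensions, hence a minimal defect.\<close>
  let ?S = "(\<lambda>Z. (V.dim (?CZ Z), V.dim Z)) ` {Z. P Z}"
  have "?S \<subseteq> {..V.dim (?CZ M)} \<times> {..V.dim M}"
    using V.fd_dim_mono[OF vmult.fd_act_span[OF fd_C fdM] vmult.act_span_mono[OF subset_refl]]
      V.fd_dim_mono[OF fdM] unfolding P_def by auto
  hence "finite ?S" by (rule finite_subset) simp
  hence "finite ((\<lambda>(a, b). real a - c * real b) ` ?S)" by (rule finite_imageI)
  hence fin: "finite (h ` {Z. P Z})" unfolding h_def image_image by simp
  hence "Min (h ` {Z. P Z}) \<in> h ` {Z. P Z}" using PZ0 by (intro Min_in) auto
  then obtain Z1 where Z1: "P Z1" "h Z1 = Min (h ` {Z. P Z})" by auto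
  have min: "h Z1 \<le> h Z" if "P Z" for Z unfolding Z1(2) using fin that by (intro Min_le) auto
  obtain Z where Z: "P Z" "h Z = h Z1" and least: "\<And>Z'. P Z' \<Longrightarrow> h Z' = h Z1 \<Longrightarrow> V.dim Z \<le> V.dim Z'"
    using ex_has_least_nat[of "\<lambda>Z. P Z \<and> h Z = h Z1" Z1 V.dim] Z1(1) by auto
  have ZW: "Z \<subseteq> W" "V.subspace Z" "Z \<subseteq> M" using Z unfolding P_def stable_def by auto
  have "shift \<phi> z \<in> Z" if f: "functional \<phi>" and z: "z \<in> Z" for \<phi> z
  \<comment> \<open>The field property: as \<open>d\<close> generates \<open>D\<close>, the
    functional acts on \<open>D\<close> either as zero or invertibly, according to its effect on
    \<open>d\<close>.\<close>
  proof (cases "ract \<phi> d = 0")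
    case True
    have r0: "ract \<phi> y = 0" if y: "y \<in> D" for y
    proof -
      obtain \<theta> where "ract \<theta> d = y" using D_orbit[OF y] by blast
      thus ?thesis using True ract_commute[of \<phi> \<theta> d] by (simp add: ract.zero)
    qed
    have e0: "emb k 0 = 0" for k by (simp add: emb_def fun_eq_iff)
    have "shift \<phi> z = 0" if "z \<in> W" for z
      by (rule W_induct[OF that shift.subspace_kernel]) (simp only: shift_emb r0 e0)
    thus ?thesis using ZW z V.subspace_0 by auto
  next
    case False
    obtain \<phi>' where \<phi>': "ract \<phi>' (ract \<phi> d) = d" using D_simple[OF D_ract[OF d] False] by blast
    have r1: "ract \<phi>' (ract \<phi> y) = y" if y: "y \<in> D" for y
    proof -
      obtain \<theta> where t: "ract \<theta> d = y" using D_orbit[OF y] by blast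
      have "ract \<phi>' (ract \<phi> (ract \<theta> d)) = ract \<theta> (ract \<phi>' (ract \<phi> d))" by (metis ract_commute)
      thus ?thesis using t \<phi>' by simp
    qed
    have l: "Vector_Spaces.linear vscale vscale (\<lambda>w. shift \<phi>' (shift \<phi> w))"
      using Vector_Spaces.linear_compose[OF vlinear_shift[of \<phi>] vlinear_shift[of \<phi>']] by (simp add: o_def)
    have inv: "shift \<phi>' (shift \<phi> w) = w" if "w \<in> W" for w
      by (rule W_induct[OF that subspace_equalizer[OF l V.linear_ident]]) (simp only: shift_emb r1)
    let ?Z = "shift \<phi> ` Z"
    have P': "P ?Z"
      unfolding P_def stable_def
    proof (intro conjI allI impI ballI)
      show "V.subspace ?Z" by (rule shift.subspace_image[OF ZW(2)])
      show "?Z \<subseteq> W" using shift_W ZW by blast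
      show "?Z \<subseteq> M" using shiftM ZW by blast
      fix \<theta> y assume t: "functional \<theta>" "y \<in> ?Z"
      then obtain w where w: "w \<in> Z" "y = shift \<phi> w" by blast
      have "vract \<theta> w \<in> Z" using Z(1) t(1) w(1) unfolding P_def stable_def by blast
      thus "vract \<theta> y \<in> ?Z" unfolding w(2) shift_vract[symmetric] by blast
    qed
    have dimZ: "V.dim ?Z = V.dim Z"
    proof (rule VV.dim_image_inj[OF vlinear_shift Pfd[OF Z(1)]])
      show "w = 0" if "w \<in> Z" "shift \<phi> w = 0" for w
        using inv[of w] that ZW(1) by (auto simp: shift.zero)
    qed
    have "?CZ ?Z \<subseteq> shift \<phi> ` ?CZ Z"
    proof (rule vmult.act_span_minimal)
      show "vact f e \<in> shift \<phi> ` ?CZ Z" if fe: "f \<in> C" "e \<in> ?Z" for f e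
      proof -
        obtain w where w: "w \<in> Z" "e = shift \<phi> w" using fe by blast
        show ?thesis unfolding w(2) shift_vact[symmetric] using vmult.act_span_base[OF fe(1) w(1)] by blast
      qed
      show "V.subspace (shift \<phi> ` ?CZ Z)" by (rule shift.subspace_image) simp
    qed
    hence "V.dim (?CZ ?Z) \<le> V.dim (shift \<phi> ` ?CZ Z)"
      by (rule V.fd_dim_mono[OF VV.fd_image[OF vlinear_shift Pfd'[OF Z(1)]]])
    also have "\<dots> \<le> V.dim (?CZ Z)" by (rule VV.dim_image_le[OF vlinear_shift Pfd'[OF Z(1)]])
    finally have hZ': "h ?Z \<le> h Z1" using dimZ Z(2) unfolding h_def by simp
    have sZ': "V.subspace ?Z" "?Z \<subseteq> W" using P' unfolding P_def stable_def by auto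
    have vractZ: "functional \<theta> \<Longrightarrow> w \<in> Z \<Longrightarrow> vract \<theta> w \<in> Z"
      "functional \<theta> \<Longrightarrow> w \<in> ?Z \<Longrightarrow> vract \<theta> w \<in> ?Z" for \<theta> w
      using Z(1) P' unfolding P_def stable_def by blast+
    have Pplus: "P (Z + ?Z)"
      unfolding P_def stable_def
    proof (intro conjI allI impI ballI)
      show "V.subspace (Z + ?Z)" by (rule V.subspace_plus[OF ZW(2) sZ'(1)])
      show "Z + ?Z \<subseteq> W" using ZW sZ' V.subspace_add[OF subspace_W] unfolding set_plus_def by blast
      show "Z + ?Z \<subseteq> M" using ZW P' V.subspace_add[OF sM] unfolding P_def set_plus_def by blast
      fix \<theta> y assume t: "functional \<theta>" "y \<in> Z + ?Z"
      obtain u v where uv: "u \<in> Z" "v \<in> ?Z" "y = u + v" using t(2) by (rule set_plus_elim)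
      show "vract \<theta> y \<in> Z + ?Z"
        unfolding uv(3) vract.add using vractZ(1)[OF t(1) uv(1)] vractZ(2)[OF t(1) uv(2)]
        by (rule set_plus_intro)
    qed
    have Pint: "P (Z \<inter> ?Z)"
      unfolding P_def stable_def using ZW vractZ V.subspace_inter[OF ZW(2) sZ'(1)] by blast
    \<comment> \<open>Submodularity: \<open>C (Z + Z')\<close> lies in \<open>C Z + C Z'\<close> and
      \<open>C (Z \<inter> Z')\<close> in \<open>C Z \<inter> C Z'\<close>, while the dimension of
      the subspace itself is modular.\<close>
    have "V.dim (?CZ (Z + ?Z)) + V.dim (?CZ (Z \<inter> ?Z)) \<le> V.dim (?CZ Z) + V.dim (?CZ ?Z)"
    proof -
      have "V.dim (?CZ (Z + ?Z)) \<le> V.dim (?CZ Z + ?CZ ?Z)"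
        by (intro V.fd_dim_mono V.fd_subspace_sum Pfd' Z P' vmult.act_span_plus ZW sZ')
      moreover have "V.dim (?CZ (Z \<inter> ?Z)) \<le> V.dim (?CZ Z \<inter> ?CZ ?Z)"
      proof (rule V.fd_dim_mono)
        show "V.fd_subspace (?CZ Z \<inter> ?CZ ?Z)"
          by (rule V.fd_subspace_subset[OF Pfd'[OF Z(1)]]) (simp_all add: V.subspace_inter)
        show "?CZ (Z \<inter> ?Z) \<subseteq> ?CZ Z \<inter> ?CZ ?Z"
          using vmult.act_span_mono[of C C "Z \<inter> ?Z" Z] vmult.act_span_mono[of C C "Z \<inter> ?Z" ?Z] by blast
      qed
      ultimately show ?thesis using V.dim_plus_inter[OF Pfd'[OF Z(1)] Pfd'[OF P']] by linarith
    qed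
    hence "real (V.dim (?CZ (Z + ?Z))) + real (V.dim (?CZ (Z \<inter> ?Z))) \<le> real (V.dim (?CZ Z)) + real (V.dim (?CZ ?Z))"
      by linarith
    moreover have "c * real (V.dim (Z + ?Z)) + c * real (V.dim (Z \<inter> ?Z)) = c * real (V.dim Z) + c * real (V.dim ?Z)"
      using V.dim_plus_inter[OF Pfd[OF Z(1)] Pfd[OF P']] by (simp flip: distrib_left of_nat_add)
    ultimately have "h (Z + ?Z) + h (Z \<inter> ?Z) \<le> h Z + h ?Z" unfolding h_def by linarith
    \<comment> \<open>The defect of the sum is not below the minimum, so the intersection attains it
      too. Leastness of the dimension of \<open>Z\<close> then makes the intersection all of
      \<open>Z\<close>, and equality of dimensions identifies \<open>Z\<close> with its
      translate.\<close>
    hence "h (Z \<inter> ?Z) = h Z1" using hZ' Z(2) min[OF Pplus] min[OF Pint] by linarith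
    hence "V.dim Z \<le> V.dim (Z \<inter> ?Z)" by (rule least[OF Pint])
    hence "Z \<inter> ?Z = Z"
      using Pint unfolding P_def stable_def by (intro V.fd_dim_eq[OF Pfd[OF Z(1)]]) auto
    hence "Z = ?Z"
      using dimZ by (intro V.fd_dim_eq[OF Pfd[OF P'] ZW(2)]) auto
    thus ?thesis using z by blast
  qed
  hence "kract \<chi> z \<in> Z" if "functional \<chi>" "z \<in> Z" for \<chi> z
    using kract_stable[of Z \<chi> z] Z(1) that unfolding P_def by blast
  hence "0 \<le> h Z" using kract_stable_expands[OF Pfd[OF Z(1)] ZW(1)] unfolding h_def by simp
  moreover have "h Z0 < 0" using neg unfolding h_def by simp
  ultimately show False using min[OF PZ0] Z(2) by linarith
qed

end

text \<open>Here \<open>d \<mapsto> t\<close> induces a map of \<open>D\<close> into the quotient comodule \<open>H / N\<close>, which extends to a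
  map \<open>lift\<close> of \<open>K \<otimes> D\<close> into the Hopf module \<open>H / N\<close>.\<close>

locale hopf_submodule_extension =
  expanding_simple_subcoalgebra scale comult counit antipode K D d B \<psi> C c
  for scale :: "'k::field \<Rightarrow> 'a::ring_1 \<Rightarrow> 'a" and comult counit antipode K D d B \<psi> C c +
  fixes N :: "'a set" and t :: 'a
  assumes N: "hopf_submodule K N" and t: "t \<notin> N"
    and annihilator: "\<And>\<phi>. functional \<phi> \<Longrightarrow> ract \<phi> d = 0 \<Longrightarrow> ract \<phi> t \<in> N"
begin

lemma N_subcoalgebra: "subcoalgebra N" and N_mult: "k \<in> K \<Longrightarrow> x \<in> N \<Longrightarrow> k * x \<in> N"
  using N unfolding hopf_submodule_def by auto

lemma N_subspace: "subspace N"
  by (rule subcoalgebra_subspace[OF N_subcoalgebra])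

lemma N_ract: "x \<in> N \<Longrightarrow> ract \<phi> x \<in> N"
  by (rule subcoalgebra_ract[OF N_subcoalgebra])

definition gen :: "'a \<Rightarrow> 'a \<Rightarrow> 'k"
  where "gen b = (SOME \<phi>. functional \<phi> \<and> ract \<phi> d = b)"

lemma gen: "b \<in> D \<Longrightarrow> functional (gen b)" "b \<in> D \<Longrightarrow> ract (gen b) d = b"
  using someI_ex[OF D_orbit] unfolding gen_def by auto

text \<open>A linear representative in \<open>H\<close> of the comodule map from \<open>D\<close> to
  \<open>H / N\<close> that sends \<open>ract \<phi> d\<close> to the class of
  \<open>ract \<phi> t\<close>. By \<open>annihilator\<close> the choices made in \<open>gen\<close>
  matter only modulo \<open>N\<close>.\<close>

definition lift0 :: "'a \<Rightarrow> 'a"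
  where "lift0 y = (\<Sum>b\<in>B. scale (\<psi> b y) (ract (gen b) t))"

lemma lift0_ract:
  assumes f: "functional \<phi>"
  shows "lift0 (ract \<phi> d) - ract \<phi> t \<in> N"
proof -
  let ?y = "ract \<phi> d"
  have y: "?y \<in> D" using D_ract[OF d] .
  \<comment> \<open>The combination of the \<open>gen b\<close> that produces
    \<open>ract \<phi> d\<close>, minus \<open>\<phi>\<close>. It annihilates \<open>d\<close>, so
    \<open>annihilator\<close> puts its effect on \<open>t\<close> into \<open>N\<close>.\<close>
  let ?w = "\<lambda>x. (\<Sum>b\<in>B. \<psi> b ?y * gen b x) + - 1 * \<phi> x"
  have g: "functional (\<lambda>x. \<psi> b ?y * gen b x)" if "b \<in> B" for b
    using gen B_D that by (intro functional_const_mult) blast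
  have gg: "functional (gen b)" if "b \<in> B" for b using gen B_D that by blast
  have w: "functional ?w"
    by (intro functional_plus functional_Sum functional_const_mult f) (rule gg)
  have e: "ract ?w x = (\<Sum>b\<in>B. scale (\<psi> b ?y) (ract (gen b) x)) - ract \<phi> x" for x
  proof -
    have "ract ?w x = ract (\<lambda>x. \<Sum>b\<in>B. \<psi> b ?y * gen b x) x + ract (\<lambda>x. - 1 * \<phi> x) x"
      by (intro ract_functional_add functional_Sum g functional_const_mult f)
    also have "\<dots> = (\<Sum>b\<in>B. scale (\<psi> b ?y) (ract (gen b) x)) + scale (- 1) (ract \<phi> x)"
      by (simp add: ract_functional_sum g ract_functional_scale gg ract_functional_scale[OF f, of "- 1", simplified])
    finally show ?thesis by simp
  qed
  have "(\<Sum>b\<in>B. scale (\<psi> b ?y) (ract (gen b) d)) = (\<Sum>b\<in>B. scale (\<psi> b ?y) b)"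
    using gen(2) B_D by (intro sum.cong) auto
  hence "ract ?w d = 0" unfolding e using \<psi>_expand[OF y] by simp
  from annihilator[OF w this] show ?thesis unfolding e lift0_def .
qed

lemma lift0_comodule:
  assumes "y \<in> D" "functional \<phi>"
  shows "lift0 (ract \<phi> y) - ract \<phi> (lift0 y) \<in> N"
proof -
  obtain \<theta> where t: "functional \<theta>" "ract \<theta> d = y" using D_orbit[OF assms(1)] by blast
  have 1: "lift0 (ract (conv \<phi> \<theta>) d) - ract (conv \<phi> \<theta>) t \<in> N"
    by (rule lift0_ract[OF functional_conv])
  have 2: "ract \<phi> (lift0 (ract \<theta> d) - ract \<theta> t) \<in> N" by (rule N_ract[OF lift0_ract[OF t(1)]])
  show ?thesis
    using subspace_diff[OF N_subspace 1 2] t by (simp add: ract_conv ract.diff)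
qed

definition lift :: "(('a \<Rightarrow> 'k) \<Rightarrow> 'a) \<Rightarrow> 'a"
  where "lift z = (\<Sum>b\<in>B. coord (\<psi> b) z * ract (gen b) t)"

lemma vlinear_lift: "Vector_Spaces.linear vscale scale lift"
  unfolding Vector_Spaces.linear_iff
  by (simp add: V.vector_space_axioms vector_space_axioms lift_def coord.add coord.scale
      distrib_right sum.distrib scale_mult_left scale_sum_right)

sublocale lift: Vector_Spaces.linear vscale scale lift
  by (rule vlinear_lift)

lemma lift_emb: "y \<in> D \<Longrightarrow> lift (emb k y) = k * lift0 y"
  by (simp add: lift_def lift0_def coord_emb functional_\<psi> sum_distrib_left scale_mult_left scale_mult_right)

lemma lift_vact: "lift (vact k z) = k * lift z"
  by (simp add: lift_def coord_vact sum_distrib_left mult.assoc)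

text \<open>\<open>lift\<close> respects the coactions modulo \<open>N\<close>: on
  \<open>emb k y\<close> the error is a sum of elements of \<open>K\<close> times errors of
  \<open>lift0\<close>, and \<open>N\<close> absorbs multiplication by \<open>K\<close>.\<close>

lemma lift_vract:
  assumes "z \<in> W" "functional \<phi>"
  shows "lift (vract \<phi> z) - ract \<phi> (lift z) \<in> N"
  using assms(1)
proof (rule W_induct)
  show "V.subspace {z. lift (vract \<phi> z) - ract \<phi> (lift z) \<in> N}"
  proof -
    have 1: "Vector_Spaces.linear vscale scale (\<lambda>z. lift (vract \<phi> z))"
      using Vector_Spaces.linear_compose[OF vlinear_vract vlinear_lift, of \<phi>] by (simp add: o_def)
    have 2: "Vector_Spaces.linear vscale scale (\<lambda>z. ract \<phi> (lift z))"
      using Vector_Spaces.linear_compose[OF vlinear_lift linear_ract, of \<phi>] by (simp add: o_def)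
    interpret l: Vector_Spaces.linear vscale scale "\<lambda>z. lift (vract \<phi> z) - ract \<phi> (lift z)"
      by (rule VH.linear_compose_sub[OF 1 2])
    show ?thesis by (rule l.subspace_linear_preimage[OF N_subspace])
  qed
  show "lift (vract \<phi> (emb k y)) - ract \<phi> (lift (emb k y)) \<in> N" if ky: "k \<in> K" "y \<in> D" for k y
  proof -
    obtain I :: "('a \<times> 'a) set" and a \<omega> where I: "finite I" "\<And>i. i \<in> I \<Longrightarrow> a i \<in> K"
      "\<And>i. functional (\<omega> i)" "\<And>y. vract \<phi> (emb k y) = (\<Sum>i\<in>I. emb (a i) (ract (\<omega> i) y))"
      "\<And>x. ract \<phi> (k * x) = (\<Sum>i\<in>I. a i * ract (\<omega> i) x)"
      by (rule vract_emb[OF K_subcoalgebra ky(1) assms(2)]) (rule that)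
    have "lift (vract \<phi> (emb k y)) - ract \<phi> (lift (emb k y)) =
      (\<Sum>i\<in>I. a i * (lift0 (ract (\<omega> i) y) - ract (\<omega> i) (lift0 y)))"
      unfolding I(4) lift_emb[OF ky(2)] I(5) lift.sum
      by (simp add: lift_emb D_ract[OF ky(2)] right_diff_distrib sum_subtractf)
    also have "\<dots> \<in> N"
      using I lift0_comodule[OF ky(2)] by (intro subspace_sum[OF N_subspace] N_mult) auto
    finally show ?thesis .
  qed
qed

lemma lift_emb_one: "lift (emb 1 d) \<notin> N"
proof
  assume "lift (emb 1 d) \<in> N"
  hence "lift0 d \<in> N" by (simp add: lift_emb[OF d])
  moreover have "lift0 d - t \<in> N" using lift0_ract[OF functional_counit] by (simp add: ract_counit)
  ultimately have "lift0 d - (lift0 d - t) \<in> N" by (rule subspace_diff[OF N_subspace])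
  thus False using t by simp
qed

text \<open>With \<open>R\<close> the kernel of \<open>lift\<close> modulo \<open>N\<close> in
  \<open>W\<close>, this is the intersection over \<open>P\<close> of the preimages of
  \<open>R\<close> under the translations \<open>shift \<phi>\<close>. It is \<open>W\<close> for
  empty \<open>P\<close>.\<close>

definition killed :: "('a \<Rightarrow> 'k) set \<Rightarrow> (('a \<Rightarrow> 'k) \<Rightarrow> 'a) set"
  where "killed P = {z \<in> W. \<forall>\<phi>\<in>P. lift (shift \<phi> z) \<in> N}"

lemma killedI: "z \<in> W \<Longrightarrow> (\<And>\<phi>. \<phi> \<in> P \<Longrightarrow> lift (shift \<phi> z) \<in> N) \<Longrightarrow> z \<in> killed P"
  unfolding killed_def by blast

lemma killed_W: "killed P \<subseteq> W"
  unfolding killed_def by blast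

lemma killedD: "z \<in> killed P \<Longrightarrow> \<phi> \<in> P \<Longrightarrow> lift (shift \<phi> z) \<in> N"
  unfolding killed_def by blast

lemma killed_subspace: "V.subspace (killed P)"
  by (rule V.subspaceI)
    (auto simp: killed_def shift.zero lift.zero shift.add lift.add shift.scale lift.scale
      subspace_0[OF N_subspace] subspace_add[OF N_subspace] subspace_scale[OF N_subspace]
      V.subspace_0[OF subspace_W] V.subspace_add[OF subspace_W] V.subspace_scale[OF subspace_W])

lemma killed_vact: "z \<in> killed P \<Longrightarrow> k \<in> K \<Longrightarrow> vact k z \<in> killed P"
  by (auto simp: killed_def vact_W shift_vact lift_vact N_mult)

lemma killed_vract:
  assumes "z \<in> killed P" "functional \<theta>"
  shows "vract \<theta> z \<in> killed P"
proof (rule killedI)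
  have z: "z \<in> W" using assms killed_W by blast
  show "vract \<theta> z \<in> W" by (rule vract_W[OF z assms(2)])
  fix \<phi> assume "\<phi> \<in> P"
  hence "ract \<theta> (lift (shift \<phi> z)) \<in> N" using killedD[OF assms(1)] N_ract by blast
  from subspace_add[OF N_subspace lift_vract[OF shift_W[OF z, of \<phi>] assms(2)] this]
  show "lift (shift \<phi> (vract \<theta> z)) \<in> N" unfolding shift_vract by simp
qed

lemma killed_stable: "stable (killed P)"
  unfolding stable_def using killed_subspace killed_W killed_vract by blast

text \<open>As in the structure theorem for Hopf modules, a nonzero submodule of \<open>K \<otimes> D\<close> that is
  stable under \<open>D\<^sup>*\<close> contains some \<open>1 \<otimes> y \<noteq> 0\<close>, hence also \<open>1 \<otimes> d\<close>.\<close>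

lemma killed_all: "killed {\<phi>. functional \<phi>} = {0}"
proof -
  let ?Y = "killed {\<phi>. functional \<phi>}"
  have shiftY: "shift \<theta> z \<in> ?Y" if "z \<in> ?Y" for \<theta> z
  proof (rule killedI)
    have z: "z \<in> W" using that killed_W by blast
    show "shift \<theta> z \<in> W" by (rule shift_W[OF z])
    show "lift (shift \<phi> (shift \<theta> z)) \<in> N" for \<phi>
      unfolding shift_shift[OF z] using killedD[OF that] functional_conv by blast
  qed
  have kractY: "kract \<chi> z \<in> ?Y" if "functional \<chi>" "z \<in> ?Y" for \<chi> z
    by (rule kract_stable[OF killed_stable]) (use shiftY that in auto)
  have "z = 0" if z: "z \<in> ?Y" for z
  proof (rule ccontr)
    assume nz: "z \<noteq> 0"
    have zW: "z \<in> W" using z killed_W by blast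
    obtain b0 where b0: "b0 \<in> B" "coord (\<psi> b0) z \<noteq> 0" using W_zeroI[OF zW] nz by blast
    \<comment> \<open>\<open>\<chi>\<close> is chosen so that, after acting by it, the coordinate at
      \<open>b0\<close> has nonzero counit; the averaging below retains only the counits of the
      coordinates.\<close>
    obtain \<chi> where \<chi>: "functional \<chi>" "\<chi> (coord (\<psi> b0) z) \<noteq> 0"
      using functional_zero_imp_zero[of "coord (\<psi> b0) z"] b0(2) by blast
    define k where "k b = coord (\<psi> b) (kract \<chi> z)" for b
    have z1: "kract \<chi> z \<in> ?Y" by (rule kractY[OF \<chi>(1) z])
    hence z1W: "kract \<chi> z \<in> W" using killed_W by blast
    have kK: "k b \<in> K" for b unfolding k_def by (rule coord_K[OF z1W functional_\<psi>])
    have ck: "counit (k b) = \<chi> (coord (\<psi> b) z)" for b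
      unfolding k_def coord_kract[OF zW functional_\<psi> \<chi>(1)] by (rule counit_ract[OF \<chi>(1)])
    have "span (k ` B) \<subseteq> K" using kK by (intro span_minimal K_subspace) blast
    then obtain E where E: "fd_subspace E" "subcoalgebra E" "span (k ` B) \<subseteq> E" "E \<subseteq> K"
      using fd_subcoalgebra_containing[OF fd_subspace_span[OF finite_imageI[OF finite_B]] _ K_subcoalgebra]
      by blast
    obtain X \<eta> where X: "finite X" "independent X" "span X = E" "\<And>h. functional (\<eta> h)"
      "\<And>b c. b \<in> X \<Longrightarrow> c \<in> X \<Longrightarrow> \<eta> b c = (if b = c then 1 else 0)"
      "\<And>v. v \<in> E \<Longrightarrow> (\<Sum>h\<in>X. scale (\<eta> h v) h) = v"
      by (rule dual_basis[OF E(1)]) (rule that)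
    \<comment> \<open>The projection \<open>m \<mapsto> S(m\<^sub>1) m\<^sub>2\<close> onto
      coinvariants, applied to the translated \<open>z\<close> with \<open>m\<^sub>1\<close>
      expanded over a basis of \<open>E\<close>. Its coordinates are
      \<open>S(k\<^sub>1) k\<^sub>2 = \<epsilon>(k) 1\<close> for the coordinates \<open>k\<close>
      of that element, so it has the form \<open>1 \<otimes> y\<close>.\<close>
    define z2 where "z2 = (\<Sum>h\<in>X. vact (antipode h) (kract (\<eta> h) (kract \<chi> z)))"
    have z2: "z2 \<in> ?Y"
      unfolding z2_def
    proof (intro V.subspace_sum[OF killed_subspace] killed_vact kractY X(4))
      show "antipode h \<in> K" if "h \<in> X" for h
        using that X(3) E(4) span_base[of h X] K_antipode by blast
    qed (rule \<chi>(1), rule z)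
    have z2W: "z2 \<in> W" using z2 killed_W by blast
    have c2: "coord (\<psi> b) z2 = scale (counit (k b)) 1" if b: "b \<in> B" for b
    proof -
      have kE: "k b \<in> E" using b E(3) span_base[of "k b" "k ` B"] by blast
      have "coord (\<psi> b) z2 = (\<Sum>h\<in>X. antipode h * ract (\<eta> h) (k b))"
        unfolding z2_def coord.sum coord_vact coord_kract[OF z1W functional_\<psi> X(4)] k_def ..
      thus ?thesis using sum_antipode_mult_ract[OF E(2) X(6) X(4) kE] by simp
    qed
    define y where "y = (\<Sum>b\<in>B. scale (counit (k b)) b)"
    have yD: "y \<in> D" unfolding y_def using B_D by (intro subspace_sum subspace_scale D_subspace) auto
    have "z2 = (\<Sum>b\<in>B. emb (scale (counit (k b)) 1) b)"
      using W_expand[OF z2W] c2 by (metis (no_types, lifting) sum.cong)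
    also have "\<dots> = emb 1 y" unfolding y_def by (simp add: emb_sum_right emb_scale_left emb_scale_right)
    finally have z2y: "z2 = emb 1 y" .
    have "\<psi> b0 y = (\<Sum>b\<in>B. counit (k b) * (if b0 = b then 1 else 0))"
      unfolding y_def using b0(1) \<psi>_dual
      by (simp add: functional_sum[OF functional_\<psi>] functional_scale[OF functional_\<psi>])
    also have "\<dots> = counit (k b0)"
      using finite_B b0(1) by (simp add: if_distrib[of "\<lambda>x. _ * x"] cong: if_cong)
    finally have "\<psi> b0 y \<noteq> 0" using ck \<chi>(2) by simp
    hence "y \<noteq> 0" using functional_zero[OF functional_\<psi>] by metis
    \<comment> \<open>Translating \<open>1 \<otimes> y\<close> by this \<open>\<phi>\<close> gives
      \<open>1 \<otimes> d\<close>, which \<open>lift\<close> would have to send into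
      \<open>N\<close>.\<close>
    then obtain \<phi> where "functional \<phi>" "ract \<phi> y = d" using D_simple[OF yD] by blast
    hence "lift (emb 1 d) \<in> N" using killedD[OF z2, of \<phi>] z2y by (simp add: shift_emb)
    thus False using lift_emb_one by blast
  qed
  moreover have "0 \<in> ?Y" by (rule V.subspace_0[OF killed_subspace])
  ultimately show ?thesis by blast
qed

lemma killed_dual_basis: "killed (\<psi> ` B) = {0}"
proof -
  have "killed (\<psi> ` B) \<subseteq> killed {\<phi>. functional \<phi>}"
  proof
    fix z assume z: "z \<in> killed (\<psi> ` B)"
    have zW: "z \<in> W" using z killed_W by blast
    show "z \<in> killed {\<phi>. functional \<phi>}"
    proof (rule killedI[OF zW])
      fix \<phi> assume "\<phi> \<in> {\<phi>. functional \<phi>}"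
      hence "lift (shift \<phi> z) = (\<Sum>b\<in>B. scale (\<phi> b) (lift (shift (\<psi> b) z)))"
        using shift_expand[OF zW] by (simp add: lift.sum lift.scale)
      also have "\<dots> \<in> N" using killedD[OF z] by (intro subspace_sum subspace_scale N_subspace) auto
      finally show "lift (shift \<phi> z) \<in> N" .
    qed
  qed
  thus ?thesis using killed_all V.subspace_0[OF killed_subspace] by blast
qed

text \<open>If no pair existed, inserting functionals one at a time would never reduce
  \<open>killed P\<close> to zero. Starting from \<open>W\<close>, which contains
  \<open>emb 1 d\<close>, this contradicts \<open>killed_dual_basis\<close>, whose family is
  finite.\<close>

lemma exists_embedded_submodule:
  "\<exists>P \<phi>. killed P \<noteq> {0} \<and> (\<forall>z\<in>killed P. lift (shift \<phi> z) \<in> N \<longrightarrow> z = 0)"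
proof (rule ccontr)
  assume no: "\<nexists>P \<phi>. killed P \<noteq> {0} \<and> (\<forall>z\<in>killed P. lift (shift \<phi> z) \<in> N \<longrightarrow> z = 0)"
  have step: "killed (insert \<phi> P) \<noteq> {0}" if P: "killed P \<noteq> {0}" for \<phi> P
  proof
    assume k: "killed (insert \<phi> P) = {0}"
    have "\<forall>z\<in>killed P. lift (shift \<phi> z) \<in> N \<longrightarrow> z = 0"
      using k unfolding killed_def by blast
    thus False using no P by blast
  qed
  have "emb 1 d \<in> killed {}" unfolding killed_def using emb_W[OF K_one d] by blast
  moreover have "emb 1 d \<noteq> 0" using lift_emb_one lift.zero subspace_0[OF N_subspace] by metis
  ultimately have base: "killed {} \<noteq> {0}" by blast
  have "killed P \<noteq> {0}" if "finite P" for P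
    using that
  proof (induction P rule: finite_induct)
    case (insert x P)
    show ?case by (rule step[OF insert.IH])
  qed (rule base)
  thus False using killed_dual_basis finite_B by blast
qed

end

section \<open>Enlarging an expanding Hopf submodule\<close>

context hopf_submodule_extension
begin

lemma strict_extension:
  assumes exp: "expands C c N"
  shows "\<exists>N'. hopf_submodule K N' \<and> N \<subset> N' \<and> expands C c N'"
proof -
  obtain P \<phi> where ne: "killed P \<noteq> {0}" and inj: "\<forall>z\<in>killed P. lift (shift \<phi> z) \<in> N \<longrightarrow> z = 0"
    using exists_embedded_submodule by blast
  define g where "g z = lift (shift \<phi> z)" for z
  have lg: "Vector_Spaces.linear vscale scale g"
    using Vector_Spaces.linear_compose[OF vlinear_shift vlinear_lift, of \<phi>] by (simp add: o_def g_def[abs_def])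
  interpret g: Vector_Spaces.linear vscale scale g by (rule lg)
  have g_vact: "g (vact k z) = k * g z" for k z by (simp add: g_def shift_vact lift_vact)
  have g_vract: "g (vract \<theta> z) - ract \<theta> (g z) \<in> N" if "functional \<theta>" "z \<in> killed P" for \<theta> z
    using lift_vract[OF shift_W that(1), of z \<phi>] that(2) killed_W unfolding g_def shift_vract by blast
  \<comment> \<open>\<open>p\<close> plays the quotient map by \<open>N\<close>; composed with it,
    \<open>g\<close> becomes injective on \<open>killed P\<close>.\<close>
  obtain p where p: "Vector_Spaces.linear scale scale p" "\<And>x. p x = 0 \<longleftrightarrow> x \<in> N"
    using linear_with_kernel[OF N_subspace] by blast
  interpret p: Vector_Spaces.linear scale scale p by (rule p(1))
  have lpg: "Vector_Spaces.linear vscale scale (p \<circ> g)" by (rule Vector_Spaces.linear_compose[OF lg p(1)])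
  interpret pg: Vector_Spaces.linear vscale scale "p \<circ> g" by (rule lpg)
  have inj_pg: "inj_on (p \<circ> g) (killed P)"
    unfolding pg.inj_on_iff_eq_0[OF killed_subspace] using inj p(2) by (simp add: g_def)
  obtain q0 where q0: "Vector_Spaces.linear scale vscale q0" "\<forall>z\<in>killed P. q0 ((p \<circ> g) z) = z"
    using VH.linear_exists_left_inverse_on[OF lpg killed_subspace inj_pg] by blast
  \<comment> \<open>On \<open>N'\<close> below, \<open>q\<close> is the projection modulo
    \<open>N\<close> followed by the inverse of the embedding of \<open>killed P\<close>. It is
    linear on all of \<open>H\<close>, but its compatibility with multiplication by \<open>K\<close>
    and with the coaction is established on \<open>N'\<close>.\<close>
  define q where "q = q0 \<circ> p"
  have lq: "Vector_Spaces.linear scale vscale q"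
    unfolding q_def by (rule Vector_Spaces.linear_compose[OF p(1) q0(1)])
  interpret q: Vector_Spaces.linear scale vscale q by (rule lq)
  interpret q0: Vector_Spaces.linear scale vscale q0 by (rule q0(1))
  have qN: "q n = 0" if "n \<in> N" for n using p(2)[THEN iffD2, OF that] by (simp add: q_def q0.zero)
  have qg: "q (n + g z) = z" if "n \<in> N" "z \<in> killed P" for n z
    using qN[OF that(1)] q0(2) that(2) by (simp add: q.add) (simp add: q_def)
  define N' where "N' = N + g ` killed P"
  have N'I: "n + g z \<in> N'" if "n \<in> N" "z \<in> killed P" for n z
    unfolding N'_def using that by (intro set_plus_intro) auto
  have N'E: "\<exists>n z. n \<in> N \<and> z \<in> killed P \<and> x = n + g z" if "x \<in> N'" for x
    using that unfolding N'_def set_plus_def by blast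
  have k0: "0 \<in> killed P" by (rule V.subspace_0[OF killed_subspace])
  have NN': "N \<subseteq> N'" using N'I[OF _ k0] by (auto simp: g.zero)
  have sN': "subspace N'"
    unfolding N'_def by (intro subspace_plus N_subspace g.subspace_image killed_subspace)
  have act: "k * x \<in> N' \<and> q (k * x) = vact k (q x)" if k: "k \<in> K" and x: "x \<in> N'" for k x
  proof -
    obtain n z where nz: "n \<in> N" "z \<in> killed P" "x = n + g z" using N'E[OF x] by blast
    have e: "k * x = k * n + g (vact k z)" unfolding nz(3) g_vact by (rule distrib_left)
    show ?thesis
      unfolding e using nz qg N'I killed_vact[OF nz(2) k] N_mult[OF k nz(1)] by simp
  qed
  have coact: "ract \<theta> x \<in> N' \<and> q (ract \<theta> x) = vract \<theta> (q x)" if t: "functional \<theta>" and x: "x \<in> N'" for \<theta> x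
  proof -
    obtain n z where nz: "n \<in> N" "z \<in> killed P" "x = n + g z" using N'E[OF x] by blast
    \<comment> \<open>\<open>g\<close> respects the coaction only up to elements of
      \<open>N\<close>; this error is moved into the component in \<open>N\<close>, where
      \<open>q\<close> does not see it.\<close>
    have e: "ract \<theta> x = (ract \<theta> n - (g (vract \<theta> z) - ract \<theta> (g z))) + g (vract \<theta> z)"
      unfolding nz(3) ract.add by simp
    have n: "ract \<theta> n - (g (vract \<theta> z) - ract \<theta> (g z)) \<in> N"
      by (rule subspace_diff[OF N_subspace N_ract[OF nz(1)] g_vract[OF t nz(2)]])
    have qx: "q x = z" using qg[OF nz(1,2)] nz(3) by simp
    have z': "vract \<theta> z \<in> killed P" by (rule killed_vract[OF nz(2) t])
    show ?thesis using N'I[OF n z'] qg[OF n z'] unfolding e[symmetric] qx by blast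
  qed
  have "subcoalgebra N'"
    using coact by (intro subcoalgebraI sN') (simp add: lact_eq_ract)
  hence hN': "hopf_submodule K N'" unfolding hopf_submodule_def using act by blast
  have strict: "N \<noteq> N'"
  proof
    assume e: "N = N'"
    obtain z where z: "z \<in> killed P" "z \<noteq> 0" using ne k0 by blast
    have "g z \<in> N" using N'I[OF subspace_0[OF N_subspace] z(1)] e by simp
    thus False using inj z unfolding g_def by blast
  qed
  have qker: "q x = 0 \<longleftrightarrow> x \<in> N" if "x \<in> N'" for x
    using N'E[OF that] qg qN by (metis add.right_neutral g.zero)
  have qW: "q x \<in> killed P" if "x \<in> N'" for x using N'E[OF that] qg by metis
  have "expands C c N'"
    unfolding expands_def
  proof (intro allI impI, elim conjE)
    fix E assume E: "fd_subspace E" "subcoalgebra E" "E \<subseteq> N'"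
    have "stable (q ` E)"
      unfolding stable_def
    proof (intro conjI allI impI ballI)
      show "V.subspace (q ` E)" by (rule q.subspace_image[OF fd_subspaceD[OF E(1)]])
      show "q ` E \<subseteq> W" using qW E(3) killed_W by blast
      fix \<theta> y assume t: "functional \<theta>" and "y \<in> q ` E"
      then obtain x where x: "x \<in> E" "y = q x" by blast
      have "vract \<theta> y = q (ract \<theta> x)" using coact[OF t] x E(3) by auto
      thus "vract \<theta> y \<in> q ` E" using subcoalgebra_ract[OF E(2) x(1)] by blast
    qed
    hence 1: "c * real (V.dim (q ` E)) \<le> real (V.dim (vmult.act_span C (q ` E)))"
      using stable_expands vmult.fd_image[OF lq E(1)] by blast
    have EN: "E \<inter> {x. q x = 0} = E \<inter> N" using qker E(3) by blast
    have "subcoalgebra (E \<inter> N)"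
      using E(2) N_subcoalgebra subspace_inter unfolding subcoalgebra_iff by blast
    moreover from this have "fd_subspace (E \<inter> N)"
      by (intro fd_subspace_subset[OF E(1)] subcoalgebra_subspace) auto
    ultimately have 2: "c * real (dim (E \<inter> N)) \<le> real (dim (prod_span C (E \<inter> N)))"
      using exp unfolding expands_def by blast
    \<comment> \<open>The inequality for \<open>E\<close> is the sum of those for \<open>q\<close>
      applied to \<open>E\<close>, a subcomodule of \<open>K \<otimes> D\<close>, and for the
      intersection of \<open>E\<close> with \<open>N\<close>.\<close>
    interpret P: kspace_action_pair scale scale "(*)" vscale vact by unfold_locales
    have "V.dim (vmult.act_span C (q ` E)) + dim (prod_span C (E \<inter> {x. q x = 0})) \<le> dim (prod_span C E)"
      using P.dim_act_span_ge[OF lq fd_C E(1)] act E(3) C_K by (auto simp: act_span_mult)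
    thus "c * real (dim E) \<le> real (dim (prod_span C E))"
      using 1 2 vmult.rank_nullity[OF lq E(1)] by (simp add: EN distrib_left)
  qed
  thus ?thesis using hN' NN' strict by blast
qed

end

section \<open>Simple subquotients, maximal expanding submodules and part (1)\<close>

context cocommutative_hopf_algebra
begin

text \<open>A comodule generator \<open>t\<close> of a simple subquotient \<open>(T + N) / N\<close> yields the simple
  subcoalgebra \<open>D\<close> of its matrix coefficients, generated by \<open>d = \<Sum> t\<^sub>1 \<lambda>(t\<^sub>2)\<close> for any functional
  \<open>\<lambda>\<close> that vanishes on \<open>N\<close> but not at \<open>t\<close>.\<close>

lemma exists_simple_subcoalgebra:
  assumes K: "hopf_subalgebra K" and N: "hopf_submodule K N" and ne: "N \<noteq> UNIV"
  shows "\<exists>D d B \<psi> t. simple_subcoalgebra scale comult counit antipode K D d B \<psi> \<and> t \<notin> N \<and>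
    (\<forall>\<phi>. functional \<phi> \<longrightarrow> ract \<phi> d = 0 \<longrightarrow> ract \<phi> t \<in> N)"
proof -
  have Nc: "subcoalgebra N" using N unfolding hopf_submodule_def by blast
  obtain t0 where t0: "t0 \<notin> N" using ne by blast
  obtain C0 where C0: "fd_subspace C0" "subcoalgebra C0" "t0 \<in> C0" using fd_subcoalgebra_generated by blast
  obtain T where T: "subcoalgebra T" "T \<subseteq> C0" "\<not> T \<subseteq> N"
    and least: "\<And>T'. subcoalgebra T' \<Longrightarrow> T' \<subseteq> C0 \<Longrightarrow> \<not> T' \<subseteq> N \<Longrightarrow> dim T \<le> dim T'"
    using ex_has_least_nat[of "\<lambda>T. subcoalgebra T \<and> T \<subseteq> C0 \<and> \<not> T \<subseteq> N" C0 dim] C0 t0 by blast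
  have fdT: "fd_subspace T" by (rule fd_subspace_subset[OF C0(1) subcoalgebra_subspace[OF T(1)] T(2)])
  obtain t where t: "t \<in> T" "t \<notin> N" using T(3) by blast
  have return: "\<exists>\<theta>. functional \<theta> \<and> ract \<theta> (ract \<phi> t) = t" if "ract \<phi> t \<notin> N" for \<phi>
  proof -
    let ?O = "orbit (ract \<phi> t)"
    have OT: "?O \<subseteq> T" by (intro orbit_subset T subcoalgebra_ract t)
    have "dim T \<le> dim ?O"
      using OT T(2) that orbit_self by (intro least subcoalgebra_orbit) blast+
    hence "?O = T" by (rule fd_dim_eq[OF fdT subcoalgebra_subspace[OF subcoalgebra_orbit] OT])
    hence "t \<in> ?O" using t by simp
    thus ?thesis unfolding orbit_def by auto
  qed
  obtain l where l: "functional l" "\<And>x. x \<in> N \<Longrightarrow> l x = 0" "l t = 1"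
    by (rule functional_separates[OF subcoalgebra_subspace[OF Nc] t(2)]) (rule that)
  define d where "d = ract l t"
  \<comment> \<open>By cocommutativity a functional \<open>\<phi>\<close> and \<open>l\<close> can
    exchange their roles, and \<open>l\<close> vanishes on the subcoalgebra
    \<open>N\<close>.\<close>
  have lN: "ract l n = 0" if n: "n \<in> N" for n
  proof (rule functional_zero_imp_zero)
    fix \<phi> assume f: "functional \<phi>"
    have "\<phi> (ract l n) = l (ract \<phi> n)"
      using functional_apply_ract[OF f l(1)] functional_apply_lact[OF l(1) f] by (simp add: lact_eq_ract)
    thus "\<phi> (ract l n) = 0" using l(2) subcoalgebra_ract[OF Nc n] by simp
  qed
  have d0: "d \<noteq> 0"
  proof
    assume "d = 0"
    hence "counit (ract l t) = 0" using functional_zero[OF functional_counit] unfolding d_def by simp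
    thus False using counit_ract[OF l(1)] l(3) by simp
  qed
  \<comment> \<open>A translation that keeps \<open>t\<close> outside \<open>N\<close> can be undone
    on \<open>t\<close>. As \<open>d\<close> is itself a translate of \<open>t\<close> and
    translations commute, it is also undone on \<open>d\<close>, so it cannot annihilate the nonzero
    \<open>d\<close>.\<close>
  have ann: "ract \<phi> t \<in> N" if "ract \<phi> d = 0" for \<phi>
  proof (rule ccontr)
    assume "ract \<phi> t \<notin> N"
    then obtain \<theta> where "ract \<theta> (ract \<phi> t) = t" using return by blast
    hence "ract \<theta> (ract \<phi> d) = d" unfolding d_def by (metis ract_commute)
    thus False using that d0 ract.zero by simp
  qed
  have fdD: "fd_subspace (orbit d)"
    using orbit_subset[OF T(1), of d] subcoalgebra_ract[OF T(1) t(1)] unfolding d_def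
    by (intro fd_subspace_subset[OF fdT subcoalgebra_subspace[OF subcoalgebra_orbit]]) blast
  obtain B \<psi> where B: "finite B" "independent B" "span B = orbit d" "\<And>b. functional (\<psi> b)"
    "\<And>b c. b \<in> B \<Longrightarrow> c \<in> B \<Longrightarrow> \<psi> b c = (if b = c then 1 else 0)"
    "\<And>v. v \<in> orbit d \<Longrightarrow> (\<Sum>b\<in>B. scale (\<psi> b v) b) = v"
    by (rule dual_basis[OF fdD]) (rule that)
  have "simple_subcoalgebra scale comult counit antipode K (orbit d) d B \<psi>"
  proof (intro simple_subcoalgebra.intro simple_subcoalgebra_axioms.intro cocommutative_hopf_algebra_axioms)
    show "hopf_subalgebra K" "finite B" by fact+
    show "subcoalgebra (orbit d)" "d \<in> orbit d" by (rule subcoalgebra_orbit, rule orbit_self)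
    show "B \<subseteq> orbit d" using B(3) span_superset by blast
    show "\<exists>\<phi>. functional \<phi> \<and> ract \<phi> d = y" if "y \<in> orbit d" for y using that unfolding orbit_def by blast
    show "\<exists>\<phi>. functional \<phi> \<and> ract \<phi> y = d" if y: "y \<in> orbit d" "y \<noteq> 0" for y
    proof -
      obtain \<phi> where \<phi>: "y = ract \<phi> d" using y unfolding orbit_def by blast
      have "ract \<phi> t \<notin> N"
      proof
        assume "ract \<phi> t \<in> N"
        hence "ract l (ract \<phi> t) = 0" by (rule lN)
        thus False using y(2) ract_commute[of l \<phi> t] unfolding \<phi> d_def by simp
      qed
      then obtain \<theta> where "functional \<theta>" "ract \<theta> (ract \<phi> t) = t" using return by blast
      thus ?thesis unfolding \<phi> d_def by (metis ract_commute)
    qed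
    show "functional (\<psi> b)" for b by (rule B(4))
    show "\<psi> b c = (if b = c then 1 else 0)" if "b \<in> B" "c \<in> B" for b c using that by (rule B(5))
    show "(\<Sum>b\<in>B. scale (\<psi> b y) b) = y" if "y \<in> orbit d" for y using that by (rule B(6))
  qed
  thus ?thesis using t(2) ann by blast
qed

lemma expands_UNIV:
  assumes K: "hopf_subalgebra K" and C: "fd_subspace C" "C \<subseteq> K" and exp: "expands C c K"
  shows "expands C c UNIV"
proof -
  let ?A = "{N. hopf_submodule K N \<and> expands C c N}"
  \<comment> \<open>The zero submodule starts the application of Zorn's lemma.\<close>
  have "subcoalgebra {0}" unfolding subcoalgebra_iff by (simp add: ract.zero)
  hence "{0} \<in> ?A"
  proof -
    have "dim E = 0" if "E \<subseteq> {0}" for E using dim_le_card[of E "{}"] that by simp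
    thus ?thesis using \<open>subcoalgebra {0}\<close> unfolding hopf_submodule_def expands_def by simp
  qed
  moreover have "\<Union>\<C> \<in> ?A" if ch: "\<C> \<noteq> {}" "subset.chain ?A \<C>" for \<C>
  proof -
    have sub: "hopf_submodule K X" "expands C c X" "subcoalgebra X" "subspace X" if "X \<in> \<C>" for X
      using ch(2) that subcoalgebra_subspace unfolding subset_chain_def hopf_submodule_def by auto
    have "subspace (\<Union>\<C>)"
    proof (rule subspaceI)
      show "0 \<in> \<Union>\<C>" using ch(1) sub(4) subspace_0 by blast
      show "x + y \<in> \<Union>\<C>" if xy: "x \<in> \<Union>\<C>" "y \<in> \<Union>\<C>" for x y
      proof -
        obtain X Y where "X \<in> \<C>" "Y \<in> \<C>" "x \<in> X" "y \<in> Y" using xy by blast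
        moreover from this have "X \<subseteq> Y \<or> Y \<subseteq> X" using ch(2) unfolding subset_chain_def by blast
        ultimately show ?thesis using sub(4) subspace_add by blast
      qed
      show "scale a x \<in> \<Union>\<C>" if "x \<in> \<Union>\<C>" for a x using that sub(4) subspace_scale by blast
    qed
    hence "subcoalgebra (\<Union>\<C>)" using sub(3) subcoalgebra_ract unfolding subcoalgebra_iff by blast
    hence "hopf_submodule K (\<Union>\<C>)" using sub(1) unfolding hopf_submodule_def by blast
    moreover have "expands C c (\<Union>\<C>)"
      unfolding expands_def
    proof (intro allI impI, elim conjE)
      fix E assume E: "fd_subspace E" "subcoalgebra E" "E \<subseteq> \<Union>\<C>"
      obtain S where S: "finite S" "E = span S" using E(1) unfolding fd_subspace_def by blast
      have "S \<subseteq> \<Union>\<C>" using S(2) E(3) span_superset by blast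
      then obtain X where X: "X \<in> \<C>" "S \<subseteq> X"
        by (rule finite_subset_Union_chain[OF S(1) _ ch])
      have "E \<subseteq> X" unfolding S(2) using X sub(4) by (intro span_minimal) auto
      thus "c * real (dim E) \<le> real (dim (prod_span C E))"
        using sub(2)[OF X(1)] E unfolding expands_def by blast
    qed
    ultimately show ?thesis by blast
  qed
  ultimately have "\<exists>M\<in>?A. \<forall>X\<in>?A. M \<subseteq> X \<longrightarrow> X = M" by (intro subset_Zorn_nonempty) auto
  then obtain M where M: "hopf_submodule K M" "expands C c M"
    and max: "\<And>X. hopf_submodule K X \<Longrightarrow> expands C c X \<Longrightarrow> M \<subseteq> X \<Longrightarrow> X = M" by auto
  have "M = UNIV"
  proof (rule ccontr)
    assume "M \<noteq> UNIV"
    then obtain D d B \<psi> t where s: "simple_subcoalgebra scale comult counit antipode K D d B \<psi>"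
      and t: "t \<notin> M" "\<forall>\<phi>. functional \<phi> \<longrightarrow> ract \<phi> d = 0 \<longrightarrow> ract \<phi> t \<in> M"
      using exists_simple_subcoalgebra[OF K M(1)] by blast
    interpret s: simple_subcoalgebra scale comult counit antipode K D d B \<psi> by (rule s)
    interpret x: hopf_submodule_extension scale comult counit antipode K D d B \<psi> C c M t
      by unfold_locales (use C exp M t in auto)
    show False using x.strict_extension[OF M(2)] max by blast
  qed
  thus ?thesis using M(2) by simp
qed

lemma amenable_hopf_subalgebra:
  assumes H: "amenable UNIV" and K: "hopf_subalgebra K"
  shows "amenable K"
proof (rule ccontr)
  assume na: "\<not> amenable K"
  have K1: "subcoalgebra K" "1 \<in> K" using K unfolding hopf_subalgebra_def subalgebra_def by auto
  obtain C \<epsilon> where C: "fd_subspace C" "subcoalgebra C" "1 \<in> C" "C \<subseteq> K" "0 < (\<epsilon>::real)"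
    and exp: "\<And>E. fd_subspace E \<Longrightarrow> subcoalgebra E \<Longrightarrow> E \<subseteq> K \<Longrightarrow>
      (1 + \<epsilon>) * real (dim E) \<le> real (dim (prod_span C E))"
    by (rule not_amenable_expanding[OF K1 na]) (rule that)
  have "expands C (1 + \<epsilon>) UNIV"
    using C exp by (intro expands_UNIV[OF K]) (auto simp: expands_def)
  \<comment> \<open>Amenability of \<open>H\<close> is tested at the same \<open>C\<close> and
    \<open>\<epsilon>\<close> that witness the failure for \<open>K\<close>; the strict bound on the
    quotient contradicts the factor \<open>1 + \<epsilon>\<close>.\<close>
  moreover obtain E where E: "fd_subspace E" "subcoalgebra E"
    "real (dim_quot (E + prod_span C E) E) < \<epsilon> * real (dim E)"
    using H C(1,5) unfolding amenable_def by blast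
  ultimately have "(1 + \<epsilon>) * real (dim E) \<le> real (dim (prod_span C E))" unfolding expands_def by blast
  also have "\<dots> \<le> real (dim (E + prod_span C E))"
  proof -
    have "prod_span C E \<subseteq> E + prod_span C E"
      using subspace_0[OF fd_subspaceD[OF E(1)]] by (force simp: set_plus_def)
    moreover have "fd_subspace (E + prod_span C E)"
      using E(1) C(1) by (intro fd_subspace_sum mult_action.fd_act_span)
    ultimately show ?thesis using fd_dim_mono by (intro of_nat_mono)
  qed
  finally show False
    using E(3) dim_quot_plus[OF E(1) C(1)] by (simp add: of_nat_diff algebra_simps)
qed

end

subsection \<open>Amenability\<close>

theorem theorem4:
  fixes scale :: "'k::field \<Rightarrow> 'a::ring_1 \<Rightarrow> 'a"
    and comult :: "'a \<Rightarrow> (('a \<times> 'a) \<Rightarrow>\<^sub>0 'k)"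
    and counit :: "'a \<Rightarrow> 'k"
    and antipode :: "'a \<Rightarrow> 'a"
  assumes "hopf_algebra scale comult counit antipode"
  shows
    "(coalgebra.cocommutative scale comult \<and> hopf_algebra.amenable scale comult UNIV \<longrightarrow>
        (\<forall>K. hopf_algebra.hopf_subalgebra scale comult antipode K \<longrightarrow>
             hopf_algebra.amenable scale comult K))
     \<and>
     (\<forall>(I :: 'i set) (H :: 'i \<Rightarrow> 'a set).
        I \<noteq> {} \<and>
        (\<forall>i\<in>I. hopf_algebra.hopf_subalgebra scale comult antipode (H i)) \<and>
        (\<forall>i\<in>I. \<forall>j\<in>I. \<exists>k\<in>I. H i \<union> H j \<subseteq> H k) \<and>
        (\<Union>i\<in>I. H i) = UNIV \<and>
        (\<forall>i\<in>I. hopf_algebra.amenable scale comult (H i))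
        \<longrightarrow> hopf_algebra.amenable scale comult UNIV)
     \<and>
     (unital_algebra.locally_subexp_growth scale \<longrightarrow> hopf_algebra.amenable scale comult UNIV)
     \<and>
     ((\<forall>x y :: 'a. x * y = y * x) \<longrightarrow> hopf_algebra.amenable scale comult UNIV)"
proof -
  interpret hopf_algebra scale comult counit antipode by fact
  have 1: "amenable K" if "cocommutative" "amenable UNIV" "hopf_subalgebra K" for K
  proof -
    interpret cocommutative_hopf_algebra scale comult counit antipode
      by unfold_locales (rule that(1))
    show ?thesis by (rule amenable_hopf_subalgebra[OF that(2,3)])
  qed
  have 2: "amenable UNIV"
    if "I \<noteq> {}" "\<forall>i\<in>I. hopf_subalgebra (H i)" "\<forall>i\<in>I. \<forall>j\<in>I. \<exists>k\<in>I. H i \<union> H j \<subseteq> H k"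
      "(\<Union>i\<in>I. H i) = UNIV" "\<forall>i\<in>I. amenable (H i)" for I :: "'i set" and H :: "'i \<Rightarrow> 'a set"
    using that by (intro amenable_directed_union[of I H]) auto
  show ?thesis
  proof (intro conjI allI impI; (elim conjE)?)
    show "amenable K" if "cocommutative" "amenable UNIV" "hopf_subalgebra K" for K
      using that by (rule 1)
    show "amenable UNIV"
      if "I \<noteq> {}" "\<forall>i\<in>I. hopf_subalgebra (H i)" "\<forall>i\<in>I. \<forall>j\<in>I. \<exists>k\<in>I. H i \<union> H j \<subseteq> H k"
        "(\<Union>i\<in>I. H i) = UNIV" "\<forall>i\<in>I. amenable (H i)" for I :: "'i set" and H :: "'i \<Rightarrow> 'a set"
      using that by (rule 2)
    show "amenable UNIV" if "locally_subexp_growth" using that by (rule amenable_of_subexp_growth)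
    show "amenable UNIV" if "\<forall>x y :: 'a. x * y = y * x"
      using that by (intro amenable_of_commutative) blast
  qed
qed

end
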